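(* Let $n \geq 2$, let $(z,w) \in \mathbb{C}^n \times \mathbb{C}$ be the coordinates and, near the origin, let $M \subset \mathbb{C}^{n+1}$ be a submanifold of real codimension 2 given by $$w = \rho(z,\bar z) = Q(z,\bar z) + E(z,\bar z) = z^* A z + \overline{z^t B z} + z^t C z + E(z,\bar z),$$ where $\rho$ is real-analytic, $A,B,C$ are complex $n\times n$ matrices, $B$ and $C$ are symmetric, and $E$ is $O(\|z\|^3)$. Assume $$\operatorname{rank}\begin{bmatrix} A^* \\ B\end{bmatrix} \geq 2 .$$ Suppose $f(z,\bar z)$ is a real-analytic function defined near the origin that, when considered as a function on $M$ (parametrized by $z$), is a CR function on $M_{\mathit{CR}}$. Then there exists a unique holomorphic function $F(z,w)$ defined near the origin such that $f$ and $F$ agree on $M$, that is, $$f(z,\bar z) = F\bigl(z,\rho(z,\bar z)\bigr).$$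
   Context: Vectors $z\in\mathbb{C}^n$ are columns; $z^t$ is the transpose, $z^*$ the conjugate transpose, and $A^*$ the conjugate transpose of $A$. $\begin{bmatrix} A^* \\ B\end{bmatrix}$ is the $2n\times n$ matrix obtained by stacking $A^*$ on top of $B$. Functions are complex-valued; $\rho$ is not assumed real-valued, so the equation $w=\rho(z,\bar z)$ is two real equations. For a real submanifold $M\subset\mathbb{C}^{n+1}$ and $p\in M$, put $$T^{0,1}_pM = (\mathbb{C}\otimes T_pM)\cap \operatorname{span}_{\mathbb{C}}\Bigl\{\tfrac{\partial}{\partial \bar z_1}\big|_p,\ldots,\tfrac{\partial}{\partial \bar z_n}\big|_p,\tfrac{\partial}{\partial \bar w}\big|_p\Bigr\}.$$ $M_{\mathit{CR}}\subset M$ is the set of CR points, i.e. points near which $\dim_{\mathbb{C}} T^{0,1}_pM$ is constant as $p\in M$ varies; the other points are CR singular. A CR vector field is a vector field on $M$ with values in $T^{0,1}M$. A function is CR (on $M_{\mathit{CR}}$) if it is annihilated by every CR vector field (on $M_{\mathit{CR}}$). Since $M$ is a graph over $z$, a function $f(z,\bar z)$ is regarded as the function on $M$ whose value at $(z,\rho(z,\bar z))$ is $f(z,\bar z)$. *)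

theory Defs
  imports "HOL-Analysis.Analysis" "HOL-Library.Landau_Symbols"
begin

section \<open>Real-analytic, smooth and holomorphic functions of several variables\<close>

text \<open>Power series in the real coordinates \<open>(x - p) \<bullet> b\<close>, \<open>b \<in> Basis\<close>. For \<open>complex^'n\<close> these are the
  real and imaginary parts of the components. Multi-indices are functions vanishing outside \<open>Basis\<close>;
  \<open>has_sum\<close> is unconditional summation.\<close>

definition multi_indices :: "('a::euclidean_space \<Rightarrow> nat) set" where
  "multi_indices = {\<alpha>. \<forall>b. b \<notin> Basis \<longrightarrow> \<alpha> b = 0}"

definition real_analytic_on :: "('a::euclidean_space \<Rightarrow> 'b::real_normed_vector) \<Rightarrow> 'a set \<Rightarrow> bool"
    (infixl "real'_analytic'_on" 50) where
  "f real_analytic_on S \<longleftrightarrow>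
     (\<forall>p\<in>S. \<exists>r>0. \<exists>c. \<forall>x\<in>ball p r.
        ((\<lambda>\<alpha>. (\<Prod>b\<in>Basis. ((x - p) \<bullet> b) ^ \<alpha> b) *\<^sub>R c \<alpha>) has_sum f x) multi_indices)"

text \<open>Class \<open>C\<^sup>k\<close> on an open set of a finite-dimensional space.\<close>

primrec Ck_on :: "nat \<Rightarrow> 'a::euclidean_space set \<Rightarrow> ('a \<Rightarrow> 'b::real_normed_vector) \<Rightarrow> bool" where
  "Ck_on 0 S f \<longleftrightarrow> continuous_on S f"
| "Ck_on (Suc k) S f \<longleftrightarrow>
     (\<exists>f'. (\<forall>x\<in>S. (f has_derivative f' x) (at x)) \<and> (\<forall>v. Ck_on k S (\<lambda>x. f' x v)))"

text \<open>Smoothness on an arbitrary subset of a Euclidean space, by local smooth extension to the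
  ambient space; on an embedded submanifold this is intrinsic smoothness.\<close>

definition smooth_on_subset :: "'a::euclidean_space set \<Rightarrow> ('a \<Rightarrow> 'b::real_normed_vector) \<Rightarrow> bool" where
  "smooth_on_subset S f \<longleftrightarrow>
     (\<forall>p\<in>S. \<exists>N g. open N \<and> p \<in> N \<and> (\<forall>k. Ck_on k N g) \<and> (\<forall>q\<in>S \<inter> N. g q = f q))"

text \<open>\<open>\<complex>\<^sup>n\<^sup>+\<^sup>1\<close> is \<open>complex^'n \<times> complex\<close>, with coordinates \<open>(z, w)\<close>.\<close>

definition cmult :: "complex \<Rightarrow> (complex^'n) \<times> complex \<Rightarrow> (complex^'n) \<times> complex" where
  "cmult c v = (c *s fst v, c * snd v)"

definition holomorphic_several_on ::
    "((complex^'n) \<times> complex \<Rightarrow> complex) \<Rightarrow> ((complex^'n) \<times> complex) set \<Rightarrow> bool"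
    (infixl "holomorphic'_several'_on" 50) where
  "F holomorphic_several_on W \<longleftrightarrow>
     (\<forall>p\<in>W. \<exists>D. (F has_derivative D) (at p) \<and> (\<forall>c v. D (cmult c v) = c * D v))"


section \<open>Tangent vectors and their complexification\<close>

text \<open>\<open>\<gamma>\<close> is a curve in \<open>M\<close> with \<open>\<gamma>(0) = p\<close> and \<open>\<gamma>'(0) = v\<close>.\<close>

definition curve_in :: "'a::real_normed_vector set \<Rightarrow> 'a \<Rightarrow> 'a \<Rightarrow> (real \<Rightarrow> 'a) \<Rightarrow> bool" where
  "curve_in M p v \<gamma> \<longleftrightarrow>
     \<gamma> 0 = p \<and> (\<forall>\<^sub>F t in nhds 0. \<gamma> t \<in> M) \<and> (\<gamma> has_vector_derivative v) (at 0)"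

definition tangent_space :: "'a::real_normed_vector set \<Rightarrow> 'a \<Rightarrow> 'a set" where
  "tangent_space M p = {v. \<exists>\<gamma>. curve_in M p v \<gamma>}"

text \<open>The complexification \<open>\<complex> \<otimes> V\<close> of a real vector space \<open>V\<close> is modelled by \<open>V \<times> V\<close>, the pair \<open>(X, Y)\<close>
  standing for \<open>X + \<i> Y\<close>. For \<open>V = \<complex>\<^sup>n\<^sup>+\<^sup>1\<close> this formal \<open>\<i>\<close> is not multiplication by \<open>\<i>\<close>
  on \<open>\<complex>\<^sup>n\<^sup>+\<^sup>1\<close>, which is \<^term>\<open>cmult \<i>\<close>.\<close>

definition cscale :: "complex \<Rightarrow> 'a::real_vector \<times> 'a \<Rightarrow> 'a \<times> 'a" where
  "cscale c Z = (Re c *\<^sub>R fst Z - Im c *\<^sub>R snd Z, Re c *\<^sub>R snd Z + Im c *\<^sub>R fst Z)"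

interpretation ctensor: vector_space cscale
  by unfold_locales (simp_all add: cscale_def algebra_simps)

definition complexify :: "'a::real_vector set \<Rightarrow> ('a \<times> 'a) set" where
  "complexify V = V \<times> V"

text \<open>If \<open>e\<close> is the coordinate vector \<open>\<partial>/\<partial>x\<close> of a complex coordinate \<open>x + \<i> y\<close>, then
  \<open>\<partial>/\<partial>y\<close> is \<open>cmult \<i> e\<close>, and this is \<open>(\<partial>/\<partial>x + \<i> \<partial>/\<partial>y) / 2\<close>.\<close>

definition dbar_vector ::
    "(complex^'n) \<times> complex \<Rightarrow> ((complex^'n) \<times> complex) \<times> ((complex^'n) \<times> complex)" where
  "dbar_vector e = cscale (1/2) (e, cmult \<i> e)"

definition antiholomorphic_vectors ::
    "(((complex^'n) \<times> complex) \<times> ((complex^'n) \<times> complex)) set" where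
  "antiholomorphic_vectors =
     ctensor.span (insert (dbar_vector (0, 1)) (range (\<lambda>j. dbar_vector (axis j 1, 0))))"

definition T01 ::
    "((complex^'n) \<times> complex) set \<Rightarrow> (complex^'n) \<times> complex \<Rightarrow>
     (((complex^'n) \<times> complex) \<times> ((complex^'n) \<times> complex)) set" where
  "T01 M p = complexify (tangent_space M p) \<inter> antiholomorphic_vectors"


section \<open>CR points, CR vector fields, CR functions\<close>

definition CR_points :: "((complex^'n) \<times> complex) set \<Rightarrow> ((complex^'n) \<times> complex) set" where
  "CR_points M =
     {p \<in> M. \<exists>N. open N \<and> p \<in> N \<and> (\<forall>q\<in>M \<inter> N. ctensor.dim (T01 M q) = ctensor.dim (T01 M p))}"

text \<open>A smooth CR vector field on the part \<open>S\<close> of \<open>M\<close>; values outside \<open>S\<close> are irrelevant.\<close>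

definition CR_vector_field ::
    "((complex^'n) \<times> complex) set \<Rightarrow> ((complex^'n) \<times> complex) set \<Rightarrow>
     ((complex^'n) \<times> complex \<Rightarrow> ((complex^'n) \<times> complex) \<times> ((complex^'n) \<times> complex)) \<Rightarrow> bool" where
  "CR_vector_field M S Z \<longleftrightarrow> smooth_on_subset S Z \<and> (\<forall>p\<in>S. Z p \<in> T01 M p)"

text \<open>\<open>v g = L\<close> for a function \<open>g\<close> on \<open>M\<close> and a real tangent vector \<open>v\<close> to \<open>M\<close> at \<open>p\<close>. Only the values
  of \<open>g\<close> on \<open>M\<close> matter.\<close>

definition has_tangential_derivative ::
    "'a::real_normed_vector set \<Rightarrow> ('a \<Rightarrow> complex) \<Rightarrow> 'a \<Rightarrow> 'a \<Rightarrow> complex \<Rightarrow> bool" where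
  "has_tangential_derivative M g p v L \<longleftrightarrow>
     (\<forall>\<gamma>. curve_in M p v \<gamma> \<longrightarrow> ((\<lambda>t. g (\<gamma> t)) has_vector_derivative L) (at 0))"

text \<open>The complexified tangent vector \<open>X + \<i> Y\<close> acts by \<open>X g + \<i> (Y g)\<close>.\<close>

definition annihilates ::
    "'a::real_normed_vector set \<Rightarrow> 'a \<Rightarrow> 'a \<times> 'a \<Rightarrow> ('a \<Rightarrow> complex) \<Rightarrow> bool" where
  "annihilates M p Z g \<longleftrightarrow>
     (\<exists>a b. has_tangential_derivative M g p (fst Z) a \<and>
            has_tangential_derivative M g p (snd Z) b \<and> a + \<i> * b = 0)"

definition CR_function ::
    "((complex^'n) \<times> complex) set \<Rightarrow> ((complex^'n) \<times> complex \<Rightarrow> complex) \<Rightarrow> bool" where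
  "CR_function M g \<longleftrightarrow>
     (\<forall>Z. CR_vector_field M (CR_points M) Z \<longrightarrow> (\<forall>p\<in>CR_points M. annihilates M p (Z p) g))"


section \<open>Graphs, quadratic forms and matrices\<close>

definition graph_over :: "(complex^'n) set \<Rightarrow> (complex^'n \<Rightarrow> complex) \<Rightarrow> ((complex^'n) \<times> complex) set" where
  "graph_over U \<rho> = {(z, \<rho> z) | z. z \<in> U}"

definition cnj_vec :: "complex^'n \<Rightarrow> complex^'n" where
  "cnj_vec z = (\<chi> i. cnj (z $ i))"

definition conj_transpose :: "complex^'n^'m \<Rightarrow> complex^'m^'n" where
  "conj_transpose A = (\<chi> i j. cnj (A $ j $ i))"

text \<open>\<open>z\<^sup>* A z\<close>\<close>

definition sesq_form :: "complex^'n^'n \<Rightarrow> complex^'n \<Rightarrow> complex" where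
  "sesq_form A z = scalar_product (cnj_vec z) (A *v z)"

text \<open>\<open>z\<^sup>t B z\<close>\<close>

definition quad_form :: "complex^'n^'n \<Rightarrow> complex^'n \<Rightarrow> complex" where
  "quad_form B z = scalar_product z (B *v z)"

text \<open>The first matrix on top of the second.\<close>

definition stack_rows :: "'a^'n^'m \<Rightarrow> 'a^'n^'k \<Rightarrow> 'a^'n^('m + 'k)" where
  "stack_rows A B = (\<chi> i. case i of Inl j \<Rightarrow> A $ j | Inr j \<Rightarrow> B $ j)"


section \<open>Holomorphic extension\<close>

text \<open>\<open>F\<close> is holomorphic on the neighbourhood \<open>W\<close> of the origin and agrees with \<open>f\<close> on the part of the
  graph of \<open>\<rho>\<close> over \<open>U\<close> that lies in \<open>W\<close>.\<close>

definition holomorphic_extension_near_0 ::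
    "(complex^'n) set \<Rightarrow> (complex^'n \<Rightarrow> complex) \<Rightarrow> (complex^'n \<Rightarrow> complex) \<Rightarrow>
     ((complex^'n) \<times> complex) set \<Rightarrow> ((complex^'n) \<times> complex \<Rightarrow> complex) \<Rightarrow> bool" where
  "holomorphic_extension_near_0 U \<rho> f W F \<longleftrightarrow>
     open W \<and> 0 \<in> W \<and> F holomorphic_several_on W \<and>
     (\<forall>z\<in>U. (z, \<rho> z) \<in> W \<longrightarrow> f z = F (z, \<rho> z))"

end

theory Submission
  imports Defs "HOL-Complex_Analysis.Complex_Analysis"
begin

text \<open>Replace \<open>cnj z\<close> by an independent variable \<open>\<xi>\<close>. Then \<open>\<rho>\<close> and \<open>f\<close> become holomorphic functions
  \<open>R(z, \<xi>)\<close> and \<open>G(z, \<xi>)\<close>, and \<open>f\<close> is CR exactly when \<open>d\<^sub>\<xi>G \<and> d\<^sub>\<xi>R = 0\<close>. The rank condition says that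
  two components of \<open>d\<^sub>\<xi>R\<close> have linearly independent linear parts at the origin, so \<open>d\<^sub>\<xi>R\<close> vanishes only in
  codimension two and division gives a holomorphic \<open>g\<^sub>1\<close> with \<open>d\<^sub>\<xi>G = g\<^sub>1 d\<^sub>\<xi>R\<close>. Again
  \<open>d\<^sub>\<xi>g\<^sub>1 \<and> d\<^sub>\<xi>R = 0\<close>, so iteration gives \<open>g\<^sub>0 = G\<close> and \<open>d\<^sub>\<xi>g\<^sub>k = g\<^sub>k\<^sub>+\<^sub>1 d\<^sub>\<xi>R\<close>. Here \<open>g\<^sub>k\<close> has to be the
  \<open>k\<close>-th \<open>w\<close>-derivative of the extension along \<open>w = R(z, \<xi>)\<close>. Cauchy estimates away from the zeros of
  \<open>d\<^sub>\<xi>R\<close> and the maximum principle give \<open>\<bar>g\<^sub>k\<bar> \<le> M K\<^sup>k k!\<close>, so that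
  \<open>F(z, w) = \<Sum>\<^sub>k g\<^sub>k(z, 0) (w - R(z, 0))\<^sup>k / k!\<close> converges.\<close>

text \<open>The \<xi>-gradient of R vanishes at the origin, exactly where the extension is wanted,
  so quotients cannot be estimated there directly. They are controlled on complex lines: in a
  direction u each line meets the zeros of one component of the gradient at most once, and bounds on
  a circle that avoids this zero pass to its inside by the maximum principle. This is why holomorphy
  is defined through lines: one-variable theorems and compactness then suffice. At a common zero of
  two components one first moves off in a second direction v. Two features make the factorial bounds
  possible. Division works on the whole ball, so all \<open>g\<^sub>k\<close> live on one domain;
  and the estimate of \<open>g\<^sub>k\<close> starts afresh from the bound of
  \<open>g\<^sub>0\<close>, spending a fixed radius in equal portions over k Cauchy estimates, which
  costs about k^k. The CR condition is known only on \<xi> = cnj z. This subspace is totally real of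
  full dimension, so identities on it hold for all (z, \<xi>). Where the antiholomorphic derivatives
  of \<rho> vanish the relation is trivial, so CR singular points require no limiting
  argument.\<close>

no_notation fps_nth (infixl \<open>$\<close> 75)

section \<open>Functions holomorphic on complex lines\<close>

text \<open>The variables (z, w) and (z, \<xi>) live in different product types. One class over
  \<open>euclidean_space\<close> serves both and keeps compactness of balls and real Frechet
  derivatives available.\<close>

class complex_space = euclidean_space +
  fixes scaleC :: "complex \<Rightarrow> 'a \<Rightarrow> 'a" (infixr "*c" 75)
  assumes scaleC_add_right: "c *c (x + y) = c *c x + c *c y"
    and scaleC_add_left: "(c + d) *c x = c *c x + d *c x"
    and scaleC_scaleC: "c *c d *c x = (c * d) *c x"
    and scaleC_of_real: "of_real r *c x = r *\<^sub>R x"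
    and norm_scaleC: "norm (c *c x) = cmod c * norm x"

instantiation complex :: complex_space
begin
definition scaleC_complex :: "complex \<Rightarrow> complex \<Rightarrow> complex" where "scaleC_complex c x = c * x"
instance
  by standard (simp_all add: scaleC_complex_def algebra_simps norm_mult scaleR_conv_of_real)
end

instantiation vec :: (complex_space, finite) complex_space
begin
definition scaleC_vec :: "complex \<Rightarrow> 'a^'b \<Rightarrow> 'a^'b" where "scaleC_vec c x = (\<chi> i. c *c x $ i)"
instance
proof
  fix c :: complex and x :: "'a^'b"
  have "norm (c *c x) = L2_set (\<lambda>i. cmod c * norm (x $ i)) UNIV"
    by (simp add: norm_vec_def scaleC_vec_def norm_scaleC)
  then show "norm (c *c x) = cmod c * norm x"
    by (simp add: norm_vec_def L2_set_right_distrib)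
qed (simp_all add: scaleC_vec_def vec_eq_iff scaleC_add_left scaleC_add_right scaleC_scaleC scaleC_of_real)
end

instantiation prod :: (complex_space, complex_space) complex_space
begin
definition scaleC_prod :: "complex \<Rightarrow> 'a \<times> 'b \<Rightarrow> 'a \<times> 'b" where
  "scaleC_prod c x = (c *c fst x, c *c snd x)"
instance
proof
  fix c :: complex and x :: "'a \<times> 'b"
  have "norm (c *c x) = sqrt ((cmod c)\<^sup>2 * ((norm (fst x))\<^sup>2 + (norm (snd x))\<^sup>2))"
    by (simp add: norm_prod_def scaleC_prod_def norm_scaleC power_mult_distrib algebra_simps)
  then show "norm (c *c x) = cmod c * norm x"
    by (simp add: norm_prod_def real_sqrt_mult)
qed (simp_all add: scaleC_prod_def prod_eq_iff scaleC_add_left scaleC_add_right scaleC_scaleC scaleC_of_real)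
end

lemma scaleC_simps [simp]:
  fixes x :: "'a::complex_space"
  shows "1 *c x = x" "0 *c x = 0" "c *c (0::'a) = 0" "c *c d *c x = (c * d) *c x"
    "(- c) *c x = - (c *c x)" "c *c (- x) = - (c *c x)"
proof -
  show a: "1 *c x = x" using scaleC_of_real[of 1 x] by simp
  show b: "0 *c x = 0" using scaleC_of_real[of 0 x] by simp
  show c: "c *c (0::'a) = 0" using scaleC_add_right[of c "0::'a" 0] by simp
  show "c *c d *c x = (c * d) *c x" by (rule scaleC_scaleC)
  show "(- c) *c x = - (c *c x)" using scaleC_add_left[of c "-c" x] b
    by (intro minus_unique[symmetric]) simp
  show "c *c (- x) = - (c *c x)" using scaleC_add_right[of c x "-x"] c
    by (intro minus_unique[symmetric]) simp
qed

lemma scaleC_diff_left: "(c - d) *c (x::'a::complex_space) = c *c x - d *c x"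
  using scaleC_add_left[of c "-d" x] by simp

lemma scaleC_diff_right: "c *c (x - y::'a::complex_space) = c *c x - c *c y"
  using scaleC_add_right[of c x "-y"] by simp

lemma fst_scaleC [simp]: "fst (c *c x) = c *c fst x"
  and snd_scaleC [simp]: "snd (c *c x) = c *c snd x"
  and scaleC_Pair [simp]: "c *c (a, b) = (c *c a, c *c b)"
  by (simp_all add: scaleC_prod_def)

lemma vec_scaleC_nth [simp]: "(c *c x) $ i = c *c x $ i"
  by (simp add: scaleC_vec_def)

lemma complex_scaleC [simp]: "c *c (x::complex) = c * x"
  by (simp add: scaleC_complex_def)

lemma bounded_bilinear_scaleC: "bounded_bilinear (\<lambda>c (x::'a::complex_space). c *c x)"
proof
  fix r :: real and c :: complex and x :: 'a
  show "(r *\<^sub>R c) *c x = r *\<^sub>R c *c x"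
    by (metis scaleC_of_real scaleC_scaleC scaleR_conv_of_real)
  show "c *c r *\<^sub>R x = r *\<^sub>R c *c x"
    by (metis scaleC_of_real scaleC_scaleC mult.commute)
  show "\<exists>K. \<forall>a b. norm (a *c (b::'a)) \<le> norm a * norm b * K"
    by (intro exI[of _ 1]) (simp add: norm_scaleC)
qed (simp_all add: scaleC_add_right scaleC_add_left)

lemmas continuous_on_scaleC [continuous_intros] =
  bounded_bilinear.continuous_on[OF bounded_bilinear_scaleC]
lemmas tendsto_scaleC [tendsto_intros] =
  bounded_bilinear.tendsto[OF bounded_bilinear_scaleC]

text \<open>This is weaker than complex Frechet differentiability in form only (\<open>hol_has_derivative\<close>), and it
  passes to locally uniform limits at once.\<close>

definition hol :: "('a::complex_space \<Rightarrow> complex) \<Rightarrow> 'a set \<Rightarrow> bool" where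
  "hol f S \<longleftrightarrow> continuous_on S f \<and>
     (\<forall>p v. (\<lambda>t. f (p + t *c v)) holomorphic_on {t. p + t *c v \<in> S})"

definition cderiv :: "'a::complex_space \<Rightarrow> ('a \<Rightarrow> complex) \<Rightarrow> 'a \<Rightarrow> complex" where
  "cderiv v f p = deriv (\<lambda>t. f (p + t *c v)) 0"

lemma open_line: "open S \<Longrightarrow> open {t. p + t *c v \<in> S}"
  for p :: "'a::complex_space"
proof -
  assume "open S"
  moreover have "continuous_on UNIV (\<lambda>t. p + t *c v)" by (intro continuous_intros)
  ultimately show ?thesis
    using open_vimage[of S "\<lambda>t. p + t *c v"] by (simp add: vimage_def)
qed

lemma convex_line: "convex S \<Longrightarrow> convex {t. p + t *c v \<in> S}"
  for p :: "'a::complex_space"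
proof (rule convexI)
  fix x y :: complex and a b :: real
  assume S: "convex S" and x: "x \<in> {t. p + t *c v \<in> S}" and y: "y \<in> {t. p + t *c v \<in> S}"
    and ab: "0 \<le> a" "0 \<le> b" "a + b = 1"
  have "p + (a *\<^sub>R x + b *\<^sub>R y) *c v = a *\<^sub>R (p + x *c v) + b *\<^sub>R (p + y *c v)"
  proof -
    have "p = a *\<^sub>R p + b *\<^sub>R p" using ab by (metis scaleR_add_left scaleR_one)
    moreover have "(a *\<^sub>R x) *c v = a *\<^sub>R x *c v" "(b *\<^sub>R y) *c v = b *\<^sub>R y *c v"
      by (metis scaleC_of_real scaleC_scaleC scaleR_conv_of_real)+
    ultimately show ?thesis by (simp add: scaleC_add_left scaleR_add_right)
  qed
  then show "a *\<^sub>R x + b *\<^sub>R y \<in> {t. p + t *c v \<in> S}"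
    using S x y ab by (auto simp: convex_def)
qed

lemma line_cball:
  fixes p :: "'a::complex_space"
  assumes "open S" "p \<in> S"
  obtains r where "r > 0" "cball 0 r \<subseteq> {t. p + t *c v \<in> S}"
proof -
  have "0 \<in> {t. p + t *c v \<in> S}" using assms by simp
  then show ?thesis using open_line[OF assms(1), of p v] open_contains_cball that by blast
qed

lemma hol_DERIV:
  assumes "hol f S" "open S" "p + t *c v \<in> S"
  shows "((\<lambda>s. f (p + s *c v)) has_field_derivative cderiv v f (p + t *c v)) (at t)"
proof -
  have "((\<lambda>s. f (p + s *c v)) has_field_derivative deriv (\<lambda>s. f (p + s *c v)) t) (at t)"
    using assms open_line[OF \<open>open S\<close>, of p v] unfolding hol_def
    by (intro holomorphic_derivI[of _ "{t. p + t *c v \<in> S}"]) auto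
  then have "((\<lambda>s. f (p + (t + s) *c v)) has_field_derivative deriv (\<lambda>s. f (p + s *c v)) t) (at 0)"
    using DERIV_shift[of "(\<lambda>s. f (p + s *c v))" "deriv (\<lambda>s. f (p + s *c v)) t" 0 t]
    by (simp add: add.commute)
  then have "cderiv v f (p + t *c v) = deriv (\<lambda>s. f (p + s *c v)) t"
    unfolding cderiv_def by (intro DERIV_imp_deriv) (simp add: scaleC_add_left add.assoc)
  then show ?thesis
    using \<open>(_ has_field_derivative deriv _ t) (at t)\<close> by simp
qed

lemma hol_DERIV0:
  assumes "hol f S" "open S" "p \<in> S"
  shows "((\<lambda>s. f (p + s *c v)) has_field_derivative cderiv v f p) (at 0)"
  using hol_DERIV[OF assms(1,2), of p 0 v] assms(3) by simp

lemma cderiv_eqI: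
  "((\<lambda>s. f (p + s *c v)) has_field_derivative D) (at 0) \<Longrightarrow> cderiv v f p = D"
  unfolding cderiv_def by (rule DERIV_imp_deriv)

lemma hol_subset: "hol f S \<Longrightarrow> T \<subseteq> S \<Longrightarrow> hol f T"
  unfolding hol_def by (auto intro: continuous_on_subset holomorphic_on_subset)

lemma hol_continuous_on: "hol f S \<Longrightarrow> continuous_on S f"
  by (simp add: hol_def)

lemma hol_line: "hol f S \<Longrightarrow> (\<lambda>t. f (p + t *c v)) holomorphic_on {t. p + t *c v \<in> S}"
  by (simp add: hol_def)

text \<open>Line parameters other than 0 are reached by moving the base point p along v.\<close>

lemma holI:
  assumes "open S" "continuous_on S f"
    "\<And>p v. p \<in> S \<Longrightarrow> (\<lambda>t. f (p + t *c v)) field_differentiable at 0"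
  shows "hol f S"
  unfolding hol_def
proof (intro conjI allI assms)
  fix p v
  have "(\<lambda>s. f (p + s *c v)) field_differentiable at t" if "p + t *c v \<in> S" for t
  proof -
    have "(\<lambda>s. f ((p + t *c v) + s *c v)) field_differentiable at 0"
      by (rule assms(3)[OF that])
    then obtain D where "((\<lambda>s. f ((p + t *c v) + s *c v)) has_field_derivative D) (at 0)"
      by (auto simp: field_differentiable_def)
    then have "((\<lambda>s. f (p + (s + t) *c v)) has_field_derivative D) (at 0)"
      by (simp add: scaleC_add_left algebra_simps)
    then have "((\<lambda>s. f (p + s *c v)) has_field_derivative D) (at t)"
      using DERIV_shift[of "(\<lambda>s. f (p + s *c v))" D 0 t] by simp
    then show ?thesis by (auto simp: field_differentiable_def)
  qed
  then show "(\<lambda>t. f (p + t *c v)) holomorphic_on {t. p + t *c v \<in> S}"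
    by (simp add: holomorphic_on_open[OF open_line[OF assms(1)]] field_differentiable_def)
qed

lemma hol_local:
  assumes "open S" "\<And>p. p \<in> S \<Longrightarrow> \<exists>d>0. hol f (ball p d)"
  shows "hol f S"
proof (rule holI[OF assms(1)])
  show "continuous_on S f"
  proof (rule continuous_at_imp_continuous_on, rule ballI)
    fix p assume "p \<in> S"
    then obtain d where "d > 0" "hol f (ball p d)" using assms(2) by blast
    then show "isCont f p"
      using continuous_on_eq_continuous_at[of "ball p d" f] by (auto simp: hol_def)
  qed
next
  fix p v assume "p \<in> S"
  then obtain d where "d > 0" "hol f (ball p d)" using assms(2) by blast
  then show "(\<lambda>t. f (p + t *c v)) field_differentiable at 0"
    using hol_DERIV0[of f "ball p d" p v] by (auto simp: field_differentiable_def)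
qed

lemma hol_cong:
  assumes "\<And>x. x \<in> S \<Longrightarrow> f x = g x"
  shows "hol f S \<longleftrightarrow> hol g S"
proof -
  have "(\<lambda>t. f (p + t *c v)) holomorphic_on {t. p + t *c v \<in> S} \<longleftrightarrow>
        (\<lambda>t. g (p + t *c v)) holomorphic_on {t. p + t *c v \<in> S}" for p v
    by (rule holomorphic_cong) (auto simp: assms)
  moreover have "continuous_on S f \<longleftrightarrow> continuous_on S g"
    by (rule continuous_on_cong) (auto simp: assms)
  ultimately show ?thesis unfolding hol_def by simp
qed

named_theorems hol_intros

lemma hol_const [hol_intros]: "hol (\<lambda>x. c) S"
  by (auto simp: hol_def)
lemma hol_add [hol_intros]: "hol f S \<Longrightarrow> hol g S \<Longrightarrow> hol (\<lambda>x. f x + g x) S"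
  by (auto simp: hol_def intro!: continuous_intros holomorphic_intros)
lemma hol_diff [hol_intros]: "hol f S \<Longrightarrow> hol g S \<Longrightarrow> hol (\<lambda>x. f x - g x) S"
  by (auto simp: hol_def intro!: continuous_intros holomorphic_intros)
lemma hol_mult [hol_intros]: "hol f S \<Longrightarrow> hol g S \<Longrightarrow> hol (\<lambda>x. f x * g x) S"
  by (auto simp: hol_def intro!: continuous_intros holomorphic_intros)
lemma hol_divide [hol_intros]:
  "hol f S \<Longrightarrow> hol g S \<Longrightarrow> (\<And>x. x \<in> S \<Longrightarrow> g x \<noteq> 0) \<Longrightarrow> hol (\<lambda>x. f x / g x) S"
  by (auto simp: hol_def intro!: continuous_intros holomorphic_intros)
lemma hol_power [hol_intros]: "hol f S \<Longrightarrow> hol (\<lambda>x. f x ^ n) S"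
  by (auto simp: hol_def intro!: continuous_intros holomorphic_intros)
lemma hol_sum [hol_intros]: "(\<And>i. i \<in> I \<Longrightarrow> hol (f i) S) \<Longrightarrow> hol (\<lambda>x. \<Sum>i\<in>I. f i x) S"
  by (auto simp: hol_def intro!: continuous_intros holomorphic_intros)
lemma hol_prod [hol_intros]: "(\<And>i. i \<in> I \<Longrightarrow> hol (f i) S) \<Longrightarrow> hol (\<lambda>x. \<Prod>i\<in>I. f i x) S"
  by (auto simp: hol_def intro!: continuous_intros holomorphic_intros)

lemma hol_compose_affine:
  assumes "hol f T" "bounded_linear L" "\<And>c v. L (c *c v) = c *c L v"
    "\<And>x. x \<in> S \<Longrightarrow> a + L x \<in> T"
  shows "hol (\<lambda>x. f (a + L x)) S"
  unfolding hol_def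
proof (intro conjI allI)
  interpret L: bounded_linear L by fact
  show "continuous_on S (\<lambda>x. f (a + L x))"
    by (rule continuous_on_compose2[OF hol_continuous_on[OF assms(1)]])
       (use assms(4) in \<open>auto intro!: continuous_intros L.continuous_on\<close>)
  fix p v
  have "(\<lambda>t. f ((a + L p) + t *c L v)) holomorphic_on {t. (a + L p) + t *c L v \<in> T}"
    by (rule hol_line[OF assms(1)])
  then have "(\<lambda>t. f ((a + L p) + t *c L v)) holomorphic_on {t. p + t *c v \<in> S}"
    by (rule holomorphic_on_subset) (use assms(4) in \<open>auto simp: L.add assms(3) add.assoc[symmetric] dest!: \<close>,
      metis L.add add.assoc assms(3,4))
  then show "(\<lambda>t. f (a + L (p + t *c v))) holomorphic_on {t. p + t *c v \<in> S}"
    by (simp add: L.add assms(3) add.assoc)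
qed

lemma hol_linear:
  assumes "bounded_linear L" "\<And>c v. L (c *c v) = c * L v"
  shows "hol L S"
proof -
  have "(\<lambda>t. L p + t * L v) holomorphic_on X" for p v X
    by (intro holomorphic_intros)
  then show ?thesis
    unfolding hol_def using assms bounded_linear.linear[OF assms(1)]
    by (auto simp: linear_add intro: linear_continuous_on)
qed

text \<open>The second derivative is bounded by Cauchy's estimate on discs of radius R/4 about
  points of the disc of radius R/2: 2! (K + 1) / (R/4)^2 = 32 (K + 1) / R^2. Passing from K to K + 1
  gives the strict bound that \<open>Cauchy_higher_deriv_bound\<close> asks for.\<close>

lemma taylor_bound_one_variable:
  assumes hol: "\<phi> holomorphic_on ball 0 R" and K: "\<And>z. z \<in> ball 0 R \<Longrightarrow> cmod (\<phi> z) \<le> K"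
    and z: "cmod z < R / 2"
  shows "cmod (\<phi> z - \<phi> 0 - z * deriv \<phi> 0) \<le> 32 * (K + 1) / R\<^sup>2 * (cmod z)\<^sup>2"
proof -
  have R: "R > 0" using z norm_ge_zero[of z] by linarith
  define f where "f i = (deriv ^^ i) \<phi>" for i
  have hf: "f i holomorphic_on ball 0 R" for i
    unfolding f_def by (intro holomorphic_higher_deriv hol) auto
  have "cmod (f 0 z - (\<Sum>i\<le>1. f i 0 * (z-0) ^ i / (fact i))) \<le> 32 * (K + 1) / R\<^sup>2 * cmod(z - 0)^(Suc 1) / fact 1"
  proof (rule complex_Taylor[of "ball 0 (R/2)"])
    fix i :: nat and x :: complex assume "x \<in> ball 0 (R/2)"
    then have "x \<in> ball 0 R" using R by auto
    then have "(f i has_field_derivative f (Suc i) x) (at x)"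
      using holomorphic_derivI[OF hf[of i]] by (auto simp: f_def)
    then show "(f i has_field_derivative f (Suc i) x) (at x within ball 0 (R/2))"
      by (rule has_field_derivative_at_within)
  next
    fix x :: complex assume x: "x \<in> ball 0 (R/2)"
    have sub: "cball x (R/4) \<subseteq> ball 0 R"
      using x R by (auto simp: subset_iff dist_norm) (smt (verit) norm_minus_commute norm_triangle_sub field_sum_of_halves)
    have "cmod ((deriv ^^ 2) \<phi> x) \<le> fact 2 * (K+1) / (R/4)^2"
    proof (rule Cauchy_higher_deriv_bound[where y = 0])
      show "\<phi> holomorphic_on ball x (R / 4)" by (rule holomorphic_on_subset[OF hol]) (use sub in auto)
      show "continuous_on (cball x (R / 4)) \<phi>"
        by (rule holomorphic_on_imp_continuous_on[OF holomorphic_on_subset[OF hol sub]])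
      fix w assume "w \<in> ball x (R/4)"
      then have "w \<in> ball 0 R" using sub by (meson ball_subset_cball subsetD)
      from K[OF this] show "\<phi> w \<in> ball 0 (K+1)" by simp
    qed (use R in auto)
    moreover have "f (Suc 1) x = (deriv ^^ 2) \<phi> x" by (simp only: f_def one_add_one[symmetric] Suc_eq_plus1)
    moreover have "fact 2 * (K+1) / (R/4)^2 = 32 * (K + 1) / R\<^sup>2" by (simp add: power_divide)
    ultimately show "cmod (f (Suc 1) x) \<le> 32 * (K + 1) / R\<^sup>2" by simp
  qed (use z R in auto)
  then show ?thesis by (simp add: f_def algebra_simps power2_eq_square)
qed

text \<open>The point is uniformity: one K serves all base points q near p and all directions v.
  Uniformity in q makes difference quotients converge locally uniformly; uniformity in v, at t = 1,
  gives Frechet differentiability.\<close>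

lemma hol_taylor_bound:
  fixes p :: "'a::complex_space"
  assumes "hol f S" "open S" "p \<in> S"
  obtains r K where "r > 0" "K \<ge> 0" "ball p (2 * r) \<subseteq> S"
    "\<And>q v t. q \<in> ball p r \<Longrightarrow> norm (t *c v) < r \<Longrightarrow>
       cmod (f (q + t *c v) - f q - t * cderiv v f q) \<le> K * (norm v)\<^sup>2 * (cmod t)\<^sup>2"
proof -
  have "isCont f p" using assms continuous_on_eq_continuous_at[of S f] hol_continuous_on[of f S] by simp
  then obtain d0 where "d0 > 0" and d0: "\<And>x. dist x p < d0 \<Longrightarrow> dist (f x) (f p) < 1"
    unfolding continuous_at_eps_delta by (meson zero_less_one)
  obtain d1 where "d1 > 0" "ball p d1 \<subseteq> S" using assms open_contains_ball by blast
  define d where "d = min d0 d1"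
  have d: "d > 0" "ball p d \<subseteq> S" and bd: "\<And>x. x \<in> ball p d \<Longrightarrow> cmod (f x) \<le> cmod (f p) + 1"
  proof -
    show "d > 0" "ball p d \<subseteq> S" using \<open>d0 > 0\<close> \<open>d1 > 0\<close> \<open>ball p d1 \<subseteq> S\<close> by (auto simp: d_def)
    fix x assume "x \<in> ball p d"
    then have "dist (f x) (f p) < 1" by (intro d0) (auto simp: d_def dist_commute)
    then show "cmod (f x) \<le> cmod (f p) + 1" using norm_triangle_sub[of "f x" "f p"] by (simp add: dist_norm)
  qed
  define r where "r = d / 4"
  define C where "C = 32 * (cmod (f p) + 2) * 4 / d\<^sup>2"
  show ?thesis
  proof (rule that[of r C])
    show "r > 0" "C \<ge> 0" using d by (simp_all add: r_def C_def)
    show "ball p (2 * r) \<subseteq> S" using d by (auto simp: r_def)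
    fix q v :: 'a and t assume q: "q \<in> ball p r" and tv: "norm (t *c v) < r"
    show "cmod (f (q + t *c v) - f q - t * cderiv v f q) \<le> C * (norm v)\<^sup>2 * (cmod t)\<^sup>2"
    proof (cases "v = 0")
      case True
      then show ?thesis by (simp add: cderiv_def)
    next
      case False
      \<comment> \<open>Lines through q in the ball of radius d/4 stay in the ball of radius d for
        |s| < R, and |t v| < d/4 means |t| < R/2, as the one-variable bound requires.\<close>
      define R where "R = d / (2 * norm v)"
      have "R > 0" using False d by (simp add: R_def)
      have inb: "q + s *c v \<in> ball p d" if "s \<in> ball 0 R" for s
      proof -
        have "norm (s *c v) < d / 2"
          using that False by (simp add: norm_scaleC R_def field_simps)
        moreover have "dist p (q + s *c v) \<le> dist p q + norm (s *c v)"
          using dist_triangle[of p "q + s *c v" q] by (simp add: dist_norm)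
        ultimately show ?thesis using q d by (auto simp: r_def)
      qed
      have "cmod (f (q + t *c v) - f (q + 0 *c v) - t * deriv (\<lambda>s. f (q + s *c v)) 0)
          \<le> 32 * ((cmod (f p) + 1) + 1) / R\<^sup>2 * (cmod t)\<^sup>2"
      proof (rule taylor_bound_one_variable)
        show "(\<lambda>s. f (q + s *c v)) holomorphic_on ball 0 R"
          by (rule holomorphic_on_subset[OF hol_line[OF assms(1)]]) (use inb d in auto)
        show "cmod t < R / 2" using tv False by (simp add: norm_scaleC R_def r_def field_simps)
      qed (use inb bd in blast)
      also have "32 * ((cmod (f p) + 1) + 1) / R\<^sup>2 = C * (norm v)\<^sup>2"
        using False d by (simp add: R_def C_def field_simps power2_eq_square)
      finally show ?thesis by (simp add: cderiv_def)
    qed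
  qed
qed

text \<open>The filter is arbitrary because the limit is taken along sequences (difference
  quotients, the series for F) and also along finite sets of multi-indices in
  \<open>complexification\<close>.\<close>

lemma hol_uniform_limit:
  assumes "open S" "F \<noteq> bot"
    and "\<And>p. p \<in> S \<Longrightarrow> \<exists>d>0. (\<forall>\<^sub>F n in F. hol (f n) (ball p d)) \<and> uniform_limit (ball p d) f g F"
  shows "hol g S"
proof (rule hol_local[OF assms(1)])
  fix p assume "p \<in> S"
  then obtain d where d: "d > 0" "\<forall>\<^sub>F n in F. hol (f n) (ball p d)" "uniform_limit (ball p d) f g F"
    using assms(3) by blast
  have "hol g (ball p d)"
  proof (rule holI)
    show "continuous_on (ball p d) g"
      by (rule uniform_limit_theorem[OF eventually_mono[OF d(2)] d(3) assms(2)]) (rule hol_continuous_on)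
    fix q v assume q: "q \<in> ball p d"
    obtain r where r: "r > 0" "cball 0 r \<subseteq> {t. q + t *c v \<in> ball p d}"
      by (rule line_cball[OF open_ball q]) (rule that)
    have "(\<lambda>t. g (q + t *c v)) holomorphic_on ball 0 r"
    proof (rule holomorphic_uniform_limit[of 0 r "\<lambda>n t. f n (q + t *c v)" F])
      show "\<forall>\<^sub>F n in F. continuous_on (cball 0 r) (\<lambda>t. f n (q + t *c v)) \<and> (\<lambda>t. f n (q + t *c v)) holomorphic_on ball 0 r"
        using d(2)
      proof eventually_elim
        case (elim n)
        have "(\<lambda>t. f n (q + t *c v)) holomorphic_on cball 0 r"
          by (rule holomorphic_on_subset[OF hol_line[OF elim, of q v] r(2)])
        then show ?case
          by (blast intro: holomorphic_on_imp_continuous_on holomorphic_on_subset ball_subset_cball[THEN subsetD])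
      qed
      show "uniform_limit (cball 0 r) (\<lambda>n t. f n (q + t *c v)) (\<lambda>t. g (q + t *c v)) F"
        by (rule uniform_limit_compose'[OF d(3)]) (use r in auto)
    qed (use assms in auto)
    then show "(\<lambda>t. g (q + t *c v)) field_differentiable at 0"
      using r holomorphic_on_imp_differentiable_at[of _ "ball 0 r" 0] by auto
  qed simp
  then show "\<exists>d>0. hol g (ball p d)" using d by blast
qed

section \<open>Difference quotients and the calculus of directional derivatives\<close>

definition dquot :: "'a::complex_space \<Rightarrow> ('a \<Rightarrow> complex) \<Rightarrow> nat \<Rightarrow> 'a \<Rightarrow> complex" where
  "dquot v f n q = of_nat (Suc n) * (f (q + (1 / of_nat (Suc n)) *c v) - f q)"

text \<open>A difference quotient with fixed step is a combination of f and a translate of f, hence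
  holomorphic where both are defined. This exhibits \<open>cderiv v f\<close> as a locally uniform
  limit of holomorphic functions.\<close>

lemma dquot_uniform_limit:
  assumes "hol f S" "open S" "p \<in> S"
  shows "\<exists>d>0. ball p d \<subseteq> S \<and> (\<forall>\<^sub>F n in sequentially. hol (dquot v f n) (ball p d)) \<and>
           uniform_limit (ball p d) (dquot v f) (cderiv v f) sequentially"
proof -
  from hol_taylor_bound[OF assms] obtain r K where r: "r > 0" "K \<ge> 0" "ball p (2 * r) \<subseteq> S" and
    bd: "\<And>q v t. q \<in> ball p r \<Longrightarrow> norm (t *c v) < r \<Longrightarrow>
       cmod (f (q + t *c v) - f q - t * cderiv v f q) \<le> K * (norm v)\<^sup>2 * (cmod t)\<^sup>2" by metis
  have "(\<lambda>n. norm v / real (Suc n)) \<longlonglongrightarrow> 0"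
    by (rule LIMSEQ_Suc) (rule lim_const_over_n)
  then have ev: "\<forall>\<^sub>F n in sequentially. norm v / real (Suc n) < r"
    using r(1) by (rule order_tendstoD)
  have "\<forall>\<^sub>F n in sequentially. hol (dquot v f n) (ball p r)"
    using ev
  proof eventually_elim
    case (elim n)
    have "hol (\<lambda>q. f ((1 / of_nat (Suc n)) *c v + q)) (ball p r)"
    proof (rule hol_compose_affine[OF assms(1), of "\<lambda>q. q"])
      fix q assume "q \<in> ball p r"
      moreover have "dist p ((1 / of_nat (Suc n)) *c v + q) \<le> dist p q + norm ((1 / of_nat (Suc n)) *c v)"
        using dist_triangle[of p "(1 / of_nat (Suc n)) *c v + q" q] by (simp add: dist_norm norm_minus_commute)
      moreover have "norm ((1 / of_nat (Suc n)) *c v) < r"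
        using elim by (simp add: norm_scaleC norm_divide del: of_nat_Suc)
      ultimately show "(1 / of_nat (Suc n)) *c v + q \<in> S" using r by (auto simp: subset_iff)
    qed auto
    then have "hol (\<lambda>q. f (q + (1 / of_nat (Suc n)) *c v)) (ball p r)" by (simp add: add.commute)
    moreover have "hol f (ball p r)" using hol_subset[OF assms(1)] r by (auto simp: subset_iff)
    ultimately show ?case unfolding dquot_def by (intro hol_intros)
  qed
  moreover have "uniform_limit (ball p r) (dquot v f) (cderiv v f) sequentially"
  proof (rule uniform_limitI)
    fix e :: real assume "e > 0"
    have "(\<lambda>n. K * (norm v)\<^sup>2 / real (Suc n)) \<longlonglongrightarrow> 0"
      by (rule LIMSEQ_Suc) (rule lim_const_over_n)
    then have "\<forall>\<^sub>F n in sequentially. K * (norm v)\<^sup>2 / real (Suc n) < e"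
      using \<open>e > 0\<close> by (rule order_tendstoD)
    with ev show "\<forall>\<^sub>F n in sequentially. \<forall>x\<in>ball p r. dist (dquot v f n x) (cderiv v f x) < e"
    proof eventually_elim
      case (elim n)
      show ?case
      proof
        fix x assume x: "x \<in> ball p r"
        define t :: complex where "t = 1 / of_nat (Suc n)"
        have t: "cmod t = 1 / real (Suc n)" "t \<noteq> 0" "of_nat (Suc n) = 1 / t"
          by (simp_all add: t_def norm_divide del: of_nat_Suc)
        have "dquot v f n x - cderiv v f x = (f (x + t *c v) - f x - t * cderiv v f x) / t"
          using t(2) by (simp add: dquot_def t(3) t_def[symmetric] field_simps del: of_nat_Suc)
        then have "cmod (dquot v f n x - cderiv v f x) = cmod (f (x + t *c v) - f x - t * cderiv v f x) / cmod t"
          by (simp add: norm_divide)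
        also have "\<dots> \<le> K * (norm v)\<^sup>2 * (cmod t)\<^sup>2 / cmod t"
          by (intro divide_right_mono bd x) (use elim(1) t in \<open>auto simp: norm_scaleC\<close>)
        also have "\<dots> = K * (norm v)\<^sup>2 / real (Suc n)"
          using t by (simp add: power2_eq_square)
        finally show "dist (dquot v f n x) (cderiv v f x) < e" using elim(2) by (simp add: dist_norm)
      qed
    qed
  qed
  ultimately show ?thesis using r by (intro exI[of _ r]) (auto simp: subset_iff)
qed

lemma hol_cderiv [hol_intros]:
  assumes "hol f S" "open S"
  shows "hol (cderiv v f) S"
proof (rule hol_uniform_limit[of _ sequentially "dquot v f"])
  fix p assume "p \<in> S"
  from dquot_uniform_limit[OF assms this, of v]
  show "\<exists>d>0. (\<forall>\<^sub>F n in sequentially. hol (dquot v f n) (ball p d)) \<and>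
       uniform_limit (ball p d) (dquot v f) (cderiv v f) sequentially" by blast
qed (use assms in auto)

text \<open>Forming a difference quotient in direction v commutes exactly with differentiation in
  direction w, and differentiation in direction w passes through the locally uniform limit of the
  quotients.\<close>

lemma cderiv_commute:
  assumes "hol f S" "open S" "p \<in> S"
  shows "cderiv w (cderiv v f) p = cderiv v (cderiv w f) p"
proof -
  obtain d where d: "d > 0" "ball p d \<subseteq> S" "\<forall>\<^sub>F n in sequentially. hol (dquot v f n) (ball p d)"
    "uniform_limit (ball p d) (dquot v f) (cderiv v f) sequentially"
    using dquot_uniform_limit[OF assms] by blast
  have "p \<in> ball p d" using d by simp
  then obtain r where r: "r > 0" "cball 0 r \<subseteq> {t. p + t *c w \<in> ball p d}"
    by (rule line_cball[OF open_ball]) (rule that)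
  obtain g' where g': "\<And>s. s \<in> ball 0 r \<Longrightarrow> ((\<lambda>t. cderiv v f (p + t *c w)) has_field_derivative (g' s)) (at s) \<and>
      ((\<lambda>n. cderiv w (dquot v f n) (p + s *c w)) \<longlongrightarrow> g' s) sequentially"
  proof (rule has_complex_derivative_uniform_limit[of 0 r "\<lambda>n t. dquot v f n (p + t *c w)"
        "\<lambda>n s. cderiv w (dquot v f n) (p + s *c w)" sequentially])
    show "\<forall>\<^sub>F n in sequentially. continuous_on (cball 0 r) (\<lambda>t. dquot v f n (p + t *c w)) \<and>
       (\<forall>s\<in>ball 0 r. ((\<lambda>t. dquot v f n (p + t *c w)) has_field_derivative cderiv w (dquot v f n) (p + s *c w)) (at s))"
      using d(3)
    proof eventually_elim
      case (elim n)
      have "continuous_on (cball 0 r) (\<lambda>t. dquot v f n (p + t *c w))"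
        by (rule holomorphic_on_imp_continuous_on[OF holomorphic_on_subset[OF hol_line[OF elim, of p w] r(2)]])
      moreover have "((\<lambda>t. dquot v f n (p + t *c w)) has_field_derivative cderiv w (dquot v f n) (p + s *c w)) (at s)"
        if "s \<in> ball 0 r" for s
        by (rule hol_DERIV[OF elim]) (use that r in \<open>auto simp: subset_iff\<close>)
      ultimately show ?case by blast
    qed
    show "uniform_limit (cball 0 r) (\<lambda>n t. dquot v f n (p + t *c w)) (\<lambda>t. cderiv v f (p + t *c w)) sequentially"
      by (rule uniform_limit_compose'[OF d(4)]) (use r in auto)
  qed (use r that in auto)
  have "g' 0 = cderiv w (cderiv v f) p"
    using g'[of 0] r by (intro cderiv_eqI[symmetric]) simp
  then have lim1: "(\<lambda>n. cderiv w (dquot v f n) p) \<longlonglongrightarrow> cderiv w (cderiv v f) p"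
    using g'[of 0] r by simp
  obtain d' where d': "d' > 0" "uniform_limit (ball p d') (dquot v (cderiv w f)) (cderiv v (cderiv w f)) sequentially"
    using dquot_uniform_limit[OF hol_cderiv[OF assms(1,2)] assms(2,3)] by blast
  have lim2: "(\<lambda>n. dquot v (cderiv w f) n p) \<longlonglongrightarrow> cderiv v (cderiv w f) p"
    using tendsto_uniform_limitI[OF d'(2)] d'(1) by simp
  have "(\<lambda>n. norm v / real (Suc n)) \<longlonglongrightarrow> 0"
    by (rule LIMSEQ_Suc) (rule lim_const_over_n)
  then have ev: "\<forall>\<^sub>F n in sequentially. norm v / real (Suc n) < d"
    using d(1) by (rule order_tendstoD)
  then have "\<forall>\<^sub>F n in sequentially. cderiv w (dquot v f n) p = dquot v (cderiv w f) n p"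
  proof eventually_elim
    case (elim n)
    define t :: complex where "t = 1 / of_nat (Suc n)"
    have "norm (t *c v) < d"
      using elim by (simp add: t_def norm_scaleC norm_divide del: of_nat_Suc)
    then have "p + t *c v \<in> S" using d by (auto simp: dist_norm subset_iff)
    from hol_DERIV0[OF assms(1,2) this, of w] hol_DERIV0[OF assms, of w]
    have "((\<lambda>s. of_nat (Suc n) * (f ((p + t *c v) + s *c w) - f (p + s *c w))) has_field_derivative
       of_nat (Suc n) * (cderiv w f (p + t *c v) - cderiv w f p)) (at 0)"
      by (intro DERIV_cmult DERIV_diff)
    then show ?case
      by (intro cderiv_eqI) (simp add: dquot_def t_def algebra_simps)
  qed
  then have "(\<lambda>n. dquot v (cderiv w f) n p) \<longlonglongrightarrow> cderiv w (cderiv v f) p"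
    using lim1 by (rule Lim_transform_eventually[rotated])
  then show ?thesis by (rule LIMSEQ_unique) (rule lim2)
qed

lemma cderiv_scale:
  assumes "hol f S" "open S" "p \<in> S"
  shows "cderiv (c *c v) f p = c * cderiv v f p"
proof (rule cderiv_eqI)
  have "((\<lambda>s. f (p + (s * c) *c v)) has_field_derivative cderiv v f p * c) (at 0)"
    by (rule DERIV_chain2[of "\<lambda>s. f (p + s *c v)" _ "\<lambda>s. s * c"])
       (use hol_DERIV0[OF assms, of v] in \<open>auto intro!: derivative_eq_intros\<close>)
  then show "((\<lambda>s. f (p + s *c c *c v)) has_field_derivative c * cderiv v f p) (at 0)"
    by (simp add: mult.commute)
qed

text \<open>Holomorphy on lines does not relate different directions. The quotient for u + v at p
  splits into the one for u at p and the one for v at the moving point p + u/(n+1); uniform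
  convergence of the latter handles the moving point.\<close>

lemma cderiv_add_direction:
  assumes "hol f S" "open S" "p \<in> S"
  shows "cderiv (u + v) f p = cderiv u f p + cderiv v f p"
proof -
  define x where "x n = (1 / of_nat (Suc n) :: complex)" for n
  have x0: "x \<longlonglongrightarrow> 0"
    unfolding x_def using LIMSEQ_Suc[OF lim_1_over_n[where 'a=complex]] by simp
  have "(\<lambda>n. p + x n *c u) \<longlonglongrightarrow> p + 0 *c u"
    by (intro tendsto_intros x0)
  then have ux: "(\<lambda>n. p + x n *c u) \<longlonglongrightarrow> p" by simp
  have lim: "(\<lambda>n. dquot w f n p) \<longlonglongrightarrow> cderiv w f p" for w
  proof -
    obtain d where "d > 0" "uniform_limit (ball p d) (dquot w f) (cderiv w f) sequentially"
      using dquot_uniform_limit[OF assms, of w] by blast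
    then show ?thesis by (intro tendsto_uniform_limitI) auto
  qed
  obtain d where d: "d > 0" "ball p d \<subseteq> S" "uniform_limit (ball p d) (dquot v f) (cderiv v f) sequentially"
    using dquot_uniform_limit[OF assms, of v] by blast
  have "(\<lambda>n. dquot v f n (p + x n *c u) - cderiv v f (p + x n *c u)) \<longlonglongrightarrow> 0"
  proof (rule tendstoI)
    fix e :: real assume "e > 0"
    have "\<forall>\<^sub>F n in sequentially. \<forall>y\<in>ball p d. dist (dquot v f n y) (cderiv v f y) < e"
      using d(3) \<open>e > 0\<close> by (rule uniform_limitD)
    moreover have "\<forall>\<^sub>F n in sequentially. p + x n *c u \<in> ball p d"
      by (rule topological_tendstoD[OF ux]) (use d in auto)
    ultimately show "\<forall>\<^sub>F n in sequentially. dist (dquot v f n (p + x n *c u) - cderiv v f (p + x n *c u)) 0 < e"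
      by eventually_elim (simp add: dist_norm)
  qed
  moreover have "isCont (cderiv v f) p"
    using hol_continuous_on[OF hol_cderiv[OF assms(1,2)], of v] assms
      continuous_on_eq_continuous_at[of S "cderiv v f"] by simp
  then have "(\<lambda>n. cderiv v f (p + x n *c u)) \<longlonglongrightarrow> cderiv v f p"
    using ux by (rule isCont_tendsto_compose)
  ultimately have "(\<lambda>n. (dquot v f n (p + x n *c u) - cderiv v f (p + x n *c u)) + cderiv v f (p + x n *c u)
       + dquot u f n p) \<longlonglongrightarrow> 0 + cderiv v f p + cderiv u f p"
    by (intro tendsto_add lim)
  moreover have "(dquot v f n (p + x n *c u) - cderiv v f (p + x n *c u)) + cderiv v f (p + x n *c u)
       + dquot u f n p = dquot (u + v) f n p" for n
    by (simp add: dquot_def x_def scaleC_add_right algebra_simps)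
  ultimately have "(\<lambda>n. dquot (u + v) f n p) \<longlonglongrightarrow> cderiv u f p + cderiv v f p"
    by (simp add: add.commute)
  with lim[of "u + v"] show ?thesis by (rule LIMSEQ_unique)
qed

lemma hol_has_derivative:
  assumes "hol f S" "open S" "p \<in> S"
  shows "(f has_derivative (\<lambda>v. cderiv v f p)) (at p)"
proof -
  have bl: "bounded_linear (\<lambda>v. cderiv v f p)"
  proof (rule linear_conv_bounded_linear[THEN iffD1], rule linearI)
    show "cderiv (u + v) f p = cderiv u f p + cderiv v f p" for u v
      by (rule cderiv_add_direction[OF assms])
    show "cderiv (r *\<^sub>R v) f p = r *\<^sub>R cderiv v f p" for r v
      using cderiv_scale[OF assms, of "of_real r" v] by (simp add: scaleC_of_real scaleR_conv_of_real)
  qed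
  from hol_taylor_bound[OF assms] obtain r K where r: "r > 0" "K \<ge> 0" and
    bd: "\<And>q v t. q \<in> ball p r \<Longrightarrow> norm (t *c v) < r \<Longrightarrow>
       cmod (f (q + t *c v) - f q - t * cderiv v f q) \<le> K * (norm v)\<^sup>2 * (cmod t)\<^sup>2" by metis
  have est: "norm (f (p + h) - f p - cderiv h f p) \<le> K * (norm h)\<^sup>2" if "norm h < r" for h
    using bd[of p 1 h] that r by simp
  show ?thesis
    unfolding has_derivative_at
  proof (intro conjI bl)
    show "(\<lambda>h. norm (f (p + h) - f p - cderiv h f p) / norm h) \<midarrow>0\<rightarrow> 0"
    proof (rule Lim_null_comparison)
      have "\<forall>\<^sub>F h in at 0. norm h < r" using r(1)
        by (auto simp: eventually_at intro!: exI[of _ r])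
      then show "\<forall>\<^sub>F h in at 0. norm (norm (f (p + h) - f p - cderiv h f p) / norm h) \<le> K * norm h"
      proof eventually_elim
        case (elim h)
        have "norm (f (p + h) - f p - cderiv h f p) / norm h \<le> K * (norm h)\<^sup>2 / norm h"
          by (intro divide_right_mono est elim) auto
        then show ?case by (simp add: power2_eq_square split: if_splits)
      qed
      have "((\<lambda>h. K * norm (h::'a)) \<longlongrightarrow> K * norm (0::'a)) (at 0)"
        by (intro tendsto_intros)
      then show "((\<lambda>h. K * norm (h::'a)) \<longlongrightarrow> 0) (at 0)" by simp
    qed
  qed
qed

text \<open>Converse of \<open>hol_has_derivative\<close>. It brings a competing extension, which is
  given through Frechet derivatives, and compositions with the graph map into the setting of
  \<open>hol\<close>.\<close>

lemma hol_of_has_derivative: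
  assumes "open S" "\<And>p. p \<in> S \<Longrightarrow> (f has_derivative D p) (at p)"
    "\<And>p c v. p \<in> S \<Longrightarrow> D p (c *c v) = c * D p v"
  shows "hol f S" and "p \<in> S \<Longrightarrow> cderiv v f p = D p v"
proof -
  have D: "((\<lambda>t. f (p + t *c v)) has_field_derivative D p v) (at 0)" if "p \<in> S" for p v
  proof -
    have "((\<lambda>t. p + t *c v) has_derivative (\<lambda>t. t *c v)) (at 0)"
      using has_derivative_add[OF has_derivative_const[of p] bounded_linear_imp_has_derivative[OF
         bounded_bilinear.bounded_linear_left[OF bounded_bilinear_scaleC, of v]]] by simp
    moreover have "(f has_derivative D p) (at (p + 0 *c v))" using assms(2)[OF that] by simp
    ultimately have "((\<lambda>t. f (p + t *c v)) has_derivative (\<lambda>t. D p (t *c v))) (at 0)"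
      using has_derivative_compose[of "\<lambda>t. p + t *c v" _ 0 UNIV f "D p"] by simp
    moreover have "(\<lambda>t. D p (t *c v)) = (\<lambda>t. D p v * t)"
      using assms(3)[OF that] by (simp add: mult.commute fun_eq_iff)
    ultimately show ?thesis by (simp add: has_field_derivative_def)
  qed
  show "hol f S"
  proof (rule holI[OF assms(1)])
    show "continuous_on S f"
      by (intro continuous_at_imp_continuous_on ballI has_derivative_continuous[OF assms(2)])
  qed (use D in \<open>auto simp: field_differentiable_def\<close>)
  show "p \<in> S \<Longrightarrow> cderiv v f p = D p v" using D cderiv_eqI by blast
qed

section \<open>Division by a function with simple zeros\<close>

text \<open>Here y may lie outside K. Uniform continuity is applied on the larger compact set K',
  and the lemma serves to compare a circle with all nearby translated circles.\<close>

lemma compact_uniform_neighbourhood: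
  fixes f :: "'a::euclidean_space \<Rightarrow> 'b::metric_space"
  assumes "compact K" "K \<subseteq> S" "open S" "continuous_on S f" "e > 0"
  obtains d where "d > 0" "\<And>x y. x \<in> K \<Longrightarrow> dist y x < d \<Longrightarrow> y \<in> S \<and> dist (f y) (f x) < e"
proof -
  obtain d1 where d1: "d1 > 0" "(\<Union>x\<in>K. ball x d1) \<subseteq> S"
    using compact_subset_open_imp_ball_epsilon_subset[OF assms(1,3,2)] by blast
  define K' where "K' = {x + y | x y. x \<in> K \<and> y \<in> cball (0::'a) (d1/2)}"
  have "compact K'" unfolding K'_def by (intro compact_sums assms) auto
  moreover have "K' \<subseteq> S"
  proof
    fix z assume "z \<in> K'"
    then obtain x y where "z = x + y" "x \<in> K" "norm y \<le> d1/2" by (auto simp: K'_def)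
    then have "z \<in> ball x d1" using d1(1) by (auto simp: dist_norm)
    then show "z \<in> S" using d1 \<open>x \<in> K\<close> by blast
  qed
  ultimately have "uniformly_continuous_on K' f"
    using assms(4) by (meson compact_uniformly_continuous continuous_on_subset)
  then obtain d2 where d2: "d2 > 0" "\<And>x y. x \<in> K' \<Longrightarrow> y \<in> K' \<Longrightarrow> dist y x < d2 \<Longrightarrow> dist (f y) (f x) < e"
    unfolding uniformly_continuous_on_def using \<open>e > 0\<close> by metis
  show ?thesis
  proof (rule that[of "min (d1/2) d2"])
    show "min (d1/2) d2 > 0" using d1 d2 by simp
    fix x y assume "x \<in> K" and xy: "dist y x < min (d1/2) d2"
    have "x = x + 0" "y = x + (y - x)" by simp_all
    moreover have "0 \<in> cball (0::'a) (d1/2)" "y - x \<in> cball 0 (d1/2)" using xy d1(1) by (simp_all add: dist_norm norm_minus_commute)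
    ultimately have "x \<in> K'" "y \<in> K'" using \<open>x \<in> K\<close> unfolding K'_def by blast+
    then show "y \<in> S \<and> dist (f y) (f x) < e" using d2 xy \<open>K' \<subseteq> S\<close> by auto
  qed
qed

lemma open_line_ball:
  assumes "open S" "p \<in> S"
  obtains r where "r > 0" "\<And>s t. cmod s \<le> r \<Longrightarrow> cmod t \<le> r \<Longrightarrow> p + s *c u + t *c v \<in> S"
proof -
  obtain d where d: "d > 0" "ball p d \<subseteq> S" using assms open_contains_ball by blast
  define r where "r = d / (2 * (norm u + norm v + 1))"
  have pos: "norm u + norm v + 1 > 0" using norm_ge_zero[of u] norm_ge_zero[of v] by linarith
  show ?thesis
  proof (rule that[of r])
    show "r > 0" using d pos by (simp add: r_def)
    fix s t :: complex assume st: "cmod s \<le> r" "cmod t \<le> r"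
    have "norm (s *c u + t *c v) \<le> cmod s * norm u + cmod t * norm v"
      by (metis norm_scaleC norm_triangle_ineq)
    also have "\<dots> \<le> r * norm u + r * norm v" using st by (intro add_mono mult_right_mono) auto
    also have "\<dots> \<le> r * (norm u + norm v + 1)" using \<open>r > 0\<close> by (simp add: algebra_simps)
    also have "\<dots> = d / 2" using pos by (simp add: r_def divide_simps)
    also have "\<dots> < d" using d by simp
    finally have "dist (p + s *c u + t *c v) p < d" by (simp add: dist_norm algebra_simps)
    then have "p + s *c u + t *c v \<in> ball p d" by (simp add: dist_commute)
    then show "p + s *c u + t *c v \<in> S" using d by blast
  qed
qed

lemma maximum_modulus_disc:
  assumes "\<phi> holomorphic_on ball 0 R" "r < R" "r > 0" "\<And>t. cmod t = r \<Longrightarrow> cmod (\<phi> t) \<le> B"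
  shows "cmod (\<phi> 0) \<le> B"
proof (rule maximum_modulus_frontier[of \<phi> "cball 0 r"])
  have sub: "cball 0 r \<subseteq> ball 0 R" using assms by auto
  show "\<phi> holomorphic_on interior (cball 0 r)"
    by (rule holomorphic_on_subset[OF assms(1)]) (use assms(2) in auto)
  show "continuous_on (closure (cball 0 r)) \<phi>"
    using holomorphic_on_imp_continuous_on[OF assms(1)] sub by (auto intro: continuous_on_subset)
qed (use assms in \<open>auto simp: dist_norm\<close>)

text \<open>There is at most one zero a of R. Dividing both F and R by t - a leaves a denominator
  without zeros, and at a the quotient of the two is the quotient of derivatives. The explicit
  formula is needed because the same function is restricted to many lines.\<close>

lemma divide_simple_zero:
  assumes X: "open X" and F: "F holomorphic_on X" and R: "R holomorphic_on X"
    and van: "\<And>t. t \<in> X \<Longrightarrow> R t = 0 \<Longrightarrow> F t = 0"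
    and uniq: "\<And>s t. s \<in> X \<Longrightarrow> t \<in> X \<Longrightarrow> R s = 0 \<Longrightarrow> R t = 0 \<Longrightarrow> s = t"
    and simple: "\<And>t. t \<in> X \<Longrightarrow> R t = 0 \<Longrightarrow> deriv R t \<noteq> 0"
  shows "(\<lambda>t. if R t = 0 then deriv F t / deriv R t else F t / R t) holomorphic_on X"
proof (cases "\<exists>a\<in>X. R a = 0")
  case False
  then show ?thesis
    using F R by (subst holomorphic_cong[OF refl, of _ _ "\<lambda>t. F t / R t"]) (auto intro!: holomorphic_intros)
next
  case True
  then obtain a where a: "a \<in> X" "R a = 0" by blast
  define A where "A t = (if t = a then deriv F a else (F t - F a) / (t - a))" for t
  define B where "B t = (if t = a then deriv R a else (R t - R a) / (t - a))" for t
  have "A holomorphic_on X" "B holomorphic_on X"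
    unfolding A_def B_def by (rule pole_lemma_open[OF F X] pole_lemma_open[OF R X])+
  moreover have "B t \<noteq> 0" if "t \<in> X" for t
  proof (cases "t = a")
    case True
    then show ?thesis using simple[OF a] by (simp add: B_def)
  next
    case False
    then have "R t \<noteq> 0" using uniq[OF that a(1) _ a(2)] by blast
    then show ?thesis using False a(2) by (simp add: B_def)
  qed
  ultimately have "(\<lambda>t. A t / B t) holomorphic_on X" by (intro holomorphic_intros) auto
  then show ?thesis
  proof (rule holomorphic_transform)
    fix t assume "t \<in> X"
    then have "R t = 0 \<longleftrightarrow> t = a" using uniq[OF _ a(1) _ a(2)] a(2) by blast
    then show "A t / B t = (if R t = 0 then deriv F t / deriv R t else F t / R t)"
      using a(2) van[OF a] by (simp add: A_def B_def)
  qed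
qed

lemma hol_isCont: "hol f S \<Longrightarrow> open S \<Longrightarrow> p \<in> S \<Longrightarrow> isCont f p"
  using hol_continuous_on[of f S] continuous_on_eq_continuous_at[of S f] by simp

lemma hol_small_near_0:
  assumes "hol f S" "open S" "0 \<in> S" "f 0 = 0" "e > 0"
  obtains d where "d > 0" "\<And>x. norm x < d \<Longrightarrow> cmod (f x) < e"
proof -
  have "isCont f 0" by (rule hol_isCont[OF assms(1-3)])
  then obtain d where "d > 0" "\<And>x. norm x < d \<Longrightarrow> cmod (f x) < e"
    using assms(5) unfolding continuous_at_eps_delta dist_norm diff_zero assms(4) by blast
  then show ?thesis by (rule that)
qed

lemma open_nonzero:
  fixes h :: "'a::topological_space \<Rightarrow> complex"
  assumes "continuous_on S h" "open S"
  shows "open {x \<in> S. h x \<noteq> 0}"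
proof -
  have "open (S \<inter> h -` (- {0}))" by (rule continuous_open_preimage[OF assms]) (simp add: open_Compl)
  also have "S \<inter> h -` (- {0}) = {x \<in> S. h x \<noteq> 0}" by auto
  finally show ?thesis .
qed

text \<open>Near a zero of \<open>h\<close> the restriction of \<open>g\<close> to a line is a uniform limit of restrictions to
  parallel lines on which the zeros of \<open>h\<close> are isolated.\<close>

lemma hol_removable_zero_set:
  assumes S: "open S" and g: "continuous_on S g" and h: "hol h S"
    and gh: "hol g {x \<in> S. h x \<noteq> 0}"
    and transversal: "\<And>p. p \<in> S \<Longrightarrow> h p = 0 \<Longrightarrow> \<exists>u. \<forall>s. p + s *c u \<in> S \<longrightarrow> h (p + s *c u) = 0 \<longrightarrow> s = 0"
  shows "hol g S"
proof (rule holI[OF S g])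
  fix p w assume p: "p \<in> S"
  have S': "open {x \<in> S. h x \<noteq> 0}"
    by (rule open_nonzero[OF hol_continuous_on[OF h] S])
  have diff: "(\<lambda>t. g (q + t *c w)) field_differentiable at t0"
    if "q + t0 *c w \<in> S" "h (q + t0 *c w) \<noteq> 0" for q t0
    using hol_DERIV[OF gh S', of q t0 w] that by (auto simp: field_differentiable_def)
  show "(\<lambda>t. g (p + t *c w)) field_differentiable at 0"
  proof (cases "h p = 0")
    case False
    then show ?thesis using diff[of p 0] p by simp
  next
    case True
    obtain u where u: "\<And>s. p + s *c u \<in> S \<Longrightarrow> h (p + s *c u) = 0 \<Longrightarrow> s = 0"
      using transversal[OF p True] by blast
    obtain r where r: "r > 0" "\<And>s t. cmod s \<le> r \<Longrightarrow> cmod t \<le> r \<Longrightarrow> p + s *c u + t *c w \<in> S"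
      using open_line_ball[OF S p, of u w] by blast
    have hol: "(\<lambda>t. g ((p + s *c u) + t *c w)) holomorphic_on ball 0 r" if s: "cmod s \<le> r" "s \<noteq> 0" for s
    proof -
      let ?q = "p + s *c u"
      have inS: "?q + t *c w \<in> S" if "t \<in> ball 0 r" for t using r(2)[OF s(1), of t] that by simp
      \<comment> \<open>The zeros of h on the parallel line are isolated because h does not vanish
        at its base point; this is what the transversal direction u provides.\<close>
      have q0: "h ?q \<noteq> 0" using u[of s] s r(2)[OF s(1), of 0] r(1) by auto
      have hh: "(\<lambda>t. h (?q + t *c w)) holomorphic_on ball 0 r"
        by (rule holomorphic_on_subset[OF hol_line[OF h]]) (use inS in auto)
      have cont: "continuous_on (ball 0 r) (\<lambda>t. g (?q + t *c w))"
        by (rule continuous_on_compose2[OF g]) (use inS in \<open>auto intro!: continuous_intros\<close>)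
      have "(\<lambda>t. g (?q + t *c w)) field_differentiable at t0" if t0: "t0 \<in> ball 0 r" for t0
      proof (cases "h (?q + t0 *c w) = 0")
        case False
        then show ?thesis using diff inS t0 by blast
      next
        case True
        obtain e where e: "e > 0" "ball t0 e \<subseteq> ball 0 r" "\<And>z. z \<in> ball t0 e - {t0} \<Longrightarrow> h (?q + z *c w) \<noteq> 0"
          using isolated_zeros[OF hh, of t0 0] True t0 q0 r(1) by auto
        have "(\<lambda>t. g (?q + t *c w)) holomorphic_on ball t0 e"
        proof (rule no_isolated_singularity[of _ _ "{t0}"])
          show "continuous_on (ball t0 e) (\<lambda>t. g (?q + t *c w))" by (rule continuous_on_subset[OF cont e(2)])
          show "(\<lambda>t. g (?q + t *c w)) holomorphic_on ball t0 e - {t0}"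
            unfolding holomorphic_on_def
          proof
            fix z assume z: "z \<in> ball t0 e - {t0}"
            then have "z \<in> ball 0 r" using e(2) by blast
            from diff[OF inS[OF this] e(3)[OF z]]
            show "(\<lambda>t. g (?q + t *c w)) field_differentiable at z within ball t0 e - {t0}"
              by (rule field_differentiable_at_within)
          qed
        qed auto
        then show ?thesis by (rule holomorphic_on_imp_differentiable_at) (use e(1) in auto)
      qed
      then show ?thesis by (simp add: holomorphic_on_open field_differentiable_def)
    qed
    define x where "x n = (of_real (r / real (Suc n)) :: complex)" for n
    have x: "cmod (x n) \<le> r" "x n \<noteq> 0" for n
    proof -
      have "cmod (x n) = r / real (Suc n)" using r(1) by (simp only: x_def norm_of_real) simp
      also have "\<dots> \<le> r" using r(1) by (simp add: field_simps)
      finally show "cmod (x n) \<le> r" .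
      show "x n \<noteq> 0" using r(1) by (simp add: x_def del: of_nat_Suc)
    qed
    have xlim: "(\<lambda>n. x n *c u) \<longlonglongrightarrow> 0 *c u"
    proof (intro tendsto_intros)
      have "(\<lambda>n. r / real (Suc n)) \<longlonglongrightarrow> 0" by (rule LIMSEQ_Suc) (rule lim_const_over_n)
      then show "x \<longlonglongrightarrow> 0" unfolding x_def by (rule tendsto_of_real[of _ 0, unfolded of_real_0])
    qed
    have r2: "r/2 > 0" "r/2 < r" using r(1) by auto
    have ul: "uniform_limit (cball 0 (r/2)) (\<lambda>n t. g ((p + x n *c u) + t *c w)) (\<lambda>t. g (p + t *c w)) sequentially"
    proof (rule uniform_limitI)
      fix e :: real assume "e > 0"
      obtain d where d: "d > 0" "\<And>a y. a \<in> (\<lambda>t. p + t *c w) ` cball 0 (r/2) \<Longrightarrow> dist y a < d \<Longrightarrow> y \<in> S \<and> dist (g y) (g a) < e"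
      proof (rule compact_uniform_neighbourhood[OF _ _ S g \<open>e > 0\<close>])
        show "compact ((\<lambda>t. p + t *c w) ` cball 0 (r/2))"
          by (intro compact_continuous_image continuous_intros) auto
        show "(\<lambda>t. p + t *c w) ` cball 0 (r/2) \<subseteq> S" using r(2)[of 0] r(1) by auto
      qed blast
      have "\<forall>\<^sub>F n in sequentially. norm (x n *c u) < d"
        using tendstoD[OF xlim d(1)] by simp
      then show "\<forall>\<^sub>F n in sequentially. \<forall>t\<in>cball 0 (r/2). dist (g ((p + x n *c u) + t *c w)) (g (p + t *c w)) < e"
      proof eventually_elim
        case (elim n)
        then show ?case using d(2)[OF imageI] by (auto simp: dist_norm algebra_simps)
      qed
    qed
    have ev: "\<forall>\<^sub>F n in sequentially. continuous_on (cball 0 (r/2)) (\<lambda>t. g ((p + x n *c u) + t *c w)) \<and>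
        (\<lambda>t. g ((p + x n *c u) + t *c w)) holomorphic_on ball 0 (r/2)"
    proof (intro always_eventually allI conjI)
      fix n
      show "continuous_on (cball 0 (r/2)) (\<lambda>t. g ((p + x n *c u) + t *c w))"
        by (rule continuous_on_subset[OF holomorphic_on_imp_continuous_on[OF hol[OF x]]]) (use r2 in auto)
      show "(\<lambda>t. g ((p + x n *c u) + t *c w)) holomorphic_on ball 0 (r/2)"
        by (rule holomorphic_on_subset[OF hol[OF x]]) (use r2 in auto)
    qed
    have "(\<lambda>t. g (p + t *c w)) holomorphic_on ball 0 (r/2)"
      by (rule holomorphic_uniform_limit[OF ev ul trivial_limit_sequentially])
    then show ?thesis by (rule holomorphic_on_imp_differentiable_at) (use r2 in auto)
  qed
qed

text \<open>By \<open>inj1\<close> and \<open>simple\<close> each u-line crosses the zeros of r1 at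
  most once, and transversally; by \<open>inj2\<close> common zeros of r1 and r2 in one (u, v)-plane
  share their v-coordinate. The relation forces f1 = 0 on the zeros of r1 away from the common
  zeros, and a limit covers the rest. The quotient is then holomorphic on u-lines, continuous by
  comparison of neighbouring lines, and \<open>hol_removable_zero_set\<close> gives holomorphy in
  all directions.\<close>

lemma hol_division:
  fixes u v :: "'a::complex_space"
  assumes S: "open S" and r1: "hol r1 S" and r2: "hol r2 S" and f1: "hol f1 S" and f2: "hol f2 S"
    and rel: "\<And>x. x \<in> S \<Longrightarrow> r1 x * f2 x = r2 x * f1 x"
    and inj1: "\<And>p s. p \<in> S \<Longrightarrow> p + s *c u \<in> S \<Longrightarrow> r1 p = 0 \<Longrightarrow> r1 (p + s *c u) = 0 \<Longrightarrow> s = 0"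
    and simple: "\<And>p. p \<in> S \<Longrightarrow> r1 p = 0 \<Longrightarrow> cderiv u r1 p \<noteq> 0"
    and inj2: "\<And>p s t. p \<in> S \<Longrightarrow> p + s *c u + t *c v \<in> S \<Longrightarrow> r1 p = 0 \<Longrightarrow> r2 p = 0 \<Longrightarrow>
       r1 (p + s *c u + t *c v) = 0 \<Longrightarrow> r2 (p + s *c u + t *c v) = 0 \<Longrightarrow> t = 0"
  shows "\<exists>g. hol g S \<and> (\<forall>x\<in>S. f1 x = g x * r1 x)"
proof -
  \<comment> \<open>On the zeros of r1 this is the value of l'Hopital's rule along u, which is
    correct once f1 is known to vanish there.\<close>
  define g where "g x = (if r1 x = 0 then cderiv u f1 x / cderiv u r1 x else f1 x / r1 x)" for x
  have slice: "(\<lambda>t. g (q + t *c u)) holomorphic_on X"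
    if X: "open X" "X \<subseteq> {t. q + t *c u \<in> S}"
    and van: "\<And>t. t \<in> X \<Longrightarrow> r1 (q + t *c u) = 0 \<Longrightarrow> f1 (q + t *c u) = 0" for q X
  proof -
    have d: "deriv (\<lambda>t. r1 (q + t *c u)) t = cderiv u r1 (q + t *c u)"
        "deriv (\<lambda>t. f1 (q + t *c u)) t = cderiv u f1 (q + t *c u)" if "t \<in> X" for t
      using hol_DERIV[OF r1 S, of q t u] hol_DERIV[OF f1 S, of q t u] that X by (auto intro: DERIV_imp_deriv)
    have "(\<lambda>t. if r1 (q + t *c u) = 0 then deriv (\<lambda>t. f1 (q + t *c u)) t / deriv (\<lambda>t. r1 (q + t *c u)) t
        else f1 (q + t *c u) / r1 (q + t *c u)) holomorphic_on X"
    proof (rule divide_simple_zero[OF X(1)])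
      show "(\<lambda>t. f1 (q + t *c u)) holomorphic_on X" "(\<lambda>t. r1 (q + t *c u)) holomorphic_on X"
        by (rule holomorphic_on_subset[OF hol_line[OF f1] X(2)] holomorphic_on_subset[OF hol_line[OF r1] X(2)])+
      show "deriv (\<lambda>t. r1 (q + t *c u)) t \<noteq> 0" if "t \<in> X" "r1 (q + t *c u) = 0" for t
        using simple[OF _ that(2)] that(1) X(2) by (auto simp: d)
      fix s t assume st: "s \<in> X" "t \<in> X" "r1 (q + s *c u) = 0" "r1 (q + t *c u) = 0"
      have "(q + s *c u) + (t - s) *c u = q + t *c u" by (simp add: scaleC_diff_left)
      moreover have "q + s *c u \<in> S" "q + t *c u \<in> S" using st X(2) by auto
      ultimately have "t - s = 0" using inj1[of "q + s *c u" "t - s"] st by metis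
      then show "s = t" by simp
    qed (rule van)
    then show ?thesis
      by (rule holomorphic_transform) (use d in \<open>auto simp: g_def\<close>)
  qed
  have S': "open {x \<in> S. r1 x \<noteq> 0}"
    by (rule open_nonzero[OF hol_continuous_on[OF r1] S])
  have circle: "compact ((\<lambda>s. p + s *c u) ` sphere 0 (r/2))"
    "(\<lambda>s. p + s *c u) ` sphere 0 (r/2) \<subseteq> {x \<in> S. r1 x \<noteq> 0}"
    if p: "p \<in> S" "r1 p = 0" and r: "r > 0" "\<And>s. cmod s \<le> r \<Longrightarrow> p + s *c u \<in> S" for p r
  proof -
    show "compact ((\<lambda>s. p + s *c u) ` sphere 0 (r/2))"
      by (auto intro!: compact_continuous_image continuous_intros)
    show "(\<lambda>s. p + s *c u) ` sphere 0 (r/2) \<subseteq> {x \<in> S. r1 x \<noteq> 0}"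
    proof clarify
      fix s :: complex assume s: "s \<in> sphere 0 (r/2)"
      then have inS: "p + s *c u \<in> S" and "s \<noteq> 0" using r by auto
      then show "p + s *c u \<in> S \<and> r1 (p + s *c u) \<noteq> 0" using inj1[OF p(1) inS p(2)] by blast
    qed
  qed
  \<comment> \<open>At a common zero the relation says nothing about f1. On the u-disc through p + t
    v with t \<noteq> 0 there is no common zero, so f1/r1 extends holomorphically over it. It is at
    most M + 1 on the boundary, where M bounds f1/r1 on the fixed circle about p. As t tends to 0
    this gives |f1 p| \<le> (M + 1) |r1 p| = 0.\<close>
  have van: "f1 p = 0" if p: "p \<in> S" "r1 p = 0" for p
  proof (cases "r2 p = 0")
    case False
    then show ?thesis using rel[OF p(1)] p by auto
  next
    case True
    obtain r where r: "r > 0" "\<And>s t. cmod s \<le> r \<Longrightarrow> cmod t \<le> r \<Longrightarrow> p + s *c u + t *c v \<in> S"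
      using open_line_ball[OF S p(1), of u v] by blast
    define K where "K = (\<lambda>s. p + s *c u) ` sphere 0 (r/2)"
    have K: "compact K" "K \<subseteq> {x \<in> S. r1 x \<noteq> 0}"
      unfolding K_def using circle[OF p r(1)] r(2)[of _ 0] r(1) by simp_all
    have contq: "continuous_on {x \<in> S. r1 x \<noteq> 0} (\<lambda>x. f1 x / r1 x)"
      using hol_continuous_on[OF f1] hol_continuous_on[OF r1]
      by (auto intro!: continuous_intros intro: continuous_on_subset)
    have "compact ((\<lambda>x. f1 x / r1 x) ` K)"
      by (rule compact_continuous_image[OF continuous_on_subset[OF contq K(2)] K(1)])
    then obtain M where M: "\<And>x. x \<in> K \<Longrightarrow> cmod (f1 x / r1 x) \<le> M"
      by (meson bounded_iff compact_imp_bounded imageI)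
    obtain d where d: "d > 0" "\<And>x y. x \<in> K \<Longrightarrow> dist y x < d \<Longrightarrow>
        y \<in> {x \<in> S. r1 x \<noteq> 0} \<and> dist (f1 y / r1 y) (f1 x / r1 x) < 1"
      by (rule compact_uniform_neighbourhood[OF K S' contq zero_less_one]) blast
    have bound: "cmod (f1 (p + t *c v)) \<le> (M + 1) * cmod (r1 (p + t *c v))"
      if t: "t \<noteq> 0" "cmod t < r" "norm (t *c v) < d" for t
    proof -
      let ?q = "p + t *c v"
      have inS: "?q + s *c u \<in> S" if "s \<in> ball 0 r" for s
        using r(2)[of s t] that t(2) by (simp add: algebra_simps)
      have vs: "f1 (?q + s *c u) = 0" if s: "s \<in> ball 0 r" "r1 (?q + s *c u) = 0" for s
      proof -
        have eq: "?q + s *c u = p + s *c u + t *c v" by (simp add: algebra_simps)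
        have "r2 (?q + s *c u) \<noteq> 0"
          using inj2[OF p(1), of s t] inS[OF s(1)] p(2) True s(2) t(1) unfolding eq by blast
        then show ?thesis using rel[OF inS[OF s(1)]] s(2) by simp
      qed
      have hs: "(\<lambda>s. g (?q + s *c u)) holomorphic_on ball 0 r"
        by (rule slice) (use inS vs in auto)
      have "cmod (g (?q + 0 *c u)) \<le> M + 1"
      proof (rule maximum_modulus_disc[OF hs, of "r/2"])
        fix s :: complex assume s: "cmod s = r/2"
        then have x: "p + s *c u \<in> K" by (auto simp: K_def)
        have "dist (?q + s *c u) (p + s *c u) < d" using t(3) by (simp add: dist_norm)
        from d(2)[OF x this] M[OF x] show "cmod (g (?q + s *c u)) \<le> M + 1"
          using norm_triangle_sub[of "f1 (?q + s *c u) / r1 (?q + s *c u)" "f1 (p + s *c u) / r1 (p + s *c u)"]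
          by (simp add: g_def dist_norm)
      qed (use r in auto)
      moreover have "f1 ?q = g ?q * r1 ?q"
        using vs[of 0] r(1) by (auto simp: g_def)
      ultimately show ?thesis by (simp add: norm_mult mult_right_mono)
    qed
    have lim: "((\<lambda>t. h (p + t *c v)) \<longlongrightarrow> h p) (at 0)" if "hol h S" for h
    proof -
      have "isCont h p" by (rule hol_isCont[OF that S p(1)])
      moreover have "((\<lambda>t. p + t *c v) \<longlongrightarrow> p + 0 *c v) (at 0)" by (intro tendsto_intros)
      then have "((\<lambda>t. p + t *c v) \<longlongrightarrow> p) (at 0)" by simp
      ultimately show ?thesis by (rule isCont_tendsto_compose)
    qed
    have "((\<lambda>t. norm (t *c v)) \<longlongrightarrow> norm (0 *c v)) (at 0)" by (intro tendsto_intros)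
    then have "\<forall>\<^sub>F t in at 0. norm (t *c v) < d" using d(1) by (intro order_tendstoD) auto
    moreover have "\<forall>\<^sub>F t in at 0. cmod t < r" using r(1) by (auto simp: eventually_at intro!: exI[of _ r])
    moreover have "\<forall>\<^sub>F t::complex in at 0. t \<noteq> 0" by (simp add: eventually_at_filter)
    ultimately have "\<forall>\<^sub>F t in at 0. cmod (f1 (p + t *c v)) \<le> (M + 1) * cmod (r1 (p + t *c v))"
      by eventually_elim (rule bound)
    then have "cmod (f1 p) \<le> (M + 1) * cmod (r1 p)"
      by (intro tendsto_le[OF _ tendsto_mult[OF tendsto_const tendsto_norm[OF lim[OF r1]]] tendsto_norm[OF lim[OF f1]]]) auto
    then show ?thesis using p(2) by simp
  qed
  have quot: "hol g {x \<in> S. r1 x \<noteq> 0}"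
  proof -
    have "hol (\<lambda>x. f1 x / r1 x) {x \<in> S. r1 x \<noteq> 0}"
      by (intro hol_intros hol_subset[OF f1] hol_subset[OF r1]) auto
    then show ?thesis by (subst hol_cong[of _ _ "\<lambda>x. f1 x / r1 x"]) (auto simp: g_def)
  qed
  have "continuous_on S g"
  proof (rule continuous_at_imp_continuous_on, rule ballI)
    fix p assume p: "p \<in> S"
    show "isCont g p"
    proof (cases "r1 p = 0")
      case False
      then show ?thesis by (intro hol_isCont[OF quot S']) (use p in simp)
    next
      case True
      obtain r where r: "r > 0" "\<And>s t. cmod s \<le> r \<Longrightarrow> cmod t \<le> r \<Longrightarrow> p + s *c u + t *c u \<in> S"
        using open_line_ball[OF S p, of u u] by blast
      define K where "K = (\<lambda>s. p + s *c u) ` sphere 0 (r/2)"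
      have K: "compact K" "K \<subseteq> {x \<in> S. r1 x \<noteq> 0}"
        unfolding K_def using circle[OF p True r(1)] r(2)[of _ 0] r(1) by simp_all
      have K2: "compact ((\<lambda>s. p + s *c u) ` cball 0 r)" "(\<lambda>s. p + s *c u) ` cball 0 r \<subseteq> S"
        using r(2)[of _ 0] r(1) by (auto intro!: compact_continuous_image continuous_intros)
      obtain d0 where d0: "d0 > 0" "\<And>x y. x \<in> (\<lambda>s. p + s *c u) ` cball 0 r \<Longrightarrow> dist y x < d0 \<Longrightarrow> y \<in> S"
      proof (rule compact_uniform_neighbourhood[OF K2 S hol_continuous_on[OF r1] zero_less_one])
        fix d :: real
        assume d: "d > 0" "\<And>x y. x \<in> (\<lambda>s. p + s *c u) ` cball 0 r \<Longrightarrow> dist y x < d \<Longrightarrow> y \<in> S \<and> dist (r1 y) (r1 x) < 1"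
        show thesis by (rule that[OF d(1) d(2)[THEN conjunct1]])
      qed
      show ?thesis
        unfolding continuous_at_eps_delta
      proof (intro allI impI)
        fix e :: real assume "e > 0"
        obtain d where d: "d > 0" "\<And>x y. x \<in> K \<Longrightarrow> dist y x < d \<Longrightarrow>
            y \<in> {x \<in> S. r1 x \<noteq> 0} \<and> dist (g y) (g x) < e / 2"
          by (rule compact_uniform_neighbourhood[OF K S' hol_continuous_on[OF quot] half_gt_zero[OF \<open>e > 0\<close>]]) blast
        have "dist (g q) (g p) < e" if q: "dist q p < min d d0" for q
        proof -
          have inS: "q + s *c u \<in> S" "p + s *c u \<in> S" if "s \<in> ball 0 r" for s
            using d0(2)[of "p + s *c u" "q + s *c u"] q that K2(2) by (auto simp: dist_norm)
          \<comment> \<open>Whether or not q is a zero of r1, both slices are holomorphic by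
            \<open>slice\<close>, and closeness is required only on the circle, where r1 has no
            zeros.\<close>
          have "cmod (g (q + 0 *c u) - g (p + 0 *c u)) \<le> e / 2"
          proof (rule maximum_modulus_disc[of "\<lambda>s. g (q + s *c u) - g (p + s *c u)" r "r/2"])
            show "(\<lambda>s. g (q + s *c u) - g (p + s *c u)) holomorphic_on ball 0 r"
              by (intro holomorphic_on_diff slice) (use inS van in auto)
            fix s :: complex assume "cmod s = r/2"
            then have "p + s *c u \<in> K" by (auto simp: K_def)
            from d(2)[OF this, of "q + s *c u"] q
            show "cmod (g (q + s *c u) - g (p + s *c u)) \<le> e / 2" by (simp add: dist_norm)
          qed (use r in auto)
          then show ?thesis using \<open>e > 0\<close> by (simp add: dist_norm)
        qed
        then show "\<exists>d>0. \<forall>x'. dist x' p < d \<longrightarrow> dist (g x') (g p) < e"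
          using d d0 by (intro exI[of _ "min d d0"]) auto
      qed
    qed
  qed
  then have "hol g S"
    by (rule hol_removable_zero_set[OF S _ r1 quot]) (use inj1 in blast)
  moreover have "f1 x = g x * r1 x" if "x \<in> S" for x
    using van[OF that] by (auto simp: g_def)
  ultimately show ?thesis by blast
qed

section \<open>Iterated quotients of derivatives\<close>

text \<open>Subtracting the linear function c t before applying the mean value inequality measures
  how far the increment is from its linear prediction c.\<close>

lemma hol_mean_value:
  assumes "hol f S" "open S" "convex S" "p \<in> S" "p + w \<in> S"
    and "\<And>q. q \<in> S \<Longrightarrow> cmod (cderiv w f q - c) \<le> B"
  shows "cmod (f (p + w) - f p - c) \<le> B"
proof -
  let ?X = "{t. p + t *c w \<in> S}"
  have "cmod ((f (p + 1 *c w) - c * 1) - (f (p + 0 *c w) - c * 0)) \<le> B * cmod (1 - 0)"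
  proof (rule field_differentiable_bound[OF convex_line[OF assms(3)]])
    fix t assume "t \<in> ?X"
    then have t: "p + t *c w \<in> S" by simp
    show "((\<lambda>t. f (p + t *c w) - c * t) has_field_derivative cderiv w f (p + t *c w) - c) (at t within ?X)"
      using hol_DERIV[OF assms(1,2) t]
      by (intro has_field_derivative_at_within[OF DERIV_diff]) (auto intro!: derivative_eq_intros)
    show "cmod (cderiv w f (p + t *c w) - c) \<le> B" by (rule assms(6)[OF t])
  qed (use assms in auto)
  then show ?thesis by (simp add: algebra_simps)
qed

text \<open>Each \<open>\<phi> (Suc k)\<close> is the derivative of \<open>\<phi> k\<close> divided
  by \<rho>', so it is bounded by Cauchy's estimate over c. The statement keeps s free because the
  bound of \<open>\<phi> (Suc k)\<close> on radius s needs that of \<open>\<phi> k\<close> on a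
  slightly larger radius.\<close>

lemma iterated_quotient_bound:
  fixes \<phi> :: "nat \<Rightarrow> complex \<Rightarrow> complex" and \<rho>' :: "complex \<Rightarrow> complex"
  assumes der: "\<And>k t. t \<in> ball 0 \<epsilon> \<Longrightarrow> (\<phi> k has_field_derivative \<phi> (Suc k) t * \<rho>' t) (at t)"
    and low: "\<And>t. t \<in> ball 0 \<epsilon> \<Longrightarrow> c \<le> cmod (\<rho>' t)" and c: "c > 0"
    and M: "\<And>t. t \<in> ball 0 \<epsilon> \<Longrightarrow> cmod (\<phi> 0 t) \<le> M"
  shows "0 \<le> s \<Longrightarrow> s < \<epsilon> \<Longrightarrow> cmod t \<le> s \<Longrightarrow> cmod (\<phi> k t) \<le> M * (real (Suc k) / (c * (\<epsilon> - s))) ^ k"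
proof (induction k arbitrary: s t)
  case 0
  then show ?case using M[of t] by simp
next
  case (Suc k)
  \<comment> \<open>With this choice the remaining radius shrinks by the factor (k+1)/(k+2), so the
    base of the power in the induction hypothesis is already the base wanted for k + 1. Unfolded,
    every step spends the same portion of the radius.\<close>
  define \<delta> where "\<delta> = (\<epsilon> - s) / real (Suc (Suc k))"
  have \<delta>: "\<delta> > 0" "s + \<delta> < \<epsilon>" and eq: "\<epsilon> - (s + \<delta>) = (\<epsilon> - s) * (real (Suc k) / real (Suc (Suc k)))"
  proof -
    have "(\<epsilon> - s) * 1 < (\<epsilon> - s) * real (Suc (Suc k))"
      by (rule mult_strict_left_mono) (use Suc.prems in auto)
    then have "\<delta> < \<epsilon> - s" by (simp add: \<delta>_def divide_less_eq)
    then show "s + \<delta> < \<epsilon>" by simp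
    show "\<delta> > 0" using Suc.prems by (simp add: \<delta>_def)
    show "\<epsilon> - (s + \<delta>) = (\<epsilon> - s) * (real (Suc k) / real (Suc (Suc k)))"
      by (simp add: \<delta>_def field_simps)
  qed
  let ?B = "M * (real (Suc (Suc k)) / (c * (\<epsilon> - s))) ^ k"
  have "real (Suc k) / (c * (\<epsilon> - (s + \<delta>))) = real (Suc (Suc k)) / (c * (\<epsilon> - s))"
    unfolding eq by (simp del: of_nat_Suc)
  then have IH: "cmod (\<phi> k x) \<le> ?B" if "cmod x \<le> s + \<delta>" for x
    using Suc.IH[of "s + \<delta>" x] that \<delta> Suc.prems by simp
  have inb: "x \<in> ball 0 \<epsilon>" "cmod x \<le> s + \<delta>" if "x \<in> cball t \<delta>" for x
  proof -
    have "cmod x \<le> cmod t + cmod (x - t)" by (metis norm_triangle_sub add.commute)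
    then show "x \<in> ball 0 \<epsilon>" "cmod x \<le> s + \<delta>" using that Suc.prems \<delta> by (auto simp: dist_norm norm_minus_commute)
  qed
  have hol: "\<phi> k holomorphic_on ball 0 \<epsilon>"
    unfolding holomorphic_on_open[OF open_ball] using der by blast
  have "cmod ((deriv ^^ 1) (\<phi> k) t) \<le> fact 1 * ?B / \<delta> ^ 1"
  proof (rule Cauchy_inequality)
    show "\<phi> k holomorphic_on ball t \<delta>" by (rule holomorphic_on_subset[OF hol]) (use inb in auto)
    show "continuous_on (cball t \<delta>) (\<phi> k)"
      by (rule continuous_on_subset[OF holomorphic_on_imp_continuous_on[OF hol]]) (use inb in auto)
    show "cmod (\<phi> k x) \<le> ?B" if "cmod (t - x) = \<delta>" for x
      by (rule IH, rule inb) (use that in \<open>simp add: dist_norm\<close>)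
  qed (rule \<delta>)
  moreover have t: "t \<in> ball 0 \<epsilon>" using inb(1)[of t] \<delta> by simp
  ultimately have "cmod (\<phi> (Suc k) t) * cmod (\<rho>' t) \<le> ?B / \<delta>"
    using DERIV_imp_deriv[OF der[OF t, of k]] by (simp add: norm_mult)
  moreover have "cmod (\<phi> (Suc k) t) * c \<le> cmod (\<phi> (Suc k) t) * cmod (\<rho>' t)"
    by (intro mult_left_mono low t) auto
  ultimately have "cmod (\<phi> (Suc k) t) * c \<le> ?B / \<delta>" by linarith
  then have "cmod (\<phi> (Suc k) t) \<le> ?B / \<delta> / c" using c by (simp only: pos_le_divide_eq)
  also have "\<dots> = M * (real (Suc (Suc k)) / (c * (\<epsilon> - s))) ^ Suc k"
    by (simp add: \<delta>_def ac_simps)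
  finally show ?case .
qed

text \<open>The quotient (k+1)^k / k! is a single term of the exponential series at k + 1. Thus k
  equal Cauchy steps cost only a geometric factor beyond k!.\<close>

lemma Suc_power_le_exp_fact: "real (Suc k) ^ k \<le> exp 1 * exp 1 ^ k * fact k"
proof -
  have "real (Suc k) ^ k /\<^sub>R fact k \<le> (\<Sum>n. real (Suc k) ^ n /\<^sub>R fact n)"
  proof -
    have "sum (\<lambda>n. real (Suc k) ^ n /\<^sub>R fact n) {k} \<le> (\<Sum>n. real (Suc k) ^ n /\<^sub>R fact n)"
      by (rule sum_le_suminf[OF summable_exp_generic]) auto
    then show ?thesis by simp
  qed
  also have "\<dots> = exp (real (Suc k))" by (simp only: exp_def)
  also have "\<dots> = exp 1 * exp 1 ^ k" by (simp add: exp_add exp_of_nat_mult[symmetric])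
  finally show ?thesis by (simp add: field_simps)
qed

lemma iterated_quotient_bound_fact:
  fixes \<phi> :: "nat \<Rightarrow> complex \<Rightarrow> complex" and \<rho>' :: "complex \<Rightarrow> complex"
  assumes der: "\<And>k t. t \<in> ball 0 \<epsilon> \<Longrightarrow> (\<phi> k has_field_derivative \<phi> (Suc k) t * \<rho>' t) (at t)"
    and low: "\<And>t. t \<in> ball 0 \<epsilon> \<Longrightarrow> c \<le> cmod (\<rho>' t)" and c: "c > 0"
    and M: "\<And>t. t \<in> ball 0 \<epsilon> \<Longrightarrow> cmod (\<phi> 0 t) \<le> M" and eps: "\<epsilon> > 0" and M0: "M \<ge> 0"
  shows "cmod (\<phi> k 0) \<le> (M * exp 1) * (exp 1 / (c * \<epsilon>)) ^ k * fact k"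
proof -
  have "cmod (\<phi> k 0) \<le> M * (real (Suc k) / (c * (\<epsilon> - 0))) ^ k"
    by (rule iterated_quotient_bound[OF der low c M]) (use eps in auto)
  also have "\<dots> = M * (1 / (c * \<epsilon>)) ^ k * real (Suc k) ^ k" by (simp add: power_divide)
  also have "\<dots> \<le> M * (1 / (c * \<epsilon>)) ^ k * (exp 1 * exp 1 ^ k * fact k)"
    using M0 c eps by (intro mult_left_mono Suc_power_le_exp_fact) auto
  also have "\<dots> = (M * exp 1) * (exp 1 / (c * \<epsilon>)) ^ k * fact k" by (simp add: power_divide)
  finally show ?thesis .
qed

lemma cderiv_cong:
  assumes "open S" "p \<in> S" "\<And>x. x \<in> S \<Longrightarrow> f x = g x"
  shows "cderiv v f p = cderiv v g p"
  unfolding cderiv_def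
proof (rule deriv_cong_ev[OF _ refl])
  have "open {t. p + t *c v \<in> S}" by (rule open_line[OF assms(1)])
  moreover have "0 \<in> {t. p + t *c v \<in> S}" using assms(2) by simp
  ultimately have "\<forall>\<^sub>F t in nhds 0. t \<in> {t. p + t *c v \<in> S}" by (rule eventually_nhds_in_open)
  then show "\<forall>\<^sub>F t in nhds 0. f (p + t *c v) = g (p + t *c v)"
    by eventually_elim (use assms(3) in auto)
qed

lemma cderiv_mult:
  assumes "hol f S" "hol g S" "open S" "p \<in> S"
  shows "cderiv v (\<lambda>x. f x * g x) p = cderiv v f p * g p + f p * cderiv v g p"
  using DERIV_mult[OF hol_DERIV0[OF assms(1,3,4), of v] hol_DERIV0[OF assms(2,3,4), of v]]
  by (intro cderiv_eqI) (simp add: algebra_simps)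

text \<open>If r p = 0, the points p + t u with small t \<noteq> 0 lie off the zeros of r and tend
  to p, so continuity of h decides.\<close>

lemma eq_0_of_dense:
  fixes h :: "'a::complex_space \<Rightarrow> complex"
  assumes h: "continuous_on S h" and S: "open S" and p: "p \<in> S"
    and inj: "\<And>s. p + s *c u \<in> S \<Longrightarrow> r (p + s *c u) = 0 \<Longrightarrow> r p = 0 \<Longrightarrow> s = 0"
    and zero: "\<And>x. x \<in> S \<Longrightarrow> r x \<noteq> (0::complex) \<Longrightarrow> h x = 0"
  shows "h p = 0"
proof (cases "r p = 0")
  case False
  then show ?thesis using zero p by blast
next
  case True
  have "isCont h p" using h S p continuous_on_eq_continuous_at by blast
  moreover have "((\<lambda>t. p + t *c u) \<longlongrightarrow> p + 0 *c u) (at 0)" by (intro tendsto_intros)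
  then have lim: "((\<lambda>t. p + t *c u) \<longlongrightarrow> p) (at 0)" by simp
  ultimately have "((\<lambda>t. h (p + t *c u)) \<longlongrightarrow> h p) (at 0)" by (rule isCont_tendsto_compose)
  moreover have "\<forall>\<^sub>F t in at 0. h (p + t *c u) = 0"
  proof -
    have "\<forall>\<^sub>F t in at 0. p + t *c u \<in> S" by (rule topological_tendstoD[OF lim S p])
    moreover have "\<forall>\<^sub>F t::complex in at 0. t \<noteq> 0" by (simp add: eventually_at_filter)
    ultimately show ?thesis
    proof eventually_elim
      case (elim t)
      then have "r (p + t *c u) \<noteq> 0" using inj True by blast
      then show ?case using zero elim by blast
    qed
  qed
  then have "((\<lambda>t. h (p + t *c u)) \<longlongrightarrow> 0) (at 0)" by (rule tendsto_eventually)
  ultimately show ?thesis by (intro tendsto_unique) auto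
qed

text \<open>In every (u, v)-plane the increments of (r1, r2) differ from the displacement (s, t) by
  a small fraction of |s| + |t|; convexity of S carries this from derivatives to increments. All
  transversality used for division, density and lower bounds comes from here.\<close>

locale nondegenerate_pair =
  fixes S :: "'a::complex_space set" and r1 r2 :: "'a \<Rightarrow> complex" and u v :: 'a
  assumes S: "open S" "convex S"
    and r1: "hol r1 S" and r2: "hol r2 S"
    and close: "\<And>q. q \<in> S \<Longrightarrow> cmod (cderiv u r1 q - 1) \<le> 1/8" "\<And>q. q \<in> S \<Longrightarrow> cmod (cderiv v r1 q) \<le> 1/8"
      "\<And>q. q \<in> S \<Longrightarrow> cmod (cderiv u r2 q) \<le> 1/8" "\<And>q. q \<in> S \<Longrightarrow> cmod (cderiv v r2 q - 1) \<le> 1/8"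
begin

lemma increments:
  assumes p: "p \<in> S" "p + s *c u + t *c v \<in> S"
  shows "cmod (r1 (p + s *c u + t *c v) - r1 p - s) \<le> (cmod s + cmod t) / 8"
    and "cmod (r2 (p + s *c u + t *c v) - r2 p - t) \<le> (cmod s + cmod t) / 8"
proof -
  have p': "p + (s *c u + t *c v) \<in> S" using p(2) by (simp add: add.assoc)
  have lin: "cderiv (s *c u + t *c v) r q = s * cderiv u r q + t * cderiv v r q" if "q \<in> S" "hol r S" for q r
    using that S by (simp add: cderiv_add_direction[of r S] cderiv_scale[of r S])
  have "cmod (cderiv (s *c u + t *c v) r1 q - s) \<le> (cmod s + cmod t) / 8" if q: "q \<in> S" for q
  proof -
    have "cmod (s * (cderiv u r1 q - 1) + t * cderiv v r1 q) \<le> cmod s * (1/8) + cmod t * (1/8)"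
      by (intro norm_triangle_le add_mono; unfold norm_mult; intro mult_left_mono close[OF q] norm_ge_zero)
    then show ?thesis by (simp add: lin[OF q r1] algebra_simps)
  qed
  from hol_mean_value[OF r1 S p(1) p' this]
  show "cmod (r1 (p + s *c u + t *c v) - r1 p - s) \<le> (cmod s + cmod t) / 8" by (simp add: add.assoc)
  have "cmod (cderiv (s *c u + t *c v) r2 q - t) \<le> (cmod s + cmod t) / 8" if q: "q \<in> S" for q
  proof -
    have "cmod (s * cderiv u r2 q + t * (cderiv v r2 q - 1)) \<le> cmod s * (1/8) + cmod t * (1/8)"
      by (intro norm_triangle_le add_mono; unfold norm_mult; intro mult_left_mono close[OF q] norm_ge_zero)
    then show ?thesis by (simp add: lin[OF q r2] algebra_simps)
  qed
  from hol_mean_value[OF r2 S p(1) p' this]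
  show "cmod (r2 (p + s *c u + t *c v) - r2 p - t) \<le> (cmod s + cmod t) / 8" by (simp add: add.assoc)
qed

text \<open>The point p is not assumed to be a zero: where r1 is small at p, it is large on a circle
  around p in direction u. This yields the lower bound in
  \<open>quotient_sequence_bound\<close>.\<close>

lemma r1_growth:
  assumes "p \<in> S" "p + s *c u \<in> S"
  shows "cmod (r1 (p + s *c u)) \<ge> 7/8 * cmod s - cmod (r1 p)"
proof -
  have "cmod (r1 (p + s *c u) - r1 p - s) \<le> cmod s / 8" using increments(1)[of p s 0] assms by simp
  moreover have "cmod s \<le> cmod (r1 (p + s *c u) - r1 p - s) + cmod (r1 (p + s *c u)) + cmod (r1 p)"
    using norm_triangle_ineq4[of "r1 (p + s *c u) - r1 p" "r1 (p + s *c u) - r1 p - s"]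
      norm_triangle_ineq4[of "r1 (p + s *c u)" "r1 p"] by simp
  ultimately show ?thesis by linarith
qed

lemma r1_zero_unique:
  assumes "p \<in> S" "p + s *c u \<in> S" "r1 p = 0" "r1 (p + s *c u) = 0"
  shows "s = 0"
  using r1_growth[OF assms(1,2)] assms(3,4) by simp

lemma common_zero_unique:
  assumes "p \<in> S" "p + s *c u + t *c v \<in> S" "r1 p = 0" "r2 p = 0"
    "r1 (p + s *c u + t *c v) = 0" "r2 (p + s *c u + t *c v) = 0"
  shows "t = 0"
proof -
  have "cmod s \<le> (cmod s + cmod t) / 8" "cmod t \<le> (cmod s + cmod t) / 8"
    using increments[OF assms(1,2)] assms(3-6) by simp_all
  then have "cmod s * 7 \<le> cmod t" "cmod t * 7 \<le> cmod s" by (simp_all add: field_simps)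
  moreover have "cmod s \<ge> 0" by simp
  ultimately have "cmod t \<le> 0" by linarith
  then show ?thesis by simp
qed

lemma division:
  assumes "hol f1 S" "hol f2 S" "\<And>x. x \<in> S \<Longrightarrow> r1 x * f2 x = r2 x * f1 x"
  shows "\<exists>g. hol g S \<and> (\<forall>x\<in>S. f1 x = g x * r1 x)"
proof (rule hol_division[OF S(1) r1 r2 assms, of u v])
  fix p assume "p \<in> S"
  from close(1)[OF this] show "cderiv u r1 p \<noteq> 0" by auto
qed (use r1_zero_unique common_zero_unique in blast)+

end

text \<open>\<open>d\<^sub>\<xi>R \<and> d\<^sub>\<xi>f = 0\<close>\<close>

definition proportional_on ::
  "('b::complex_space \<times> 'c::complex_space) set \<Rightarrow> ('b \<times> 'c \<Rightarrow> complex) \<Rightarrow> ('b \<times> 'c \<Rightarrow> complex) \<Rightarrow> bool" where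
  "proportional_on S R f \<longleftrightarrow> hol f S \<and>
     (\<forall>p\<in>S. \<forall>e e'. cderiv (0, e) R p * cderiv (0, e') f p = cderiv (0, e') R p * cderiv (0, e) f p)"

text \<open>Division in two components only produces g from the e1-component; the remaining
  components follow off the zeros of the e1-derivative of R, hence everywhere by density. That g is
  again proportional is the identity d(g dR) = 0 in the variable \<xi>.\<close>

lemma nondegenerate_quotient:
  assumes nd: "nondegenerate_pair S (cderiv (0, e1) R) (cderiv (0, e2) R) u v"
    and R: "hol R S" and f: "proportional_on S R f"
  shows "\<exists>g. proportional_on S R g \<and> (\<forall>p\<in>S. \<forall>e. cderiv (0, e) f p = g p * cderiv (0, e) R p)"
proof -
  interpret nondegenerate_pair S "cderiv (0, e1) R" "cderiv (0, e2) R" u v by (rule nd)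
  have hf: "hol f S" and rel: "\<And>p e e'. p \<in> S \<Longrightarrow> cderiv (0, e) R p * cderiv (0, e') f p = cderiv (0, e') R p * cderiv (0, e) f p"
    using f by (auto simp: proportional_on_def)
  obtain g where g: "hol g S" "\<And>x. x \<in> S \<Longrightarrow> cderiv (0, e1) f x = g x * cderiv (0, e1) R x"
    using division[OF hol_cderiv[OF hf S(1), of "(0, e1)"] hol_cderiv[OF hf S(1), of "(0, e2)"] rel[of _ e1 e2]]
    by (auto simp: mult.commute)
  have fg: "cderiv (0, e) f p = g p * cderiv (0, e) R p" if p: "p \<in> S" for p e
  proof -
    have "cderiv (0, e) f p - g p * cderiv (0, e) R p = 0"
    proof (rule eq_0_of_dense[of S "\<lambda>p. cderiv (0, e) f p - g p * cderiv (0, e) R p" p u "cderiv (0, e1) R"])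
      show "continuous_on S (\<lambda>p. cderiv (0, e) f p - g p * cderiv (0, e) R p)"
        by (intro hol_continuous_on hol_intros hf R g S)
      show "cderiv (0, e) f x - g x * cderiv (0, e) R x = 0" if "x \<in> S" "cderiv (0, e1) R x \<noteq> 0" for x
      proof -
        have "cderiv (0, e1) R x * (cderiv (0, e) f x - g x * cderiv (0, e) R x) = 0"
          using rel[OF that(1), of e1 e] g(2)[OF that(1)] by (simp add: algebra_simps)
        then show ?thesis using that(2) by simp
      qed
    qed (use S p r1_zero_unique in auto)
    then show ?thesis by simp
  qed
  have "cderiv (0, e) R p * cderiv (0, e') g p = cderiv (0, e') R p * cderiv (0, e) g p" if p: "p \<in> S" for p e e'
  proof -
    \<comment> \<open>Exchanging a and b and subtracting cancels the second derivatives of f and of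
      R, which are symmetric.\<close>
    have D: "cderiv (0, b) (cderiv (0, a) f) p = cderiv (0, b) g p * cderiv (0, a) R p + g p * cderiv (0, b) (cderiv (0, a) R) p" for a b
      by (rule trans[OF cderiv_cong[OF S(1) p fg] cderiv_mult[OF g(1) hol_cderiv[OF R S(1)] S(1) p]])
    show ?thesis
      using D[of e e'] D[of e' e] cderiv_commute[OF hf S(1) p, of "(0, e)" "(0, e')"]
        cderiv_commute[OF R S(1) p, of "(0, e)" "(0, e')"] by (simp add: algebra_simps)
  qed
  then show ?thesis using g(1) fg unfolding proportional_on_def by blast
qed

text \<open>All quotients are holomorphic on the same S: the domain does not shrink with k, and the
  bounds below rely on this.\<close>

lemma nondegenerate_quotient_sequence:
  assumes nd: "nondegenerate_pair S (cderiv (0, e1) R) (cderiv (0, e2) R) u v"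
    and R: "hol R S" and f: "proportional_on S R f"
  obtains g where "g 0 = f" "\<And>k. hol (g k) S"
    "\<And>k p e. p \<in> S \<Longrightarrow> cderiv (0, e) (g k) p = g (Suc k) p * cderiv (0, e) R p"
proof -
  have "\<exists>g. \<forall>k. (proportional_on S R (g k) \<and> (k = 0 \<longrightarrow> g k = f)) \<and>
      (\<forall>p\<in>S. \<forall>e. cderiv (0, e) (g k) p = g (Suc k) p * cderiv (0, e) R p)"
    using f nondegenerate_quotient[OF nd R]
    by (intro dependent_nat_choice[where Q = "\<lambda>k g g'. \<forall>p\<in>S. \<forall>e. cderiv (0, e) g p = g' p * cderiv (0, e) R p"]) auto
  then obtain g where g: "\<And>k. (proportional_on S R (g k) \<and> (k = 0 \<longrightarrow> g k = f)) \<and>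
      (\<forall>p\<in>S. \<forall>e. cderiv (0, e) (g k) p = g (Suc k) p * cderiv (0, e) R p)" by blast
  show ?thesis
  proof (rule that[of g])
    show "g 0 = f" using g[of 0] by simp
    show "hol (g k) S" for k using g[of k] by (simp add: proportional_on_def)
    show "cderiv (0, e) (g k) p = g (Suc k) p * cderiv (0, e) R p" if "p \<in> S" for k p e
      using g[of k] that by blast
  qed
qed

section \<open>Factorial bounds for the iterated quotients\<close>

lemma scaled_norm_bound: "0 \<le> d \<Longrightarrow> 0 < c \<Longrightarrow> d / (c * (norm x + 1)) * norm x \<le> d / c"
proof -
  assume "0 \<le> d" "0 < c"
  moreover from this have "d * norm x \<le> d * (norm x + 1)" by (intro mult_left_mono) auto
  moreover have "norm x + 1 > 0" using norm_ge_zero[of x] by linarith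
  ultimately show ?thesis by (simp add: divide_simps mult.commute)
qed

text \<open>Since the e1-derivative of R vanishes at 0, the quotients are estimated on a circle p +
  s u, |s| = r, where this derivative is at least r/2. There one moves by t in direction (0, e1) and
  applies the one-variable bound, which needs only a bound of \<open>g 0\<close>. The maximum
  principle in s brings the estimate back to p.\<close>

lemma quotient_sequence_bound:
  fixes R :: "'b::complex_space \<times> 'c::complex_space \<Rightarrow> complex"
  assumes nd: "nondegenerate_pair (ball 0 d) (cderiv (0, e1) R) r2 u v" and d: "d > 0"
    and zero: "cderiv (0, e1) R 0 = 0"
    and g: "\<And>k. hol (g k) (ball 0 d)"
    and step: "\<And>k p e. p \<in> ball 0 d \<Longrightarrow> cderiv (0, e) (g k) p = g (Suc k) p * cderiv (0, e) R p"
  obtains \<delta> M K where "0 < \<delta>" "\<delta> < d" "M \<ge> 0" "K > 0"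
    "\<And>k p. p \<in> ball 0 \<delta> \<Longrightarrow> cmod (g k p) \<le> M * K ^ k * fact k"
proof -
  interpret nondegenerate_pair "ball 0 d" "cderiv (0, e1) R" r2 u v by (rule nd)
  let ?r1 = "cderiv (0, e1) R"
  \<comment> \<open>If |x| < d/4 and |s| < 2 r, then x + s u stays in the ball of radius 3d/4.
    Adding 1 to the norm excludes a zero denominator.\<close>
  define r where "r = d / (4 * (norm u + 1))"
  have r: "r > 0" using d by (simp add: r_def add_nonneg_pos)
  have ru: "r * norm u \<le> d / 4" unfolding r_def using d by (intro scaled_norm_bound) auto
  have "0 \<in> ball (0::'b \<times> 'c) d" "r / 8 > 0" using d r by simp_all
  then obtain d0 where d0: "d0 > 0" "\<And>x. norm x < d0 \<Longrightarrow> cmod (?r1 x) < r / 8"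
    by (rule hol_small_near_0[OF r1 open_ball _ zero]) (rule that)
  \<comment> \<open>Within \<delta>0 the derivative \<open>?r1\<close> is at most r/8, so on the
    circle it is at least 7r/8 - r/8, which exceeds r/2.\<close>
  define \<delta>0 where "\<delta>0 = min d0 (d / 4)"
  have \<delta>0: "\<delta>0 > 0" "\<delta>0 \<le> d / 4" using d0 d by (auto simp: \<delta>0_def)
  have small: "cmod (?r1 x) \<le> r / 8" if "norm x < \<delta>0" for x
    using d0(2)[of x] that by (simp add: \<delta>0_def)
  have inS: "norm (x + s *c u) < 3 * d / 4" if "norm x < \<delta>0" "cmod s < 2 * r" for x s
  proof -
    have "norm (x + s *c u) \<le> norm x + cmod s * norm u" by (metis norm_scaleC norm_triangle_ineq)
    also have "\<dots> \<le> norm x + 2 * r * norm u" using that by (intro add_mono mult_right_mono) auto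
    also have "\<dots> < 3 * d / 4" using that \<delta>0 ru by linarith
    finally show ?thesis .
  qed
  have low: "r / 2 \<le> cmod (?r1 (x + s *c u))" if x: "norm x < \<delta>0" and s: "cmod s = r" for x s
  proof -
    have "norm x < d" using x \<delta>0 d by linarith
    moreover have "norm (x + s *c u) < d" using inS[OF x, of s] s r d by simp
    ultimately have "cmod (?r1 (x + s *c u)) \<ge> 7/8 * cmod s - cmod (?r1 x)" by (intro r1_growth) auto
    then show ?thesis using small[OF x] s r by linarith
  qed
  have "compact (g 0 ` cball 0 (3 * d / 4))"
    by (intro compact_continuous_image continuous_on_subset[OF hol_continuous_on[OF g]]) (use d in auto)
  from compact_imp_bounded[OF this] obtain M0 where "\<forall>y\<in>g 0 ` cball 0 (3 * d / 4). cmod y \<le> M0"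
    unfolding bounded_iff by blast
  then have M0: "cmod (g 0 x) \<le> M0" if "norm x \<le> 3 * d / 4" for x using that by (simp del: split_paired_All)
  have M0_nonneg: "M0 \<ge> 0" by (rule order_trans[OF norm_ge_zero M0[of 0]]) (use d in simp)
  \<comment> \<open>For p within \<delta>0/2 the shift by t in direction (0, e1), |t| < \<epsilon>,
    stays within \<delta>0, so \<open>low\<close> applies along the whole disc in t.\<close>
  define \<epsilon> where "\<epsilon> = \<delta>0 / (2 * (norm e1 + 1))"
  have \<epsilon>: "\<epsilon> > 0" using \<delta>0 by (simp add: \<epsilon>_def add_nonneg_pos)
  have \<epsilon>e: "\<epsilon> * norm e1 \<le> \<delta>0 / 2" unfolding \<epsilon>_def using \<delta>0 by (intro scaled_norm_bound) auto
  define K where "K = exp 1 / (r / 2 * \<epsilon>)"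
  show ?thesis
  proof (rule that[of "\<delta>0 / 2" "M0 * exp 1" K])
    show "0 < \<delta>0 / 2" "\<delta>0 / 2 < d" using \<delta>0 d by linarith+
    show "0 \<le> M0 * exp 1" using M0_nonneg by simp
    show "K > 0" using r \<epsilon> by (simp add: K_def)
    fix k and p :: "'b \<times> 'c" assume p: "p \<in> ball 0 (\<delta>0 / 2)"
    have circ: "cmod (g k (p + s *c u)) \<le> (M0 * exp 1) * K ^ k * fact k" if s: "cmod s = r" for s
    proof -
      let ?x = "\<lambda>t. p + s *c u + t *c (0, e1)"
      have x: "?x t = (p + t *c (0, e1)) + s *c u" for t by (simp add: algebra_simps)
      have xn: "norm (p + t *c (0, e1)) < \<delta>0" if "t \<in> ball 0 \<epsilon>" for t
      proof -
        have "norm (p + t *c (0, e1)) \<le> norm p + norm (t *c (0::'b, e1))" by (rule norm_triangle_ineq)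
        also have "norm (t *c (0::'b, e1)) = cmod t * norm e1" by (simp only: norm_scaleC) (simp add: norm_Pair)
        also have "\<dots> \<le> \<epsilon> * norm e1" using that by (intro mult_right_mono) auto
        finally show ?thesis using \<epsilon>e p by simp
      qed
      have xS: "norm (?x t) < 3 * d / 4" if "t \<in> ball 0 \<epsilon>" for t
        unfolding x by (rule inS[OF xn[OF that]]) (use s r in auto)
      then have xS': "?x t \<in> ball 0 d" if "t \<in> ball 0 \<epsilon>" for t using that d by fastforce
      have "cmod (g k (?x 0)) \<le> (M0 * exp 1) * (exp 1 / (r / 2 * \<epsilon>)) ^ k * fact k"
      proof (rule iterated_quotient_bound_fact[of \<epsilon> "\<lambda>k t. g k (?x t)" "\<lambda>t. ?r1 (?x t)"])
        fix k and t :: complex assume t: "t \<in> ball 0 \<epsilon>"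
        show "((\<lambda>t. g k (?x t)) has_field_derivative g (Suc k) (?x t) * ?r1 (?x t)) (at t)"
          using hol_DERIV[OF g open_ball xS'[OF t], of k] unfolding step[OF xS'[OF t]] .
        show "r / 2 \<le> cmod (?r1 (?x t))" unfolding x by (rule low[OF xn[OF t] s])
        show "cmod (g 0 (?x t)) \<le> M0" by (rule M0[OF less_imp_le[OF xS[OF t]]])
      qed (use r \<epsilon> M0_nonneg in auto)
      then show ?thesis by (simp add: K_def flip: zero_prod_def)
    qed
    \<comment> \<open>From the circle to its centre p, where the e1-derivative of R may
      vanish.\<close>
    have "cmod (g k (p + 0 *c u)) \<le> (M0 * exp 1) * K ^ k * fact k"
    proof (rule maximum_modulus_disc[of "\<lambda>s. g k (p + s *c u)" "2 * r" r])
      show "(\<lambda>s. g k (p + s *c u)) holomorphic_on ball 0 (2 * r)"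
      proof (rule holomorphic_on_subset[OF hol_line[OF g]], rule subsetI)
        fix s :: complex assume "s \<in> ball 0 (2 * r)"
        moreover have "norm p < \<delta>0" using p \<delta>0 by simp
        ultimately have "norm (p + s *c u) < 3 * d / 4" by (intro inS) auto
        then show "s \<in> {s. p + s *c u \<in> ball 0 d}" using d by simp
      qed
    qed (use r circ in auto)
    then show "cmod (g k p) \<le> (M0 * exp 1) * K ^ k * fact k" by simp
  qed
qed

section \<open>The extension as a power series in w - R(z, 0)\<close>

lemma nondegenerate_near:
  assumes r1: "hol r1 S" and r2: "hol r2 S" and S: "open S" "0 \<in> S"
    and D: "cderiv u r1 0 = 1" "cderiv v r1 0 = 0" "cderiv u r2 0 = 0" "cderiv v r2 0 = 1"
  obtains d where "d > 0" "ball 0 d \<subseteq> S" "nondegenerate_pair (ball 0 d) r1 r2 u v"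
proof -
  have near: "\<exists>d>0. \<forall>x. norm x < d \<longrightarrow> cmod (cderiv w r x - cderiv w r 0) < 1/8" if "hol r S" for w r
  proof -
    have "isCont (cderiv w r) 0" by (rule hol_isCont[OF hol_cderiv[OF that S(1)] S])
    then show ?thesis unfolding continuous_at_eps_delta
      by (simp only: dist_norm diff_zero)
  qed
  obtain d0 where d0: "d0 > 0" "ball 0 d0 \<subseteq> S" using S open_contains_ball by blast
  obtain d1 where d1: "d1 > 0" "\<And>x. norm x < d1 \<Longrightarrow> cmod (cderiv u r1 x - cderiv u r1 0) < 1/8" using near[OF r1, of u] by blast
  obtain d2 where d2: "d2 > 0" "\<And>x. norm x < d2 \<Longrightarrow> cmod (cderiv v r1 x - cderiv v r1 0) < 1/8" using near[OF r1, of v] by blast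
  obtain d3 where d3: "d3 > 0" "\<And>x. norm x < d3 \<Longrightarrow> cmod (cderiv u r2 x - cderiv u r2 0) < 1/8" using near[OF r2, of u] by blast
  obtain d4 where d4: "d4 > 0" "\<And>x. norm x < d4 \<Longrightarrow> cmod (cderiv v r2 x - cderiv v r2 0) < 1/8" using near[OF r2, of v] by blast
  define d where "d = Min {d0, d1, d2, d3, d4}"
  have d: "d > 0" "d \<le> d0" "d \<le> d1" "d \<le> d2" "d \<le> d3" "d \<le> d4"
    using d0 d1 d2 d3 d4 by (auto simp: d_def)
  have sub: "ball 0 d \<subseteq> S" using d0(2) d(2) by (meson order_trans subset_ball)
  show ?thesis
  proof (rule that[OF d(1) sub])
    show "nondegenerate_pair (ball 0 d) r1 r2 u v"
    proof
      show "hol r1 (ball 0 d)" "hol r2 (ball 0 d)" by (rule hol_subset[OF r1 sub] hol_subset[OF r2 sub])+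
      fix q assume "q \<in> ball (0::'a) d"
      then have "norm q < d" by simp
      then show "cmod (cderiv u r1 q - 1) \<le> 1/8" "cmod (cderiv v r1 q) \<le> 1/8"
        "cmod (cderiv u r2 q) \<le> 1/8" "cmod (cderiv v r2 q - 1) \<le> 1/8"
        using d1(2)[of q] d2(2)[of q] d3(2)[of q] d4(2)[of q] d D by simp_all
    qed auto
  qed
qed

text \<open>\<open>\<Sum>\<^sub>k g\<^sub>k(z, \<xi>) (w - R(z, \<xi>))\<^sup>k / k!\<close> has telescoping \<open>\<xi>\<close>-derivative. At \<open>\<xi> = 0\<close> it defines the
  extension, and at \<open>w = R(z, \<xi>)\<close> it is \<open>f(z, \<xi>)\<close>.\<close>

lemma DERIV_taylor_telescope:
  assumes g: "\<And>k. (g k has_field_derivative g (Suc k) t * R') (at t)" and R: "(R has_field_derivative R') (at t)"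
  shows "((\<lambda>t. \<Sum>k<Suc n. g k t / fact k * (w - R t) ^ k) has_field_derivative
     g (Suc n) t * R' * (w - R t) ^ n / fact n) (at t)"
proof (induction n)
  case 0
  then show ?case using g[of 0] by simp
next
  case (Suc n)
  have "((\<lambda>t. g (Suc n) t / fact (Suc n) * (w - R t) ^ Suc n) has_field_derivative
      (g (Suc (Suc n)) t * R' / fact (Suc n) * (w - R t) ^ Suc n +
       (of_nat (Suc n) * (w - R t) ^ n * (0 - R')) * (g (Suc n) t / fact (Suc n)))) (at t)"
    using DERIV_power[OF DERIV_diff[OF DERIV_const R], of w "Suc n"]
    by (intro DERIV_mult DERIV_cdivide g) (simp add: algebra_simps)
  from DERIV_add[OF Suc.IH this]
  have "((\<lambda>t. \<Sum>k<Suc (Suc n). g k t / fact k * (w - R t) ^ k) has_field_derivative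
     g (Suc n) t * R' * (w - R t) ^ n / fact n + (g (Suc (Suc n)) t * R' / fact (Suc n) * (w - R t) ^ Suc n +
       (of_nat (Suc n) * (w - R t) ^ n * (0 - R')) * (g (Suc n) t / fact (Suc n)))) (at t)"
    by (simp add: lessThan_Suc add.commute)
  moreover have "g (Suc n) t * R' * (w - R t) ^ n / fact n + (g (Suc (Suc n)) t * R' / fact (Suc n) * (w - R t) ^ Suc n +
       (of_nat (Suc n) * (w - R t) ^ n * (0 - R')) * (g (Suc n) t / fact (Suc n))) =
     g (Suc (Suc n)) t * R' * (w - R t) ^ Suc n / fact (Suc n)"
  proof -
    have "(of_nat (Suc n) * (w - R t) ^ n * (0 - R')) * (g (Suc n) t / fact (Suc n)) = - (g (Suc n) t * R' * (w - R t) ^ n / fact n)"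
      by (simp add: fact_Suc divide_simps del: of_nat_Suc)
    then show ?thesis by (simp only:) simp
  qed
  ultimately show ?case by simp
qed

text \<open>F is summed on the slice \<xi> = 0, so that it depends on (z, w) only. Agreement with f
  is obtained by fixing w and moving along the segment from (z, 0) to (z, \<xi>), where the partial
  sums are nearly constant.\<close>

theorem holomorphic_factorization:
  fixes R f :: "'b::complex_space \<times> 'c::complex_space \<Rightarrow> complex"
  assumes R: "hol R (ball 0 D)" and D: "D > 0" and f: "proportional_on (ball 0 D) R f"
    and R0: "R 0 = 0" and crit: "cderiv (0, e1) R 0 = 0"
    and nondeg: "cderiv u (cderiv (0, e1) R) 0 = 1" "cderiv v (cderiv (0, e1) R) 0 = 0"
      "cderiv u (cderiv (0, e2) R) 0 = 0" "cderiv v (cderiv (0, e2) R) 0 = 1"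
  obtains \<delta> F where "\<delta> > 0" "hol F (ball 0 \<delta>)"
    "\<And>z \<xi>. (z, \<xi>) \<in> ball 0 \<delta> \<Longrightarrow> (z, R (z, \<xi>)) \<in> ball 0 \<delta> \<Longrightarrow> f (z, \<xi>) = F (z, R (z, \<xi>))"
proof -
  obtain d where d: "d > 0" "ball (0::'b \<times> 'c) d \<subseteq> ball 0 D"
    and nd: "nondegenerate_pair (ball 0 d) (cderiv (0, e1) R) (cderiv (0, e2) R) u v"
  proof (rule nondegenerate_near[OF hol_cderiv[OF R open_ball] hol_cderiv[OF R open_ball] open_ball _ nondeg])
    show "0 \<in> ball (0::'b \<times> 'c) D" using D by simp
  qed (rule that)
  have hR: "hol R (ball 0 d)" by (rule hol_subset[OF R d(2)])
  have pf: "proportional_on (ball 0 d) R f" using f d(2) hol_subset unfolding proportional_on_def by blast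
  obtain g where g: "g 0 = f" "\<And>k. hol (g k) (ball 0 d)"
    "\<And>k p e. p \<in> ball 0 d \<Longrightarrow> cderiv (0, e) (g k) p = g (Suc k) p * cderiv (0, e) R p"
    by (rule nondegenerate_quotient_sequence[OF nd hR pf], rule that)
  obtain \<delta>1 M K where \<delta>1: "0 < \<delta>1" "\<delta>1 < d" and M: "M \<ge> 0" and K: "K > 0"
    and bd: "\<And>k p. p \<in> ball 0 \<delta>1 \<Longrightarrow> cmod (g k p) \<le> M * K ^ k * fact k"
    by (rule quotient_sequence_bound[where g = g, OF nd d(1) crit g(2) g(3)], assumption, rule that)
  have "0 \<in> ball (0::'b \<times> 'c) d" "1 / (8 * K) > 0" using d K by simp_all
  then obtain d0 where d0: "d0 > 0" "\<And>x. norm x < d0 \<Longrightarrow> cmod (R x) < 1 / (8 * K)"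
    by (rule hol_small_near_0[OF hR open_ball _ R0]) (rule that)
  \<comment> \<open>Both |w| and |R p| are below 1/(8 K), so |w - R p| \<le> 1/(4 K) and the factor
    K^k from the bounds leaves a geometric series of ratio 1/4.\<close>
  define \<delta> where "\<delta> = Min {\<delta>1, d0, 1 / (8 * K)}"
  have \<delta>: "\<delta> > 0" "\<delta> \<le> \<delta>1" "\<delta> \<le> d0" "\<delta> \<le> 1 / (8 * K)"
    using \<delta>1 d0 K by (auto simp: \<delta>_def)
  have term_bound: "cmod (g k p / fact k * (w - R p) ^ k) \<le> M * (1/4) ^ k"
    if "norm p < \<delta>" "cmod w < \<delta>" for k p w
  proof -
    have "cmod (w - R p) \<le> 1 / (4 * K)"
      using norm_triangle_ineq4[of w "R p"] d0(2)[of p] that \<delta> by simp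
    then have "cmod (w - R p) ^ k \<le> (1 / (4 * K)) ^ k" by (intro power_mono) auto
    moreover have "cmod (g k p) / fact k \<le> M * K ^ k"
      using bd[of p k] that \<delta> by (simp add: divide_simps)
    ultimately have "cmod (g k p) / fact k * cmod (w - R p) ^ k \<le> (M * K ^ k) * (1 / (4 * K)) ^ k"
      using M K by (intro mult_mono) auto
    also have "\<dots> = M * (1/4) ^ k" using K by (simp add: power_divide power_mult_distrib field_simps)
    finally show ?thesis by (simp add: norm_mult norm_divide norm_power)
  qed
  define T where "T k x = g k (fst x, 0) / fact k * (snd x - R (fst x, 0)) ^ k" for k and x :: "'b \<times> complex"
  define F where "F x = (\<Sum>k. T k x)" for x
  have nfst: "norm (fst x, 0::'c) < \<delta>" "cmod (snd x) < \<delta>" if "x \<in> ball 0 \<delta>" for x :: "'b \<times> complex"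
    using that norm_fst_le[of "fst x" "snd x"] norm_snd_le[of "snd x" "fst x"] by (auto simp: norm_Pair)
  have holT: "hol (T k) (ball 0 \<delta>)" for k
  proof -
    have L: "bounded_linear (\<lambda>x::'b \<times> complex. (fst x, 0::'c))"
      by (intro bounded_linear_Pair bounded_linear_fst bounded_linear_zero)
    have in_d: "0 + (fst x, 0) \<in> ball (0::'b \<times> 'c) d" if "x \<in> ball (0::'b \<times> complex) \<delta>" for x
      using nfst[OF that] \<delta> \<delta>1 by simp
    have hfst: "hol (\<lambda>x. h (fst x, 0::'c)) (ball (0::'b \<times> complex) \<delta>)" if "hol h (ball 0 d)" for h
    proof -
      have "hol (\<lambda>x. h (0 + (fst x, 0::'c))) (ball (0::'b \<times> complex) \<delta>)"
        by (rule hol_compose_affine[OF that L _ in_d]) auto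
      then show ?thesis by simp
    qed
    have "hol (\<lambda>x::'b \<times> complex. snd x) (ball 0 \<delta>)"
      by (rule hol_linear[OF bounded_linear_snd]) simp
    then show ?thesis unfolding T_def by (intro hol_intros hfst[OF g(2)] hfst[OF hR]) auto
  qed
  have "uniform_limit (ball 0 \<delta>) (\<lambda>n x. \<Sum>k<n. T k x) F sequentially"
    unfolding F_def
  proof (rule Weierstrass_m_test)
    show "cmod (T k x) \<le> M * (1/4) ^ k" if "x \<in> ball 0 \<delta>" for k x
      unfolding T_def by (rule term_bound[OF nfst[OF that]])
    show "summable (\<lambda>k. M * (1/4) ^ k)" by (intro summable_mult summable_geometric) simp
  qed
  note ul = this
  have holF: "hol F (ball 0 \<delta>)"
  proof (rule hol_uniform_limit[OF open_ball trivial_limit_sequentially])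
    fix p :: "'b \<times> complex" assume "p \<in> ball 0 \<delta>"
    then obtain e where e: "e > 0" "ball p e \<subseteq> ball 0 \<delta>" using open_contains_ball open_ball by blast
    have "hol (\<lambda>x. \<Sum>k<n. T k x) (ball p e)" for n
      by (rule hol_subset[OF _ e(2)]) (intro hol_intros holT)
    then show "\<exists>e>0. (\<forall>\<^sub>F n in sequentially. hol (\<lambda>x. \<Sum>k<n. T k x) (ball p e)) \<and>
        uniform_limit (ball p e) (\<lambda>n x. \<Sum>k<n. T k x) F sequentially"
      using e uniform_limit_on_subset[OF ul e(2)] by (intro exI[of _ e]) auto
  qed
  have agree: "f (z, \<xi>) = F (z, R (z, \<xi>))" if z: "(z, \<xi>) \<in> ball 0 \<delta>" and w: "(z, R (z, \<xi>)) \<in> ball 0 \<delta>" for z \<xi>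
  proof -
    define w where "w = R (z, \<xi>)"
    let ?X = "{t. (z, 0) + t *c (0, \<xi>) \<in> ball 0 \<delta>}"
    let ?p = "\<lambda>t. (z, 0) + t *c (0::'b, \<xi>)"
    \<comment> \<open>Bounds the derivative of R along the segment independently of n.\<close>
    define B where "B = (SUP p\<in>cball 0 \<delta>1. cmod (cderiv (0, \<xi>) R p))"
    have "compact ((\<lambda>p. cmod (cderiv (0, \<xi>) R p)) ` cball 0 \<delta>1)"
      by (intro compact_continuous_image continuous_intros
          continuous_on_subset[OF hol_continuous_on[OF hol_cderiv[OF hR open_ball]]]) (use \<delta>1 in auto)
    then have B: "cmod (cderiv (0, \<xi>) R p) \<le> B" if "norm p \<le> \<delta>1" for p
      unfolding B_def using that
      by (intro cSUP_upper bounded_imp_bdd_above compact_imp_bounded) auto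
    have wn: "cmod w < \<delta>" using nfst(2)[OF w] by (simp add: w_def)
    have X01: "0 \<in> ?X" "1 \<in> ?X"
      using z nfst(1)[OF w] by simp_all
    have in_d: "?p t \<in> ball 0 d" "norm (?p t) < \<delta>" if "t \<in> ?X" for t
      using that \<delta> \<delta>1 by simp_all
    define S where "S n t = (\<Sum>k<Suc n. g k (?p t) / fact k * (w - R (?p t)) ^ k)" for n t
    \<comment> \<open>After telescoping the derivative is a single term. It contains
      \<open>g (Suc n)\<close> but only n!, which produces the extra factor n + 1; the geometric
      factor still wins.\<close>
    have diff: "cmod (S n 1 - S n 0) \<le> (M * K * B) * (real (Suc n) * (1/4) ^ n)" for n
    proof -
      have "cmod (S n 1 - S n 0) \<le> (M * K * B) * (real (Suc n) * (1/4) ^ n) * cmod (1 - 0)"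
      proof (rule field_differentiable_bound[of ?X])
        show "convex ?X" by (rule convex_line) simp
        fix t assume t: "t \<in> ?X"
        let ?D = "g (Suc n) (?p t) * cderiv (0, \<xi>) R (?p t) * (w - R (?p t)) ^ n / fact n"
        have "(S n has_field_derivative ?D) (at t)"
          unfolding S_def
        proof (rule DERIV_taylor_telescope)
          show "((\<lambda>t. g k (?p t)) has_field_derivative g (Suc k) (?p t) * cderiv (0, \<xi>) R (?p t)) (at t)" for k
            using hol_DERIV[OF g(2) open_ball in_d(1)[OF t], of k] unfolding g(3)[OF in_d(1)[OF t]] .
          show "((\<lambda>t. R (?p t)) has_field_derivative cderiv (0, \<xi>) R (?p t)) (at t)"
            by (rule hol_DERIV[OF hR open_ball in_d(1)[OF t]])
        qed
        then show "(S n has_field_derivative ?D) (at t within ?X)" by (rule has_field_derivative_at_within)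
        have pn: "norm (?p t) < \<delta>" by (rule in_d(2)[OF t])
        have "cmod (w - R (?p t)) \<le> 1 / (4 * K)"
          using norm_triangle_ineq4[of w "R (?p t)"] d0(2)[of "?p t"] pn wn \<delta> by simp
        then have a: "cmod (w - R (?p t)) ^ n \<le> (1 / (4 * K)) ^ n" by (intro power_mono) auto
        have b: "cmod (g (Suc n) (?p t)) / fact n \<le> M * K ^ Suc n * real (Suc n)"
          using bd[of "?p t" "Suc n"] pn \<delta> by (simp add: divide_simps mult.assoc mult.left_commute)
        have "cmod ?D = (cmod (g (Suc n) (?p t)) / fact n) * cmod (cderiv (0, \<xi>) R (?p t)) * cmod (w - R (?p t)) ^ n"
          by (simp add: norm_mult norm_divide norm_power)
        also have "\<dots> \<le> (M * K ^ Suc n * real (Suc n)) * B * (1 / (4 * K)) ^ n"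
          by (intro mult_mono a b B mult_nonneg_nonneg) (use pn \<delta> M K B[of 0] \<delta>1 in \<open>auto intro: order_trans[OF norm_ge_zero]\<close>)
        also have "\<dots> = (M * K * B) * (real (Suc n) * (1/4) ^ n)"
          using K by (simp add: power_divide power_mult_distrib field_simps del: of_nat_Suc)
        finally show "cmod ?D \<le> (M * K * B) * (real (Suc n) * (1/4) ^ n)" .
      qed (use X01 in auto)
      then show ?thesis by simp
    qed
    \<comment> \<open>At the end point w - R is 0, and only the term k = 0 survives.\<close>
    have S1: "S n 1 = f (z, \<xi>)" for n
      unfolding S_def lessThan_Suc_atMost by (simp add: w_def g(1) sum.atMost_shift)
    have "(\<lambda>n. \<Sum>k<n. T k (z, w)) \<longlonglongrightarrow> F (z, w)"
      by (rule tendsto_uniform_limitI[OF ul]) (use w in \<open>simp add: w_def\<close>)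
    then have "(\<lambda>n. \<Sum>k<Suc n. T k (z, w)) \<longlonglongrightarrow> F (z, w)" by (rule LIMSEQ_Suc)
    moreover have "(\<Sum>k<Suc n. T k (z, w)) = S n 0" for n by (simp add: S_def T_def)
    ultimately have "(\<lambda>n. S n 1 - S n 0) \<longlonglongrightarrow> f (z, \<xi>) - F (z, w)"
      unfolding S1 by (intro tendsto_diff tendsto_const) simp
    moreover have "(\<lambda>n. S n 1 - S n 0) \<longlonglongrightarrow> 0"
    proof (rule Lim_null_comparison[OF always_eventually[OF allI[OF diff]]])
      have "(\<lambda>n. real (Suc n) * (1/4) ^ n) \<longlonglongrightarrow> 0" by real_asymp
      then show "(\<lambda>n. (M * K * B) * (real (Suc n) * (1/4) ^ n)) \<longlonglongrightarrow> 0" by (rule tendsto_mult_right_zero)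
    qed
    ultimately have "f (z, \<xi>) - F (z, w) = 0" by (rule LIMSEQ_unique)
    then show ?thesis by (simp add: w_def)
  qed
  show ?thesis by (rule that[OF \<delta>(1) holF agree])
qed

section \<open>Uniqueness and complexification\<close>

lemma funpow_cderiv_line:
  assumes H: "hol H S" and S: "open S"
  shows "hol ((cderiv v ^^ n) H) S"
    and "p + t *c v \<in> S \<Longrightarrow> (deriv ^^ n) (\<lambda>t. H (p + t *c v)) t = (cderiv v ^^ n) H (p + t *c v)"
proof -
  show hol: "hol ((cderiv v ^^ n) H) S" for n
    by (induction n) (auto intro: hol_cderiv H S)
  show "p + t *c v \<in> S \<Longrightarrow> (deriv ^^ n) (\<lambda>t. H (p + t *c v)) t = (cderiv v ^^ n) H (p + t *c v)"
  proof (induction n arbitrary: t)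
    case (Suc n)
    have "\<forall>\<^sub>F s in nhds t. s \<in> {s. p + s *c v \<in> S}"
      by (rule eventually_nhds_in_open[OF open_line[OF S]]) (use Suc.prems in simp)
    then have "\<forall>\<^sub>F s in nhds t. (deriv ^^ n) (\<lambda>t. H (p + t *c v)) s = (cderiv v ^^ n) H (p + s *c v)"
      by eventually_elim (use Suc.IH in simp)
    then have "deriv ((deriv ^^ n) (\<lambda>t. H (p + t *c v))) t = deriv (\<lambda>s. (cderiv v ^^ n) H (p + s *c v)) t"
      by (rule deriv_cong_ev) simp
    also have "\<dots> = cderiv v ((cderiv v ^^ n) H) (p + t *c v)"
      by (rule DERIV_imp_deriv[OF hol_DERIV[OF hol S Suc.prems]])
    finally show ?case by simp
  qed simp
qed

lemma graph_map_in_ball: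
  fixes R :: "'b::complex_space \<times> 'c::complex_space \<Rightarrow> complex"
  assumes "hol R (ball 0 d)" "d > 0" "R 0 = 0" "e > 0"
  obtains r where "r > 0" "r \<le> d" "\<And>q. q \<in> ball 0 r \<Longrightarrow> (fst q, R q) \<in> ball 0 e"
proof -
  have "0 \<in> ball (0::'b \<times> 'c) d" "e / 2 > 0" using assms by simp_all
  then obtain d0 where d0: "d0 > 0" "\<And>x. norm x < d0 \<Longrightarrow> cmod (R x) < e / 2"
    by (rule hol_small_near_0[OF assms(1) open_ball _ assms(3)]) (rule that)
  show ?thesis
  proof (rule that[of "Min {d, d0, e / 2}"])
    fix q :: "'b \<times> 'c" assume q: "q \<in> ball 0 (Min {d, d0, e / 2})"
    have "norm (fst q, R q) \<le> norm (fst q) + cmod (R q)" by (rule norm_Pair_le)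
    also have "norm (fst q) < e / 2" using q norm_fst_le[of "fst q" "snd q"] by simp
    also have "cmod (R q) < e / 2" using d0(2)[of q] q by simp
    finally show "(fst q, R q) \<in> ball 0 e" by simp
  qed (use assms d0 in auto)
qed

text \<open>The map (z, \<xi>) to (z, R(z, \<xi>)) is degenerate at 0, so openness of its image
  cannot be used there. Instead, differentiating H(z, R(z, \<xi>)) = 0 in \<xi> and cancelling the
  e1-derivative of R off its zeros shows that the w-derivative of H vanishes on the image as well.
  By induction all w-derivatives vanish at (z, R(z, 0)), and the identity theorem on the convex
  w-slice gives H = 0.\<close>

theorem factorization_unique:
  fixes R :: "'b::complex_space \<times> 'c::complex_space \<Rightarrow> complex"
  assumes R: "hol R (ball 0 D)" and D: "D > 0" and R0: "R 0 = 0"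
    and nondeg: "cderiv u (cderiv (0, e1) R) 0 = 1" "cderiv v (cderiv (0, e1) R) 0 = 0"
      "cderiv u (cderiv (0, e2) R) 0 = 0" "cderiv v (cderiv (0, e2) R) 0 = 1"
    and H: "hol H (ball 0 \<delta>)" and \<delta>: "\<delta> > 0"
    and van: "\<And>z \<xi>. (z, \<xi>) \<in> ball 0 D \<Longrightarrow> (z, R (z, \<xi>)) \<in> ball 0 \<delta> \<Longrightarrow> H (z, R (z, \<xi>)) = 0"
  obtains \<epsilon> where "\<epsilon> > 0" "\<And>x. x \<in> ball 0 \<epsilon> \<Longrightarrow> H x = 0"
proof -
  obtain d where d: "d > 0" "ball (0::'b \<times> 'c) d \<subseteq> ball 0 D"
    and nd: "nondegenerate_pair (ball 0 d) (cderiv (0, e1) R) (cderiv (0, e2) R) u v"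
  proof (rule nondegenerate_near[OF hol_cderiv[OF R open_ball] hol_cderiv[OF R open_ball] open_ball _ nondeg])
    show "0 \<in> ball (0::'b \<times> 'c) D" using D by simp
  qed (rule that)
  have hRd: "hol R (ball 0 d)" by (rule hol_subset[OF R d(2)])
  obtain d1 where d1: "d1 > 0" "d1 \<le> d" and \<Psi>: "\<And>q. q \<in> ball 0 d1 \<Longrightarrow> (fst q, R q) \<in> ball 0 \<delta>"
    by (rule graph_map_in_ball[OF hRd d(1) R0 \<delta>]) (rule that)
  have sub: "ball (0::'b \<times> 'c) d1 \<subseteq> ball 0 d" using d1 by (intro subset_ball)
  have nd1: "nondegenerate_pair (ball 0 d1) (cderiv (0, e1) R) (cderiv (0, e2) R) u v"
    using nd sub hol_subset[of _ "ball 0 d" "ball 0 d1"] unfolding nondegenerate_pair_def by (auto simp del: mem_ball)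
  interpret nondegenerate_pair "ball 0 d1" "cderiv (0, e1) R" "cderiv (0, e2) R" u v by (rule nd1)
  have hR: "hol R (ball 0 d1)" by (rule hol_subset[OF R]) (use sub d in blast)
  have cont\<Psi>: "continuous_on (ball 0 d1) (\<lambda>q. (fst q, R q))"
    by (intro continuous_intros hol_continuous_on[OF hR])
  define Hk where "Hk k = (cderiv (0::'b, 1::complex) ^^ k) H" for k
  have Hk: "hol (Hk k) (ball 0 \<delta>)" for k unfolding Hk_def by (rule funpow_cderiv_line[OF H open_ball])
  have Hk0: "Hk k (fst q, R q) = 0" if "q \<in> ball 0 d1" for k q
    using that
  proof (induction k arbitrary: q)
    case 0
    have "q \<in> ball 0 D" using 0 sub d(2) by (meson subsetD)
    then have "(fst q, snd q) \<in> ball 0 D" by simp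
    then show ?case using van[of "fst q" "snd q"] \<Psi>[OF 0] by (simp add: Hk_def)
  next
    case (Suc k)
    show ?case
    proof (rule eq_0_of_dense[of "ball 0 d1" "\<lambda>q. Hk (Suc k) (fst q, R q)" q u "cderiv (0, e1) R"])
      show "continuous_on (ball 0 d1) (\<lambda>q. Hk (Suc k) (fst q, R q))"
        by (rule continuous_on_compose2[OF hol_continuous_on[OF Hk] cont\<Psi>]) (use \<Psi> in blast)
      fix x assume x: "x \<in> ball 0 d1" and r1: "cderiv (0, e1) R x \<noteq> 0"
      let ?x = "\<lambda>t. x + t *c (0, e1)"
      \<comment> \<open>Writing the w-slice as a complex line with direction (0, 1) turns the
        w-derivative into \<open>cderiv\<close>, so that the chain rule can be applied to w =
        R.\<close>
      have eq: "(fst x, 0) + w *c (0::'b, 1) = (fst x, w)" for w :: complex by simp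
      have a: "((\<lambda>w. Hk k ((fst x, 0) + w *c (0, 1))) has_field_derivative Hk (Suc k) ((fst x, 0) + R (?x 0) *c (0, 1))) (at (R (?x 0)))"
        using hol_DERIV[OF Hk open_ball, of "(fst x, 0)" "R (?x 0)" "(0, 1)" k] \<Psi>[OF x] unfolding eq by (simp add: Hk_def flip: zero_prod_def)
      have b: "((\<lambda>t. R (?x t)) has_field_derivative cderiv (0, e1) R x) (at 0)"
        by (rule hol_DERIV0[OF hR open_ball x])
      have "((\<lambda>t. Hk k ((fst x, 0) + R (?x t) *c (0, 1))) has_field_derivative
          Hk (Suc k) ((fst x, 0) + R (?x 0) *c (0, 1)) * cderiv (0, e1) R x) (at 0)"
        by (rule DERIV_chain2[OF a b])
      then have "((\<lambda>t. Hk k (fst x, R (?x t))) has_field_derivative Hk (Suc k) (fst x, R x) * cderiv (0, e1) R x) (at 0)"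
        unfolding eq by (simp flip: zero_prod_def)
      moreover have "((\<lambda>t. Hk k (fst x, R (?x t))) has_field_derivative 0) (at 0)"
      proof (rule has_field_derivative_transform_within_open[OF DERIV_const])
        show "open {t. ?x t \<in> ball 0 d1}" by (rule open_line) simp
        show "0 \<in> {t. ?x t \<in> ball 0 d1}" using x by (simp flip: zero_prod_def)
        fix t assume "t \<in> {t. ?x t \<in> ball 0 d1}"
        then have "?x t \<in> ball 0 d1" by simp
        from Suc.IH[OF this] show "0 = Hk k (fst x, R (?x t))" by simp
      qed
      ultimately have "Hk (Suc k) (fst x, R x) * cderiv (0, e1) R x = 0" by (rule DERIV_unique)
      then show "Hk (Suc k) (fst x, R x) = 0" using r1 by simp
    qed (use r1_zero_unique Suc.prems in auto)
  qed
  show ?thesis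
  proof (rule that[of "min d1 \<delta>"])
    show "min d1 \<delta> > 0" using d1 \<delta> by simp
    fix x :: "'b \<times> complex" assume x: "x \<in> ball 0 (min d1 \<delta>)"
    obtain z w where zw: "x = (z, w)" by (cases x)
    let ?l = "\<lambda>t. (z, 0) + t *c (0::'b, 1::complex)"
    let ?X = "{t. ?l t \<in> ball 0 \<delta>}"
    have "norm (z, 0::'c) = norm z" by (simp add: norm_Pair)
    then have z: "(z, 0) \<in> ball (0::'b \<times> 'c) d1" using x norm_fst_le[of z w] by (simp add: zw)
    have "(\<lambda>t. H (?l t)) w = 0"
    proof (rule holomorphic_fun_eq_0_on_connected[of "\<lambda>t. H (?l t)" ?X "R (z, 0)" w])
      show "(\<lambda>t. H (?l t)) holomorphic_on ?X" by (rule hol_line[OF H])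
      show "open ?X" by (rule open_line) simp
      show "connected ?X" by (intro convex_connected convex_line) simp
      show RX: "R (z, 0) \<in> ?X" using \<Psi>[OF z] by simp
      show "w \<in> ?X" using x by (simp add: zw)
      show "(deriv ^^ n) (\<lambda>t. H (?l t)) (R (z, 0)) = 0" for n
        using funpow_cderiv_line(2)[OF H open_ball, of "(z, 0)" "R (z, 0)" "(0, 1)" n] RX Hk0[OF z, of n]
        by (simp add: Hk_def)
    qed
    then show "H x = 0" by (simp add: zw)
  qed
qed

section \<open>The totally real subspace \<xi> = cnj z and complexification\<close>

lemma norm_cnj_vec [simp]: "norm (cnj_vec z) = norm z"
  by (simp add: cnj_vec_def norm_vec_def)

lemma cnj_vec_simps [simp]: "cnj_vec z $ i = cnj (z $ i)" "cnj_vec (cnj_vec z) = z" "cnj_vec (x + y) = cnj_vec x + cnj_vec y"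
    "cnj_vec (x - y) = cnj_vec x - cnj_vec y" "cnj_vec (c *c x) = cnj c *c cnj_vec x"
    "cnj_vec (r *\<^sub>R x) = r *\<^sub>R cnj_vec x" "cnj_vec 0 = 0"
  by (simp_all add: cnj_vec_def vec_eq_iff)

lemma bounded_linear_cnj_vec: "bounded_linear cnj_vec"
  by (rule bounded_linear_intro[of _ 1]) simp_all

text \<open>The points (x, cnj x) form a real form of the (z, \<xi>)-space. The first part is the
  mean of p and its reflection (cnj \<xi>, cnj z), which has the same norm; this keeps it in every
  ball about 0 that contains p.\<close>

lemma real_decomposition:
  fixes p :: "(complex^'n) \<times> (complex^'n)"
  obtains x y where "p = (x, cnj_vec x) + \<i> *c (y, cnj_vec y)" "norm (x, cnj_vec x) \<le> norm p"
proof -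
  obtain z \<xi> where p: "p = (z, \<xi>)" by (cases p)
  define x where "x = (1/2) *c (z + cnj_vec \<xi>)"
  define y where "y = (- \<i> / 2) *c (z - cnj_vec \<xi>)"
  show ?thesis
  proof (rule that[of x y])
    show "p = (x, cnj_vec x) + \<i> *c (y, cnj_vec y)"
      by (simp add: p x_def y_def vec_eq_iff algebra_simps)
    have "(x, cnj_vec x) = (1/2) *c (p + (cnj_vec \<xi>, cnj_vec z))"
      by (simp add: p x_def add.commute)
    then have "2 * norm (x, cnj_vec x) = norm (p + (cnj_vec \<xi>, cnj_vec z))"
      by (simp only: norm_scaleC) (simp add: norm_divide)
    also have "\<dots> \<le> norm p + norm (cnj_vec \<xi>, cnj_vec z)" by (rule norm_triangle_ineq)
    also have "norm (cnj_vec \<xi>, cnj_vec z) = norm p" by (simp add: p norm_Pair add.commute)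
    finally show "norm (x, cnj_vec x) \<le> norm p" by simp
  qed
qed

text \<open>Write p = a + \<i> b with a and b in the real form. On the complex line a + t b the real
  parameters give points of the real form, so the restriction of \<Phi> vanishes on a real interval
  about 0 and therefore at t = \<i>. Both 0 and \<i> lie in the convex slice of the ball.\<close>

lemma totally_real_zero:
  fixes \<Phi> :: "(complex^'n) \<times> (complex^'n) \<Rightarrow> complex"
  assumes \<Phi>: "hol \<Phi> (ball 0 d)"
    and real: "\<And>z. (z, cnj_vec z) \<in> ball 0 d \<Longrightarrow> \<Phi> (z, cnj_vec z) = 0"
    and p: "p \<in> ball 0 d"
  shows "\<Phi> p = 0"
proof -
  obtain x y where eq: "(x, cnj_vec x) + \<i> *c (y, cnj_vec y) = p" and le: "norm (x, cnj_vec x) \<le> norm p"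
    using real_decomposition[of p] by metis
  let ?a = "(x, cnj_vec x)" and ?b = "(y, cnj_vec y)"
  let ?X = "{t. ?a + t *c ?b \<in> ball 0 d}"
  have real_line: "?a + of_real t *c ?b = (x + t *\<^sub>R y, cnj_vec (x + t *\<^sub>R y))" for t
    by (simp add: scaleC_of_real)
  have X0: "0 \<in> ?X" using p le by simp
  have "(\<lambda>t. \<Phi> (?a + t *c ?b)) \<i> = 0"
  proof (rule analytic_continuation[of "\<lambda>t. \<Phi> (?a + t *c ?b)" ?X "complex_of_real ` {t. complex_of_real t \<in> ?X}" 0])
    show "(\<lambda>t. \<Phi> (?a + t *c ?b)) holomorphic_on ?X" by (rule hol_line[OF \<Phi>])
    show oX: "open ?X" by (rule open_line) simp
    show "connected ?X" by (intro convex_connected convex_line) simp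
    show "0 \<in> ?X" by (rule X0)
    show "\<i> \<in> ?X" unfolding mem_Collect_eq eq by (rule p)
    show "0 islimpt complex_of_real ` {t. complex_of_real t \<in> ?X}"
      unfolding islimpt_approachable
    proof (intro allI impI)
      fix e :: real assume "e > 0"
      obtain r where r: "r > 0" "ball 0 r \<subseteq> ?X" using oX X0 open_contains_ball by blast
      define t where "t = min e r / 2"
      have t: "0 < t" "t < e" "t < r" using \<open>e > 0\<close> r(1) by (auto simp: t_def)
      then have "of_real t \<in> ?X" using r(2) by (intro subsetD[OF r(2)]) simp
      then show "\<exists>x'\<in>complex_of_real ` {t. complex_of_real t \<in> ?X}. x' \<noteq> 0 \<and> dist x' 0 < e"
        using t by (intro bexI[of _ "of_real t"]) auto
    qed
    fix t :: complex assume "t \<in> complex_of_real ` {t. complex_of_real t \<in> ?X}"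
    then obtain s :: real where s: "t = of_real s" "?a + of_real s *c ?b \<in> ball 0 d" by auto
    then show "\<Phi> (?a + t *c ?b) = 0" using real[of "x + s *\<^sub>R y"] unfolding s(1) real_line by blast
  qed auto
  then show ?thesis unfolding eq .
qed

text \<open>The complex-linear function of (z, \<xi>) that restricts to the real coordinate x
  \<bullet> b on \<xi> = cnj x.\<close>

definition complexified_coordinate :: "complex^'n \<Rightarrow> (complex^'n) \<times> (complex^'n) \<Rightarrow> complex" where
  "complexified_coordinate b q = (\<Sum>i\<in>UNIV. fst q $ i * cnj (b $ i) + snd q $ i * b $ i) / 2"

lemma bounded_linear_nth_fst: "bounded_linear (\<lambda>q::(complex^'n) \<times> 'b::real_normed_vector. fst q $ i)"
  and bounded_linear_nth_snd: "bounded_linear (\<lambda>q::'b::real_normed_vector \<times> (complex^'n). snd q $ i)"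
  by (rule bounded_linear_compose[OF bounded_linear_vec_nth bounded_linear_fst]
      bounded_linear_compose[OF bounded_linear_vec_nth bounded_linear_snd])+

lemma hol_nth_fst [hol_intros]: "hol (\<lambda>q::(complex^'n) \<times> 'b::complex_space. fst q $ i) S"
  by (rule hol_linear[OF bounded_linear_nth_fst]) simp

lemma hol_nth_snd [hol_intros]: "hol (\<lambda>q::'b::complex_space \<times> (complex^'n). snd q $ i) S"
  by (rule hol_linear[OF bounded_linear_nth_snd]) simp

lemma hol_complexified_coordinate [hol_intros]: "hol (complexified_coordinate b) S"
  unfolding complexified_coordinate_def by (intro hol_intros) simp

lemma complexified_coordinate_real: "complexified_coordinate b (x, cnj_vec x) = of_real (x \<bullet> b)"
proof -
  have "fst (x, cnj_vec x) $ i * cnj (b $ i) + snd (x, cnj_vec x) $ i * b $ i = of_real (2 * (x $ i \<bullet> b $ i))" for i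
    by (simp add: complex_eq_iff inner_complex_def)
  then show ?thesis
    by (simp add: complexified_coordinate_def inner_vec_def sum_distrib_left[symmetric] flip: of_real_sum)
qed

lemma norm_complexified_coordinate:
  fixes q :: "(complex^'n) \<times> (complex^'n)"
  assumes "b \<in> Basis"
  shows "cmod (complexified_coordinate b q) \<le> real CARD('n) * norm q"
proof -
  have "cmod (fst q $ i * cnj (b $ i) + snd q $ i * b $ i) \<le> 2 * norm q" for i
  proof -
    have b: "cmod (b $ i) \<le> 1" using Finite_Cartesian_Product.norm_nth_le[of b i] norm_Basis[OF assms] by simp
    have "cmod (fst q $ i) \<le> norm q" "cmod (snd q $ i) \<le> norm q"
      using Finite_Cartesian_Product.norm_nth_le[of "fst q" i] Finite_Cartesian_Product.norm_nth_le[of "snd q" i]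
        norm_fst_le[of "fst q" "snd q"] norm_snd_le[of "snd q" "fst q"] by auto
    then have "cmod (fst q $ i) * cmod (b $ i) \<le> norm q * 1" "cmod (snd q $ i) * cmod (b $ i) \<le> norm q * 1"
      using b by (intro mult_mono; simp)+
    moreover have "cmod (fst q $ i * cnj (b $ i) + snd q $ i * b $ i) \<le> cmod (fst q $ i) * cmod (b $ i) + cmod (snd q $ i) * cmod (b $ i)"
      by (rule order_trans[OF norm_triangle_ineq]) (simp add: norm_mult)
    ultimately show ?thesis by simp
  qed
  then have "cmod (\<Sum>i\<in>UNIV. fst q $ i * cnj (b $ i) + snd q $ i * b $ i) \<le> (\<Sum>i\<in>(UNIV::'n set). 2 * norm q)"
    by (intro order_trans[OF norm_sum] sum_mono)
  then show ?thesis by (simp add: complexified_coordinate_def norm_divide)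
qed

text \<open>The complexified coordinates are substituted into the real power series. Unconditional
  convergence in the complex numbers is absolute, so convergence at one real point with all
  coordinates equal to s > 0 majorises the series wherever the complexified coordinates have modulus
  at most s.\<close>

lemma complexification:
  fixes g :: "complex^'n \<Rightarrow> complex"
  assumes "g real_analytic_on S" "p \<in> S"
  obtains d G where "d > 0" "hol G (ball 0 d)" "\<And>x. (x, cnj_vec x) \<in> ball 0 d \<Longrightarrow> g (p + x) = G (x, cnj_vec x)"
proof -
  obtain r c where r: "r > 0" and sum: "\<And>x. x \<in> ball p r \<Longrightarrow>
      ((\<lambda>\<alpha>. (\<Prod>b\<in>Basis. ((x - p) \<bullet> b) ^ \<alpha> b) *\<^sub>R c \<alpha>) has_sum g x) multi_indices"
    using assms unfolding real_analytic_on_def by blast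
  \<comment> \<open>The point x0 with all real coordinates equal to s then has norm at most r/2,
    inside the region of convergence.\<close>
  define s where "s = r / (2 * real DIM(complex^'n))"
  have D: "real DIM(complex^'n) \<ge> 1" using DIM_positive[where 'a="complex^'n"] by linarith
  have s: "s > 0" using r D by (simp add: s_def)
  define x0 :: "complex^'n" where "x0 = (\<Sum>b\<in>Basis. s *\<^sub>R b)"
  have "norm x0 \<le> (\<Sum>b\<in>(Basis::(complex^'n) set). s)"
    unfolding x0_def using s by (intro order_trans[OF norm_sum] sum_mono) simp
  also have "\<dots> = r / 2" using D by (simp add: s_def)
  finally have x0r: "p + x0 \<in> ball p r" using r by (simp add: dist_norm)
  have x0b: "(p + x0 - p) \<bullet> b = s" if "b \<in> Basis" for b
    using that by (simp add: x0_def inner_sum_left inner_Basis if_distrib cong: if_cong)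
  define T where "T \<alpha> q = (\<Prod>b\<in>Basis. complexified_coordinate b q ^ \<alpha> b) * c \<alpha>" for \<alpha> :: "complex^'n \<Rightarrow> nat" and q
  define M where "M \<alpha> = (\<Prod>b\<in>Basis. s ^ \<alpha> b) * cmod (c \<alpha>)" for \<alpha> :: "complex^'n \<Rightarrow> nat"
  have "(\<lambda>\<alpha>. (\<Prod>b\<in>Basis. s ^ \<alpha> b) *\<^sub>R c \<alpha>) summable_on multi_indices"
    using sum[OF x0r] x0b by (auto simp: summable_on_def cong: prod.cong)
  then have "(\<lambda>\<alpha>. norm ((\<Prod>b\<in>Basis. s ^ \<alpha> b) *\<^sub>R c \<alpha>)) summable_on multi_indices"
    by (simp only: summable_on_iff_abs_summable_on_complex)
  then have M: "M summable_on multi_indices"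
    using s by (simp add: M_def[abs_def] prod_nonneg abs_of_nonneg)
  define d where "d = s / real CARD('n)"
  have d: "d > 0" using s by (simp add: d_def)
  have bound: "cmod (T \<alpha> q) \<le> M \<alpha>" if "q \<in> ball 0 d" for \<alpha> q
  proof -
    have "cmod (complexified_coordinate b q) \<le> s" if "b \<in> Basis" for b
      using norm_complexified_coordinate[OF that, of q] \<open>q \<in> ball 0 d\<close> by (simp add: d_def field_simps)
    then have "(\<Prod>b\<in>Basis. cmod (complexified_coordinate b q) ^ \<alpha> b) \<le> (\<Prod>b\<in>Basis. s ^ \<alpha> b)"
      by (intro prod_mono conjI power_mono) auto
    then show ?thesis
      unfolding T_def M_def norm_mult prod_norm[symmetric] norm_power by (intro mult_right_mono) auto
  qed
  define G where "G q = infsum (\<lambda>\<alpha>. T \<alpha> q) multi_indices" for q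
  have ul: "uniform_limit (ball 0 d) (\<lambda>X q. \<Sum>\<alpha>\<in>X. T \<alpha> q) G (finite_subsets_at_top multi_indices)"
    unfolding G_def by (rule Weierstrass_m_test_general[OF bound M])
  show ?thesis
  proof (rule that[OF d])
    show "hol G (ball 0 d)"
    proof (rule hol_uniform_limit[OF open_ball finite_subsets_at_top_neq_bot])
      fix q :: "(complex^'n) \<times> (complex^'n)" assume "q \<in> ball 0 d"
      then obtain e where e: "e > 0" "ball q e \<subseteq> ball 0 d" using open_contains_ball open_ball by blast
      have "hol (\<lambda>q. \<Sum>\<alpha>\<in>X. T \<alpha> q) (ball q e)" for X
        unfolding T_def by (intro hol_intros)
      then show "\<exists>e>0. (\<forall>\<^sub>F X in finite_subsets_at_top multi_indices. hol (\<lambda>q. \<Sum>\<alpha>\<in>X. T \<alpha> q) (ball q e)) \<and>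
          uniform_limit (ball q e) (\<lambda>X q. \<Sum>\<alpha>\<in>X. T \<alpha> q) G (finite_subsets_at_top multi_indices)"
        using e uniform_limit_on_subset[OF ul e(2)] by (intro exI[of _ e]) auto
    qed
    fix x :: "complex^'n" assume x: "(x, cnj_vec x) \<in> ball 0 d"
    have "norm x < d" using x norm_fst_le[of x "cnj_vec x"] by simp
    also have "d \<le> s" using s by (simp add: d_def divide_le_eq Suc_leI)
    also have "s < r" using r D by (simp add: s_def divide_less_eq)
    finally have "p + x \<in> ball p r" by (simp add: dist_norm)
    from sum[OF this] have "((\<lambda>\<alpha>. T \<alpha> (x, cnj_vec x)) has_sum g (p + x)) multi_indices"
      by (simp add: T_def complexified_coordinate_real scaleR_conv_of_real)
    then show "g (p + x) = G (x, cnj_vec x)" unfolding G_def by (simp add: infsumI)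
  qed
qed

section \<open>CR functions on a graph\<close>

lemma Ck_on_Suc_imp: "Ck_on (Suc k) S f \<Longrightarrow> Ck_on k S f"
proof (induction k arbitrary: f)
  case 0
  then obtain f' where "\<And>x. x \<in> S \<Longrightarrow> (f has_derivative f' x) (at x)" by auto
  then show ?case
    by (auto intro!: continuous_at_imp_continuous_on has_derivative_continuous)
next
  case (Suc k)
  from Suc.prems obtain f' where f': "\<forall>x\<in>S. (f has_derivative f' x) (at x)" "\<forall>v. Ck_on (Suc k) S (\<lambda>x. f' x v)"
    unfolding Ck_on.simps(2)[of "Suc k"] by blast
  then have "\<forall>v. Ck_on k S (\<lambda>x. f' x v)" using Suc.IH by blast
  then show ?case using f'(1) unfolding Ck_on.simps(2) by blast
qed

lemma Ck_on_SucI: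
  assumes "\<And>x. x \<in> S \<Longrightarrow> (f has_derivative f' x) (at x)" "\<And>v. Ck_on k S (\<lambda>x. f' x v)"
  shows "Ck_on (Suc k) S f"
  using assms unfolding Ck_on.simps(2) by blast

lemma Ck_on_SucE:
  assumes "Ck_on (Suc k) S f"
  obtains f' where "\<And>x. x \<in> S \<Longrightarrow> (f has_derivative f' x) (at x)" "\<And>v. Ck_on k S (\<lambda>x. f' x v)"
  using assms unfolding Ck_on.simps(2) by blast

lemma Ck_on_cong:
  assumes "open S" "\<And>x. x \<in> S \<Longrightarrow> f x = g x" "Ck_on k S f"
  shows "Ck_on k S g"
proof (cases k)
  case 0
  then show ?thesis using assms by (simp cong: continuous_on_cong)
next
  case (Suc j)
  from assms(3)[unfolded Suc] obtain f' where f': "\<And>x. x \<in> S \<Longrightarrow> (f has_derivative f' x) (at x)" "\<And>v. Ck_on j S (\<lambda>x. f' x v)"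
    by (rule Ck_on_SucE) (rule that)
  show ?thesis unfolding Suc
    by (rule Ck_on_SucI[OF has_derivative_transform_within_open[OF f'(1) assms(1)] f'(2)]) (use assms(2) in auto)
qed

lemma Ck_on_bounded_linear:
  assumes "bounded_linear T"
  shows "Ck_on k S f \<Longrightarrow> Ck_on k S (\<lambda>x. T (f x))"
proof (induction k arbitrary: f)
  case 0
  then show ?case using bounded_linear.continuous_on[OF assms] by simp
next
  case (Suc k)
  obtain f' where f': "\<And>x. x \<in> S \<Longrightarrow> (f has_derivative f' x) (at x)" "\<And>v. Ck_on k S (\<lambda>x. f' x v)"
    using Suc.prems by (rule Ck_on_SucE) (rule that)
  show ?case
    by (rule Ck_on_SucI[OF bounded_linear.has_derivative[OF assms f'(1)] Suc.IH[OF f'(2)]])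
qed

lemma Ck_on_add: "Ck_on k S f \<Longrightarrow> Ck_on k S g \<Longrightarrow> Ck_on k S (\<lambda>x. f x + g x)"
proof (induction k arbitrary: f g)
  case 0
  then show ?case by (simp add: continuous_on_add)
next
  case (Suc k)
  obtain f' where f': "\<And>x. x \<in> S \<Longrightarrow> (f has_derivative f' x) (at x)" "\<And>v. Ck_on k S (\<lambda>x. f' x v)"
    using Suc.prems(1) by (rule Ck_on_SucE) (rule that)
  obtain g' where g': "\<And>x. x \<in> S \<Longrightarrow> (g has_derivative g' x) (at x)" "\<And>v. Ck_on k S (\<lambda>x. g' x v)"
    using Suc.prems(2) by (rule Ck_on_SucE) (rule that)
  show ?case
    by (rule Ck_on_SucI[OF has_derivative_add[OF f'(1) g'(1)] Suc.IH[OF f'(2) g'(2)]])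
qed

lemma Ck_on_bilinear:
  assumes "bounded_bilinear B"
  shows "Ck_on k S f \<Longrightarrow> Ck_on k S g \<Longrightarrow> Ck_on k S (\<lambda>x. B (f x) (g x))"
proof (induction k arbitrary: f g)
  case 0
  then show ?case using bounded_bilinear.continuous_on[OF assms] by simp
next
  case (Suc k)
  obtain f' where f': "\<And>x. x \<in> S \<Longrightarrow> (f has_derivative f' x) (at x)" "\<And>v. Ck_on k S (\<lambda>x. f' x v)"
    using Suc.prems(1) by (rule Ck_on_SucE) (rule that)
  obtain g' where g': "\<And>x. x \<in> S \<Longrightarrow> (g has_derivative g' x) (at x)" "\<And>v. Ck_on k S (\<lambda>x. g' x v)"
    using Suc.prems(2) by (rule Ck_on_SucE) (rule that)
  note fg = Ck_on_Suc_imp[OF Suc.prems(1)] Ck_on_Suc_imp[OF Suc.prems(2)]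
  show ?case
    by (rule Ck_on_SucI[OF bounded_bilinear.FDERIV[OF assms f'(1) g'(1)]
        Ck_on_add[OF Suc.IH[OF fg(1) g'(2)] Suc.IH[OF f'(2) fg(2)]]])
qed

lemma Ck_on_Pair: "Ck_on k S f \<Longrightarrow> Ck_on k S g \<Longrightarrow> Ck_on k S (\<lambda>x. (f x, g x))"
proof (induction k arbitrary: f g)
  case 0
  then show ?case by (simp add: continuous_on_Pair)
next
  case (Suc k)
  obtain f' where f': "\<And>x. x \<in> S \<Longrightarrow> (f has_derivative f' x) (at x)" "\<And>v. Ck_on k S (\<lambda>x. f' x v)"
    using Suc.prems(1) by (rule Ck_on_SucE) (rule that)
  obtain g' where g': "\<And>x. x \<in> S \<Longrightarrow> (g has_derivative g' x) (at x)" "\<And>v. Ck_on k S (\<lambda>x. g' x v)"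
    using Suc.prems(2) by (rule Ck_on_SucE) (rule that)
  show ?case
    by (rule Ck_on_SucI[OF has_derivative_Pair[OF f'(1) g'(1)] Suc.IH[OF f'(2) g'(2)]])
qed

lemma Ck_on_fst: "Ck_on k N f \<Longrightarrow> Ck_on k (N \<times> UNIV) (\<lambda>p. f (fst p))"
proof (induction k arbitrary: f)
  case 0
  then have "continuous_on N f" by simp
  then have "continuous_on (N \<times> UNIV) (\<lambda>p. f (fst p))"
    by (rule continuous_on_compose2) (auto intro!: continuous_intros)
  then show ?case by simp
next
  case (Suc k)
  obtain f' where f': "\<And>x. x \<in> N \<Longrightarrow> (f has_derivative f' x) (at x)" "\<And>v. Ck_on k N (\<lambda>x. f' x v)"
    using Suc.prems by (rule Ck_on_SucE) (rule that)
  have der: "((\<lambda>p. f (fst p)) has_derivative (\<lambda>v. f' (fst p) (fst v))) (at p)" if "p \<in> N \<times> UNIV" for p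
    by (rule has_derivative_compose[OF has_derivative_fst[OF has_derivative_ident] f'(1)]) (use that in auto)
  show ?case by (rule Ck_on_SucI[OF der Suc.IH[OF f'(2)]])
qed

text \<open>The derivative in direction v is again a holomorphic function composed with the same
  affine map, namely \<open>cderiv (L v) G\<close>, so the induction closes on itself. L need only
  be real-linear; it will be x to (x, cnj x).\<close>

lemma Ck_on_hol_compose:
  assumes "open \<Omega>" "bounded_linear L"
  shows "hol G \<Omega> \<Longrightarrow> Ck_on k {x. L (x - p) \<in> \<Omega>} (\<lambda>x. G (L (x - p)))"
proof (induction k arbitrary: G)
  case 0
  have "continuous_on {x. L (x - p) \<in> \<Omega>} (\<lambda>x. G (L (x - p)))"
    by (rule continuous_on_compose2[OF hol_continuous_on[OF 0]])
       (auto intro!: continuous_intros bounded_linear.continuous_on[OF assms(2)])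
  then show ?case by simp
next
  case (Suc k)
  have der: "((\<lambda>x. G (L (x - p))) has_derivative (\<lambda>v. cderiv (L v) G (L (x - p)))) (at x)" if "x \<in> {x. L (x - p) \<in> \<Omega>}" for x
  proof (rule has_derivative_compose[of "\<lambda>x. L (x - p)" L x UNIV G "\<lambda>v. cderiv v G (L (x - p))"])
    show "((\<lambda>x. L (x - p)) has_derivative L) (at x)"
      using bounded_linear.has_derivative[OF assms(2) has_derivative_diff[OF has_derivative_ident has_derivative_const[of p]]]
      by simp
    show "(G has_derivative (\<lambda>v. cderiv v G (L (x - p)))) (at (L (x - p)))"
      by (rule hol_has_derivative[OF Suc.prems assms(1)]) (use that in simp)
  qed
  show ?case by (rule Ck_on_SucI[OF der Suc.IH[OF hol_cderiv[OF Suc.prems assms(1)]]])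
qed

lemma bounded_linear_with_cnj: "bounded_linear (\<lambda>x::complex^'n. (x, cnj_vec x))"
  by (intro bounded_linear_Pair bounded_linear_ident bounded_linear_cnj_vec)

text \<open>Smoothness is read off from the complexification, which avoids termwise differentiation
  of the real power series.\<close>

lemma real_analytic_Ck:
  fixes g :: "complex^'n \<Rightarrow> complex"
  assumes "g real_analytic_on U" "p \<in> U"
  obtains N where "open N" "p \<in> N" "\<And>k. Ck_on k N g"
proof -
  obtain d G where d: "d > 0" "hol G (ball 0 d)" "\<And>x. (x, cnj_vec x) \<in> ball 0 d \<Longrightarrow> g (p + x) = G (x, cnj_vec x)"
    by (rule complexification[OF assms], rule that)
  define N where "N = {x. (x - p, cnj_vec (x - p)) \<in> ball 0 d}"
  have N: "open N"
  proof -
    have "continuous_on UNIV (\<lambda>x. (x - p, cnj_vec (x - p)))"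
      by (intro continuous_intros bounded_linear.continuous_on[OF bounded_linear_cnj_vec])
    from open_vimage[OF open_ball this] show ?thesis by (simp only: N_def vimage_def)
  qed
  show ?thesis
  proof (rule that[OF N])
    show "p \<in> N" using d(1) by (simp add: N_def flip: zero_prod_def)
    fix k
    have ck: "Ck_on k N (\<lambda>x. G (x - p, cnj_vec (x - p)))"
      unfolding N_def by (rule Ck_on_hol_compose[OF open_ball bounded_linear_with_cnj d(2)])
    have eq: "G (x - p, cnj_vec (x - p)) = g x" if "x \<in> N" for x
      using d(3)[of "x - p"] that by (simp add: N_def)
    show "Ck_on k N g" by (rule Ck_on_cong[OF N eq ck])
  qed
qed

section \<open>Antiholomorphic derivatives of real-analytic functions\<close>

definition fderiv :: "('a::euclidean_space \<Rightarrow> complex) \<Rightarrow> 'a \<Rightarrow> 'a \<Rightarrow> complex" where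
  "fderiv g x = frechet_derivative g (at x)"

text \<open>The conjugate-linear part of the real differential. For v = \<open>axis j 1\<close> it
  is the derivative of g with respect to the conjugate of the j-th variable.\<close>

definition dbar :: "('a::complex_space \<Rightarrow> complex) \<Rightarrow> 'a \<Rightarrow> 'a \<Rightarrow> complex" where
  "dbar g x v = (fderiv g x v + \<i> * fderiv g x (\<i> *c v)) / 2"

lemma fderiv_eq: "(g has_derivative D) (at x) \<Longrightarrow> fderiv g x = D"
  unfolding fderiv_def by (rule frechet_derivative_at[symmetric])

lemma real_analytic_fderiv:
  fixes g :: "complex^'n \<Rightarrow> complex"
  assumes "g real_analytic_on U" "p \<in> U"
  obtains N where "open N" "p \<in> N" "\<And>x. x \<in> N \<Longrightarrow> (g has_derivative fderiv g x) (at x)"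
    "\<And>k v. Ck_on k N (\<lambda>x. fderiv g x v)"
proof -
  obtain N where N: "open N" "p \<in> N" "\<And>k. Ck_on k N g" by (rule real_analytic_Ck[OF assms], rule that)
  have der: "(g has_derivative fderiv g x) (at x)" if "x \<in> N" for x
  proof -
    obtain g' where g': "\<And>x. x \<in> N \<Longrightarrow> (g has_derivative g' x) (at x)" using N(3)[of "Suc 0"] by (rule Ck_on_SucE) (rule that)
    from g'[OF that] fderiv_eq[OF g'[OF that]] show ?thesis by simp
  qed
  show ?thesis
  proof (rule that[OF N(1,2) der])
    fix k v
    obtain g' where g': "\<And>x. x \<in> N \<Longrightarrow> (g has_derivative g' x) (at x)" "\<And>v. Ck_on k N (\<lambda>x. g' x v)"
      using N(3)[of "Suc k"] by (rule Ck_on_SucE) (rule that)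
    show "Ck_on k N (\<lambda>x. fderiv g x v)"
      by (rule Ck_on_cong[OF N(1) _ g'(2)]) (use fderiv_eq[OF g'(1)] in simp)
  qed
qed

lemma real_analytic_has_derivative:
  fixes g :: "complex^'n \<Rightarrow> complex"
  assumes "g real_analytic_on U" "p \<in> U"
  shows "(g has_derivative fderiv g p) (at p)"
  using real_analytic_fderiv[OF assms] by metis

lemma scaleC_Re_Im: "c *c (v::'a::complex_space) = Re c *\<^sub>R v + Im c *\<^sub>R \<i> *c v"
proof -
  have "c = of_real (Re c) + of_real (Im c) * \<i>" by (simp add: complex_eq_iff)
  then have "c *c v = of_real (Re c) *c v + of_real (Im c) *c \<i> *c v"
    by (metis scaleC_add_left scaleC_scaleC)
  then show ?thesis by (simp only: scaleC_of_real)
qed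

lemma dbar_conj_linear:
  assumes "(g has_derivative fderiv g x) (at x)"
  shows "dbar g x (u + v) = dbar g x u + dbar g x v" and "dbar g x (c *c v) = cnj c * dbar g x v"
proof -
  interpret bounded_linear "fderiv g x" by (rule has_derivative_bounded_linear[OF assms])
  show "dbar g x (u + v) = dbar g x u + dbar g x v"
    by (simp add: dbar_def scaleC_add_right add algebra_simps add_divide_distrib)
  have sc: "fderiv g x (c *c v) = of_real (Re c) * fderiv g x v + of_real (Im c) * fderiv g x (\<i> *c v)" for c v
  proof -
    show ?thesis by (subst scaleC_Re_Im) (simp only: add scaleR scaleR_conv_of_real)
  qed
  have "c = of_real (Re c) + \<i> * of_real (Im c)" by (simp add: complex_eq_iff)
  then show "dbar g x (c *c v) = cnj c * dbar g x v"
    unfolding dbar_def sc[of c v] scaleC_scaleC sc[of "\<i> * c" v] by (simp add: algebra_simps complex_eq_iff)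
qed

section \<open>Tangent vectors of type (0,1) to a graph\<close>

lemma cmult_eq_scaleC [simp]: "cmult c v = c *c v"
  by (simp add: cmult_def prod_eq_iff vec_eq_iff)

lemma sum_axis: "(\<Sum>j\<in>UNIV. z $ j *c axis j 1) = (z :: complex^'n)"
  by (simp add: vec_eq_iff axis_def if_distrib cong: if_cong)

text \<open>A vector X + \<i> Y of type (0,1) is determined by X, since Y is X multiplied by \<i> in
  the ambient space. The formal scalar c of \<open>cscale\<close> acts on X as multiplication by cnj
  c.\<close>

lemma antiholomorphic_vectors_eq: "antiholomorphic_vectors = range (\<lambda>v. (v, \<i> *c (v::(complex^'n) \<times> complex)))"
proof
  let ?A = "range (\<lambda>v. (v, \<i> *c (v::(complex^'n) \<times> complex)))"
  have scale: "cscale c (v, \<i> *c v) = (cnj c *c v, \<i> *c cnj c *c v)" for c and v :: "(complex^'n) \<times> complex"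
  proof -
    have "cnj c *c v = Re c *\<^sub>R v - Im c *\<^sub>R \<i> *c v" using scaleC_Re_Im[of "cnj c" v] by simp
    moreover have "\<i> *c cnj c *c v = Re c *\<^sub>R \<i> *c v + Im c *\<^sub>R v"
      using scaleC_Re_Im[of "\<i> * cnj c" v] by simp
    ultimately show ?thesis by (simp add: cscale_def)
  qed
  have dv: "dbar_vector e = ((1/2) *c e, \<i> *c (1/2) *c e)" for e :: "(complex^'n) \<times> complex"
    unfolding dbar_vector_def cmult_eq_scaleC using scale[of "1/2" e] by simp
  show "antiholomorphic_vectors \<subseteq> ?A"
    unfolding antiholomorphic_vectors_def
  proof (rule ctensor.span_minimal)
    show "insert (dbar_vector (0, 1)) (range (\<lambda>j. dbar_vector (axis j 1, 0))) \<subseteq> ?A"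
      unfolding dv by blast
    show "ctensor.subspace ?A"
    proof (rule ctensor.subspaceI)
      show "0 \<in> ?A"
        by (rule image_eqI[of _ _ 0]) (simp_all add: zero_prod_def)
      fix x y assume "x \<in> ?A" "y \<in> ?A"
      then obtain v w where vw: "x = (v, \<i> *c v)" "y = (w, \<i> *c w)" by blast
      have "x + y = (v + w, \<i> *c (v + w))" unfolding vw by (simp only: add_Pair scaleC_add_right)
      then show "x + y \<in> ?A" by blast
    next
      fix c x assume "x \<in> ?A"
      then show "cscale c x \<in> ?A" using scale by blast
    qed
  qed
  show "?A \<subseteq> antiholomorphic_vectors"
  proof
    fix x assume "x \<in> ?A"
    then obtain z w where x: "x = ((z, w), \<i> *c (z, w))" by auto
    have half: "cscale c (dbar_vector e) = (cnj c *c (1/2) *c e, \<i> *c cnj c *c (1/2) *c e)" for c and e :: "(complex^'n) \<times> complex"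
      unfolding dv by (rule scale)
    \<comment> \<open>The 2 undoes the 1/2 in \<open>dbar_vector\<close>, and the coefficients are
      conjugated because \<open>cscale\<close> acts conjugately on real parts.\<close>
    have "x = (\<Sum>j\<in>UNIV. cscale (2 * cnj (z $ j)) (dbar_vector (axis j 1, 0))) + cscale (2 * cnj w) (dbar_vector (0, 1))"
      unfolding half x
      by (simp add: prod_eq_iff fst_sum snd_sum sum_axis) (simp add: vec_eq_iff axis_def if_distrib cong: if_cong)
    also have "\<dots> \<in> antiholomorphic_vectors"
      unfolding antiholomorphic_vectors_def
      by (intro ctensor.span_add ctensor.span_sum ctensor.span_scale ctensor.span_base) auto
    finally show "x \<in> antiholomorphic_vectors" .
  qed
qed

lemma has_vector_derivative_line:
  assumes "(g has_derivative fderiv g z) (at z)"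
  shows "((\<lambda>t. g (z + t *\<^sub>R h)) has_vector_derivative fderiv g z h) (at 0)"
proof -
  have "((\<lambda>t. z + t *\<^sub>R h) has_derivative (\<lambda>t. t *\<^sub>R h)) (at 0)"
    by (auto intro!: derivative_eq_intros)
  then have "((\<lambda>t. g (z + t *\<^sub>R h)) has_derivative (\<lambda>t. fderiv g z (t *\<^sub>R h))) (at 0)"
    by (rule has_derivative_compose) (use assms in simp)
  then show ?thesis
    unfolding has_vector_derivative_def using linear_scale[OF has_derivative_linear[OF assms]] by simp
qed

lemma curve_in_graph:
  assumes U: "open U" "z \<in> U" and \<rho>: "(\<rho> has_derivative fderiv \<rho> z) (at z)"
  shows "curve_in (graph_over U \<rho>) (z, \<rho> z) (h, fderiv \<rho> z h) (\<lambda>t. (z + t *\<^sub>R h, \<rho> (z + t *\<^sub>R h)))"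
proof -
  have "((\<lambda>t::real. z + t *\<^sub>R h) \<longlongrightarrow> z + 0 *\<^sub>R h) (nhds 0)"
    by (intro tendsto_intros) (simp add: filterlim_ident)
  then have "\<forall>\<^sub>F t in nhds (0::real). z + t *\<^sub>R h \<in> U"
    using U by (intro topological_tendstoD) auto
  then have "\<forall>\<^sub>F t in nhds 0. (z + t *\<^sub>R h, \<rho> (z + t *\<^sub>R h)) \<in> graph_over U \<rho>"
    by eventually_elim (auto simp: graph_over_def)
  moreover have "((\<lambda>t. z + t *\<^sub>R h) has_vector_derivative h) (at 0)"
    by (auto intro!: derivative_eq_intros)
  ultimately show ?thesis
    unfolding curve_in_def using has_vector_derivative_line[OF \<rho>, of h]
    by (auto intro: has_vector_derivative_Pair)
qed

lemma tangent_space_graph: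
  assumes U: "open U" "z \<in> U" and \<rho>: "(\<rho> has_derivative fderiv \<rho> z) (at z)"
  shows "tangent_space (graph_over U \<rho>) (z, \<rho> z) = {(h, fderiv \<rho> z h) | h. True}"
proof -
  have "b = fderiv \<rho> z a" if \<gamma>: "curve_in (graph_over U \<rho>) (z, \<rho> z) (a, b) \<gamma>" for a b \<gamma>
  proof -
    have d: "(\<gamma> has_vector_derivative (a, b)) (at 0)" and g0: "\<gamma> 0 = (z, \<rho> z)"
      and ev: "\<forall>\<^sub>F t in nhds 0. \<gamma> t \<in> graph_over U \<rho>"
      using \<gamma> by (auto simp: curve_in_def)
    have df: "((\<lambda>t. fst (\<gamma> t)) has_derivative (\<lambda>t. t *\<^sub>R a)) (at 0)"
      using has_derivative_fst[OF d[unfolded has_vector_derivative_def]] by simp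
    have ds: "((\<lambda>t. snd (\<gamma> t)) has_derivative (\<lambda>t. t *\<^sub>R b)) (at 0)"
      using has_derivative_snd[OF d[unfolded has_vector_derivative_def]] by simp
    have "((\<lambda>t. \<rho> (fst (\<gamma> t))) has_derivative (\<lambda>t. fderiv \<rho> z (t *\<^sub>R a))) (at 0)"
      by (rule has_derivative_compose[OF df]) (use \<rho> g0 in simp)
    moreover have "\<forall>\<^sub>F t in nhds 0. \<rho> (fst (\<gamma> t)) = snd (\<gamma> t)"
      using ev by eventually_elim (auto simp: graph_over_def)
    then have "\<forall>\<^sub>F t in at 0. \<rho> (fst (\<gamma> t)) = snd (\<gamma> t)"
      by (auto simp: eventually_at_filter elim: eventually_mono)
    ultimately have "((\<lambda>t. snd (\<gamma> t)) has_derivative (\<lambda>t. fderiv \<rho> z (t *\<^sub>R a))) (at 0)"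
      by (rule has_derivative_transform_eventually) (use g0 in auto)
    from has_derivative_unique[OF ds this] have "1 *\<^sub>R b = fderiv \<rho> z (1 *\<^sub>R a)" by metis
    then show ?thesis by simp
  qed
  then show ?thesis
    using curve_in_graph[OF assms] unfolding tangent_space_def by fast
qed

definition tangent01 :: "(complex^'n \<Rightarrow> complex) \<Rightarrow> complex^'n \<Rightarrow> complex^'n \<Rightarrow>
    ((complex^'n) \<times> complex) \<times> ((complex^'n) \<times> complex)" where
  "tangent01 \<rho> z h = ((h, fderiv \<rho> z h), \<i> *c (h, fderiv \<rho> z h))"

text \<open>The pair consisting of X = (h, d\<rho> h) and \<i> X is tangent to the graph exactly
  when d\<rho> (\<i> h) = \<i> d\<rho> h, that is, when the conjugate-linear part of d\<rho> kills
  h.\<close>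

lemma T01_graph:
  assumes U: "open U" "z \<in> U" and \<rho>: "(\<rho> has_derivative fderiv \<rho> z) (at z)"
  shows "T01 (graph_over U \<rho>) (z, \<rho> z) = tangent01 \<rho> z ` {h. dbar \<rho> z h = 0}"
proof -
  have iff: "fderiv \<rho> z (\<i> *c h) = \<i> * fderiv \<rho> z h \<longleftrightarrow> dbar \<rho> z h = 0" for h
  proof -
    have "dbar \<rho> z h = \<i> * (fderiv \<rho> z (\<i> *c h) - \<i> * fderiv \<rho> z h) / 2"
      by (simp add: dbar_def algebra_simps flip: mult.assoc)
    also have "\<dots> = 0 \<longleftrightarrow> fderiv \<rho> z (\<i> *c h) = \<i> * fderiv \<rho> z h" by simp
    finally show ?thesis by blast
  qed
  have iff': "\<i> * fderiv \<rho> z h = fderiv \<rho> z (\<i> *c h) \<longleftrightarrow> dbar \<rho> z h = 0" for h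
    unfolding iff[symmetric] by (rule eq_commute)
  show ?thesis
    unfolding T01_def complexify_def tangent_space_graph[OF assms] antiholomorphic_vectors_eq
    by (auto simp: tangent01_def iff iff' image_def)
qed

section \<open>The dimension of the (0,1) tangent spaces and CR points\<close>

interpretation ctensor_pair: vector_space_pair cscale cscale ..

lemma ctensor_dim_image_eq:
  assumes f: "Vector_Spaces.linear cscale cscale f" and V: "ctensor.subspace V" and inj: "inj_on f V"
  shows "ctensor.dim (f ` V) = ctensor.dim V"
proof -
  obtain B where B: "B \<subseteq> V" "ctensor.independent B" "V \<subseteq> ctensor.span B" "card B = ctensor.dim V"
    by (rule ctensor.basis_exists)
  have span: "ctensor.span B = V"
    using B ctensor.span_minimal[OF B(1) V] by blast
  have "ctensor.independent (f ` B)"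
    by (rule ctensor_pair.linear_independent_injective_image[OF f B(2)]) (use inj span in simp)
  moreover have "ctensor.span (f ` B) = ctensor.span (f ` V)"
    using ctensor_pair.linear_span_image[OF f] span V by (metis ctensor.span_eq_iff)
  ultimately have "ctensor.dim (f ` V) = card (f ` B)" by (rule ctensor.dim_eq_card[rotated])
  also have "\<dots> = card B" using inj B(1) by (meson card_image inj_on_subset)
  finally show ?thesis using B(4) by simp
qed

lemma subspace_T01_graph:
  assumes U: "open U" "z \<in> U" and \<rho>: "(\<rho> has_derivative fderiv \<rho> z) (at z)"
  shows "ctensor.subspace (T01 (graph_over U \<rho>) (z, \<rho> z))"
proof -
  interpret bounded_linear "fderiv \<rho> z" by (rule has_derivative_bounded_linear[OF \<rho>])
  have "ctensor.subspace (complexify {(h, fderiv \<rho> z h) | h. True})"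
  proof (rule ctensor.subspaceI)
    show "0 \<in> complexify {(h, fderiv \<rho> z h) | h. True}"
      by (simp add: complexify_def zero_prod_def zero)
    fix x y assume "x \<in> complexify {(h, fderiv \<rho> z h) | h. True}" "y \<in> complexify {(h, fderiv \<rho> z h) | h. True}"
    then show "x + y \<in> complexify {(h, fderiv \<rho> z h) | h. True}"
      by (auto simp: complexify_def add)
  next
    fix c x assume "x \<in> complexify {(h, fderiv \<rho> z h) | h. True}"
    then show "cscale c x \<in> complexify {(h, fderiv \<rho> z h) | h. True}"
      by (auto simp: complexify_def cscale_def add diff scaleR)
  qed
  then show ?thesis
    unfolding T01_def tangent_space_graph[OF assms] antiholomorphic_vectors_def
    by (intro ctensor.subspace_inter ctensor.subspace_span)
qed

definition reduced01 :: "'n::finite \<Rightarrow> (((complex^'n) \<times> complex) \<times> ((complex^'n) \<times> complex)) set" where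
  "reduced01 j = (\<lambda>h. ((h, 0), \<i> *c (h, 0))) ` {h. h $ j = 0}"

text \<open>Where the \<open>j\<close>-th antiholomorphic derivative of \<open>\<rho>\<close> does not vanish, forgetting the \<open>j\<close>-th component
  and \<open>w\<close> identifies \<^const>\<open>T01\<close> with a space that does not depend on the point.\<close>

lemma dim_T01_graph:
  fixes \<rho> :: "complex^'n \<Rightarrow> complex"
  assumes U: "open U" "z \<in> U" and \<rho>: "(\<rho> has_derivative fderiv \<rho> z) (at z)"
    and nz: "dbar \<rho> z (axis j 1) \<noteq> 0"
  shows "ctensor.dim (T01 (graph_over U \<rho>) (z, \<rho> z)) = ctensor.dim (reduced01 j)"
proof -
  define P where "P x = (fst x - fst x $ j *c axis j 1, 0::complex)" for x :: "(complex^'n) \<times> complex"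
  define \<phi> where "\<phi> Z = (P (fst Z), P (snd Z))" for Z
  let ?V = "T01 (graph_over U \<rho>) (z, \<rho> z)"
  have V: "?V = tangent01 \<rho> z ` {h. dbar \<rho> z h = 0}" by (rule T01_graph[OF U \<rho>])
  have P: "P (x + y) = P x + P y" "P (x - y) = P x - P y" "P (r *\<^sub>R x) = r *\<^sub>R P x" for x y r
    by (simp_all add: P_def scaleC_add_left scaleC_diff_left vec_eq_iff algebra_simps)
  have lin: "Vector_Spaces.linear cscale cscale \<phi>"
    by (simp add: Vector_Spaces.linear_iff ctensor.vector_space_axioms \<phi>_def cscale_def P)
  have P01: "\<phi> (tangent01 \<rho> z h) = ((h - h $ j *c axis j 1, 0), \<i> *c (h - h $ j *c axis j 1, 0))" for h
    by (simp add: \<phi>_def tangent01_def P_def scaleC_diff_right)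
  note cl = dbar_conj_linear[OF \<rho>]
  have "inj_on \<phi> ?V"
  proof (rule inj_onI)
    fix X Y assume "X \<in> ?V" "Y \<in> ?V" and eq: "\<phi> X = \<phi> Y"
    then obtain h k where h: "X = tangent01 \<rho> z h" "dbar \<rho> z h = 0" and k: "Y = tangent01 \<rho> z k" "dbar \<rho> z k = 0"
      unfolding V by auto
    have "h - h $ j *c axis j 1 = k - k $ j *c axis j 1" using eq unfolding h k P01 by simp
    then have hk: "h = k + (h $ j - k $ j) *c axis j 1" by (simp add: scaleC_diff_left algebra_simps)
    have "dbar \<rho> z h = dbar \<rho> z k + cnj (h $ j - k $ j) * dbar \<rho> z (axis j 1)"
      by (subst hk) (simp only: cl)
    then have "h $ j - k $ j = 0" using h k nz by simp
    then show "X = Y" using hk h k by simp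
  qed
  from ctensor_dim_image_eq[OF lin subspace_T01_graph[OF U \<rho>] this]
  have "ctensor.dim (\<phi> ` ?V) = ctensor.dim ?V" .
  moreover have "\<phi> ` ?V = reduced01 j"
  proof (rule set_eqI, rule iffI)
    fix X assume "X \<in> \<phi> ` ?V"
    then obtain h where "X = \<phi> (tangent01 \<rho> z h)" unfolding V by auto
    then show "X \<in> reduced01 j"
      unfolding P01 reduced01_def by (intro image_eqI[of _ _ "h - h $ j *c axis j 1"]) auto
  next
    fix X assume "X \<in> reduced01 j"
    then obtain h where h: "X = ((h, 0), \<i> *c (h, 0))" "h $ j = 0" by (auto simp: reduced01_def)
    \<comment> \<open>The j-th component is chosen so that \<open>dbar \<rho> z k\<close> vanishes;
      the outer conjugate compensates for conjugate linearity.\<close>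
    define k where "k = h + cnj (- dbar \<rho> z h / dbar \<rho> z (axis j 1)) *c axis j 1"
    have "dbar \<rho> z k = dbar \<rho> z h + cnj (cnj (- dbar \<rho> z h / dbar \<rho> z (axis j 1))) * dbar \<rho> z (axis j 1)"
      unfolding k_def by (simp only: cl)
    then have "dbar \<rho> z k = 0" using nz by simp
    moreover have "k - k $ j *c axis j 1 = h" by (simp add: k_def h(2))
    then have "X = \<phi> (tangent01 \<rho> z k)" unfolding P01 h(1) by simp
    ultimately show "X \<in> \<phi> ` ?V" unfolding V by blast
  qed
  ultimately show ?thesis by simp
qed

text \<open>The j-th antiholomorphic derivative of \<rho> stays nonzero near z, and there the
  dimension is that of \<open>reduced01 j\<close>. A neighbourhood with arbitrary w is enough, since
  only its points on the graph count.\<close>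

lemma CR_points_graph:
  fixes \<rho> :: "complex^'n \<Rightarrow> complex"
  assumes U: "open U" and \<rho>: "\<rho> real_analytic_on U" and z: "z \<in> U" and nz: "dbar \<rho> z (axis j 1) \<noteq> 0"
  shows "(z, \<rho> z) \<in> CR_points (graph_over U \<rho>)"
proof -
  obtain N0 where N0: "open N0" "z \<in> N0" "\<And>k v. Ck_on k N0 (\<lambda>x. fderiv \<rho> x v)"
    by (rule real_analytic_fderiv[OF \<rho> z], rule that)
  have "continuous_on N0 (\<lambda>x. fderiv \<rho> x v)" for v using N0(3)[of 0 v] by simp
  then have "continuous_on N0 (\<lambda>x. dbar \<rho> x (axis j 1))"
    unfolding dbar_def by (intro continuous_intros) auto
  from open_nonzero[OF this N0(1)] U
  have N: "open (({x \<in> N0. dbar \<rho> x (axis j 1) \<noteq> 0} \<inter> U) \<times> (UNIV :: complex set))"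
    by (intro open_Times open_Int) auto
  have dim: "ctensor.dim (T01 (graph_over U \<rho>) (x, \<rho> x)) = ctensor.dim (reduced01 j)"
    if "x \<in> U" "dbar \<rho> x (axis j 1) \<noteq> 0" for x
    by (rule dim_T01_graph[OF U that(1) real_analytic_has_derivative[OF \<rho> that(1)] that(2)])
  show ?thesis
    unfolding CR_points_def
  proof (intro CollectI conjI exI)
    show "(z, \<rho> z) \<in> graph_over U \<rho>" using z by (auto simp: graph_over_def)
    show "open (({x \<in> N0. dbar \<rho> x (axis j 1) \<noteq> 0} \<inter> U) \<times> (UNIV :: complex set))" by (rule N)
    show "(z, \<rho> z) \<in> ({x \<in> N0. dbar \<rho> x (axis j 1) \<noteq> 0} \<inter> U) \<times> UNIV" using N0 nz z by simp
    show "\<forall>q\<in>graph_over U \<rho> \<inter> ({x \<in> N0. dbar \<rho> x (axis j 1) \<noteq> 0} \<inter> U) \<times> UNIV.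
       ctensor.dim (T01 (graph_over U \<rho>) q) = ctensor.dim (T01 (graph_over U \<rho>) (z, \<rho> z))"
    proof
      fix q assume "q \<in> graph_over U \<rho> \<inter> ({x \<in> N0. dbar \<rho> x (axis j 1) \<noteq> 0} \<inter> U) \<times> UNIV"
      then obtain x where "q = (x, \<rho> x)" "x \<in> U" "dbar \<rho> x (axis j 1) \<noteq> 0" by (auto simp: graph_over_def)
      then show "ctensor.dim (T01 (graph_over U \<rho>) q) = ctensor.dim (T01 (graph_over U \<rho>) (z, \<rho> z))"
        using dim[of x] dim[OF z nz] by simp
    qed
  qed
qed

text \<open>If both derivatives of \<rho> vanish at z, both sides are 0. Otherwise z gives a CR
  point, and the combination of the j-th and k-th directions that kills \<rho> defines a CR vector
  field; applied to f it yields precisely this minor. Hence the identity holds at every point of U,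
  including the CR singular ones.\<close>

lemma CR_function_dbar:
  fixes \<rho> f :: "complex^'n \<Rightarrow> complex"
  assumes U: "open U" and \<rho>: "\<rho> real_analytic_on U" and f: "f real_analytic_on U"
    and CR: "CR_function (graph_over U \<rho>) (\<lambda>p. f (fst p))" and z: "z \<in> U"
  shows "dbar \<rho> z (axis j 1) * dbar f z (axis k 1) = dbar \<rho> z (axis k 1) * dbar f z (axis j 1)"
proof (cases "dbar \<rho> z (axis j 1) = 0 \<and> dbar \<rho> z (axis k 1) = 0")
  case True
  then show ?thesis by simp
next
  case False
  then have zCR: "(z, \<rho> z) \<in> CR_points (graph_over U \<rho>)" using CR_points_graph[OF U \<rho> z] by blast
  define e where "e i = (axis i 1 :: complex^'n)" for i
  \<comment> \<open>The coefficients are conjugated because \<open>dbar\<close> is conjugate-linear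
    in the direction: \<open>dbar g x (h x)\<close> becomes the 2 by 2 minor, which is 0 for g =
    \<rho>.\<close>
  define h where "h x = cnj (dbar \<rho> x (e j)) *c e k - cnj (dbar \<rho> x (e k)) *c e j" for x
  have dh: "dbar g x (h x) = dbar \<rho> x (e j) * dbar g x (e k) - dbar \<rho> x (e k) * dbar g x (e j)"
    if "(g has_derivative fderiv g x) (at x)" for g x
  proof -
    have "h x = cnj (dbar \<rho> x (e j)) *c e k + (- cnj (dbar \<rho> x (e k))) *c e j" by (simp add: h_def)
    then show ?thesis by (simp only: dbar_conj_linear[OF that]) simp
  qed
  define Z where "Z p = tangent01 \<rho> (fst p) (h (fst p))" for p :: "(complex^'n) \<times> complex"
  have "CR_vector_field (graph_over U \<rho>) (CR_points (graph_over U \<rho>)) Z"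
    unfolding CR_vector_field_def
  proof (intro conjI ballI)
    show "Z p \<in> T01 (graph_over U \<rho>) p" if p: "p \<in> CR_points (graph_over U \<rho>)" for p
    proof -
      obtain x where x: "p = (x, \<rho> x)" "x \<in> U" using p by (auto simp: CR_points_def graph_over_def)
      note d = real_analytic_has_derivative[OF \<rho> x(2)]
      have "dbar \<rho> x (h x) = 0" using dh[OF d] by simp
      then show ?thesis unfolding x(1) T01_graph[OF U x(2) d] Z_def by simp
    qed
    show "smooth_on_subset (CR_points (graph_over U \<rho>)) Z"
      unfolding smooth_on_subset_def
    proof
      fix p assume "p \<in> CR_points (graph_over U \<rho>)"
      then obtain x where x: "p = (x, \<rho> x)" "x \<in> U" by (auto simp: CR_points_def graph_over_def)
      obtain N where N: "open N" "x \<in> N" "\<And>y. y \<in> N \<Longrightarrow> (\<rho> has_derivative fderiv \<rho> y) (at y)"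
          "\<And>k v. Ck_on k N (\<lambda>y. fderiv \<rho> y v)"
        by (rule real_analytic_fderiv[OF \<rho> x(2)], rule that)
      have ck_dbar: "Ck_on m N (\<lambda>y. dbar \<rho> y v)" for m v
      proof -
        have "bounded_linear (\<lambda>w::complex. \<i> * w)" "bounded_linear (\<lambda>w::complex. w / 2)"
          by (rule bounded_linear_mult_right bounded_linear_divide)+
        then show ?thesis unfolding dbar_def
          by (intro Ck_on_bounded_linear[of "\<lambda>w. w / 2"] Ck_on_add N(4) Ck_on_bounded_linear[of "\<lambda>w. \<i> * w"])
      qed
      have bl: "bounded_linear (\<lambda>w. cnj w *c v)" "bounded_linear (\<lambda>w. - (cnj w *c v))" for v :: "complex^'n"
      proof -
        show "bounded_linear (\<lambda>w. cnj w *c v)"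
          by (rule bounded_linear_compose[OF bounded_bilinear.bounded_linear_left[OF bounded_bilinear_scaleC] bounded_linear_cnj])
        then show "bounded_linear (\<lambda>w. - (cnj w *c v))" by (rule bounded_linear_minus)
      qed
      have ck_h: "Ck_on m N h" for m
      proof -
        have "Ck_on m N (\<lambda>y. cnj (dbar \<rho> y (e j)) *c e k + - (cnj (dbar \<rho> y (e k)) *c e j))"
          by (rule Ck_on_add[OF Ck_on_bounded_linear[OF bl(1) ck_dbar] Ck_on_bounded_linear[OF bl(2) ck_dbar]])
        then show ?thesis by (simp add: h_def[abs_def])
      qed
      \<comment> \<open>The differential of \<rho> is only real-linear, so a coefficient that
        depends on y has to be split into real and imaginary parts before it can be taken
        out.\<close>
      have ck_scaled: "Ck_on m N (\<lambda>y. fderiv \<rho> y (cnj (dbar \<rho> y a) *c b))" for m a b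
      proof -
        have "fderiv \<rho> y (cnj (dbar \<rho> y a) *c b) =
            Re (dbar \<rho> y a) *\<^sub>R fderiv \<rho> y b + (- Im (dbar \<rho> y a)) *\<^sub>R fderiv \<rho> y (\<i> *c b)" if "y \<in> N" for y
        proof -
          interpret bounded_linear "fderiv \<rho> y" by (rule has_derivative_bounded_linear[OF N(3)[OF that]])
          show ?thesis by (subst scaleC_Re_Im) (simp add: add diff scaleR)
        qed
        moreover have "Ck_on m N (\<lambda>y. Re (dbar \<rho> y a) *\<^sub>R fderiv \<rho> y b + (- Im (dbar \<rho> y a)) *\<^sub>R fderiv \<rho> y (\<i> *c b))"
          by (intro Ck_on_add Ck_on_bilinear[OF bounded_bilinear_scaleR] N(4) Ck_on_bounded_linear[OF bounded_linear_Re]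
              Ck_on_bounded_linear[OF bounded_linear_minus[OF bounded_linear_Im]] ck_dbar)
        ultimately show ?thesis using Ck_on_cong[OF N(1)] by (metis (no_types, lifting))
      qed
      have ck_Dh: "Ck_on m N (\<lambda>y. fderiv \<rho> y (h y))" for m
      proof -
        have eq: "fderiv \<rho> y (cnj (dbar \<rho> y (e j)) *c e k) + - fderiv \<rho> y (cnj (dbar \<rho> y (e k)) *c e j) = fderiv \<rho> y (h y)" if "y \<in> N" for y
          using linear_diff[OF has_derivative_linear[OF N(3)[OF that]]] by (simp add: h_def)
        have "Ck_on m N (\<lambda>y. fderiv \<rho> y (cnj (dbar \<rho> y (e j)) *c e k) + - fderiv \<rho> y (cnj (dbar \<rho> y (e k)) *c e j))"
          by (rule Ck_on_add[OF ck_scaled Ck_on_bounded_linear[OF bounded_linear_minus[OF bounded_linear_ident] ck_scaled]])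
        then show ?thesis by (rule Ck_on_cong[OF N(1) eq, rotated])
      qed
      have i: "bounded_linear (\<lambda>v. \<i> *c (v::(complex^'n) \<times> complex))"
        by (rule bounded_bilinear.bounded_linear_right[OF bounded_bilinear_scaleC])
      have ck_Z: "Ck_on m (N \<times> UNIV) Z" for m
        unfolding Z_def[abs_def] tangent01_def
        by (rule Ck_on_fst[of _ _ "\<lambda>y. ((h y, fderiv \<rho> y (h y)), \<i> *c (h y, fderiv \<rho> y (h y)))"])
           (rule Ck_on_Pair[OF Ck_on_Pair[OF ck_h ck_Dh] Ck_on_bounded_linear[OF i Ck_on_Pair[OF ck_h ck_Dh]]])
      \<comment> \<open>Z depends on z alone and is smooth on the cylinder N \<times> UNIV, so Z
        itself is the local smooth extension.\<close>
      then show "\<exists>N g. open N \<and> p \<in> N \<and> (\<forall>k. Ck_on k N g) \<and> (\<forall>q\<in>CR_points (graph_over U \<rho>) \<inter> N. g q = Z q)"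
        using N x by (intro exI[of _ "N \<times> UNIV"] exI[of _ Z]) (auto intro: open_Times)
    qed
  qed
  with CR zCR have "annihilates (graph_over U \<rho>) (z, \<rho> z) (Z (z, \<rho> z)) (\<lambda>p. f (fst p))"
    unfolding CR_function_def by blast
  then obtain a b where
      a: "has_tangential_derivative (graph_over U \<rho>) (\<lambda>p. f (fst p)) (z, \<rho> z) (h z, fderiv \<rho> z (h z)) a"
    and b: "has_tangential_derivative (graph_over U \<rho>) (\<lambda>p. f (fst p)) (z, \<rho> z) (\<i> *c (h z, fderiv \<rho> z (h z))) b"
    and ab: "a + \<i> * b = 0"
    unfolding annihilates_def Z_def tangent01_def by auto
  note d\<rho> = real_analytic_has_derivative[OF \<rho> z] and df = real_analytic_has_derivative[OF f z]
  \<comment> \<open>A tangential derivative is prescribed along all curves with the given velocity;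
    the lift of a straight line to the graph already determines its value.\<close>
  have val: "c = fderiv f z v"
    if "has_tangential_derivative (graph_over U \<rho>) (\<lambda>p. f (fst p)) (z, \<rho> z) (v, fderiv \<rho> z v) c" for v c
  proof -
    have "((\<lambda>t. f (z + t *\<^sub>R v)) has_vector_derivative c) (at 0)"
      using that curve_in_graph[OF U z d\<rho>, of v] unfolding has_tangential_derivative_def by fastforce
    then show ?thesis by (rule vector_derivative_unique_at) (rule has_vector_derivative_line[OF df])
  qed
  have "dbar \<rho> z (h z) = 0" using dh[OF d\<rho>] by simp
  then have "fderiv \<rho> z (\<i> *c h z) = \<i> * fderiv \<rho> z (h z)"
  proof -
    assume "dbar \<rho> z (h z) = 0"
    then have "\<i> * (fderiv \<rho> z (h z) + \<i> * fderiv \<rho> z (\<i> *c h z)) = 0" by (simp add: dbar_def)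
    then show ?thesis by (simp add: algebra_simps flip: mult.assoc)
  qed
  then have "b = fderiv f z (\<i> *c h z)" using b by (intro val) simp
  moreover have "a = fderiv f z (h z)" using a by (rule val)
  ultimately have "dbar f z (h z) = 0" using ab by (simp add: dbar_def)
  then show ?thesis using dh[OF df] by (simp add: e_def)
qed

section \<open>The quadratic part and the main theorem\<close>

text \<open>Dividing by t once turns the cubic bound into a quadratic one for a function \<psi>, and
  a quadratic bound on a sequence of positive points tending to 0 forces the value and the first
  derivative of \<psi> to vanish.\<close>

lemma cubic_vanishing:
  assumes \<phi>: "\<phi> holomorphic_on ball 0 r" and r: "r > 0"
    and bd: "\<And>t::real. \<bar>t\<bar> < r \<Longrightarrow> cmod (\<phi> (of_real t)) \<le> K * \<bar>t\<bar> ^ 3"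
  shows "deriv \<phi> 0 = 0" and "deriv (deriv \<phi>) 0 = 0"
proof -
  define x where "x n = r / 2 / real (Suc n)" for n
  have x: "x n > 0" "x n < r" for n
  proof -
    show "x n > 0" using r by (simp add: x_def)
    have "x n \<le> r / 2" using r by (simp add: x_def divide_le_eq)
    then show "x n < r" using r by simp
  qed
  have xlim: "x \<longlonglongrightarrow> 0" unfolding x_def by (rule LIMSEQ_Suc) (rule lim_const_over_n)
  \<comment> \<open>The bound is assumed for t > 0 only: at 0 the quotient \<psi> is filled in by a
    derivative, about which the cubic bound says nothing directly.\<close>
  have first_order: "\<psi> 0 = 0 \<and> deriv \<psi> 0 = 0"
    if \<psi>: "\<psi> holomorphic_on ball 0 r" and b: "\<And>t::real. 0 < t \<Longrightarrow> t < r \<Longrightarrow> cmod (\<psi> (of_real t)) \<le> K * t\<^sup>2" for \<psi>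
  proof -
    have xc: "(\<lambda>n. complex_of_real (x n)) \<longlonglongrightarrow> 0"
      using tendsto_of_real[OF xlim] by simp
    have d: "(\<psi> has_field_derivative deriv \<psi> 0) (at 0)"
      by (rule holomorphic_derivI[OF \<psi>]) (use r in auto)
    have "(\<lambda>n. \<psi> (of_real (x n))) \<longlonglongrightarrow> \<psi> 0"
      by (rule isCont_tendsto_compose[OF DERIV_isCont[OF d] xc])
    moreover have "(\<lambda>n. \<psi> (of_real (x n))) \<longlonglongrightarrow> 0"
    proof (rule Lim_null_comparison[OF always_eventually[OF allI[OF b[OF x]]]])
      have "(\<lambda>n. K * (x n)\<^sup>2) \<longlonglongrightarrow> K * 0\<^sup>2" by (intro tendsto_intros xlim)
      then show "(\<lambda>n. K * (x n)\<^sup>2) \<longlonglongrightarrow> 0" by simp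
    qed
    ultimately have z: "\<psi> 0 = 0" by (rule LIMSEQ_unique)
    have "((\<lambda>h. (\<psi> h - \<psi> 0) / h) \<longlongrightarrow> deriv \<psi> 0) (at 0)" using d by (simp add: DERIV_def)
    moreover have "filterlim (\<lambda>n. complex_of_real (x n)) (at 0) sequentially"
      using xc x by (auto simp: filterlim_at less_imp_neq[THEN not_sym])
    ultimately have "(\<lambda>n. (\<psi> (of_real (x n)) - \<psi> 0) / of_real (x n)) \<longlonglongrightarrow> deriv \<psi> 0"
      by (rule filterlim_compose)
    moreover have "(\<lambda>n. (\<psi> (of_real (x n)) - \<psi> 0) / of_real (x n)) \<longlonglongrightarrow> 0"
    proof (rule Lim_null_comparison[OF always_eventually[OF allI]])
      show "norm ((\<psi> (of_real (x n)) - \<psi> 0) / of_real (x n)) \<le> K * x n" for n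
        using b[OF x, of n] x(1)[of n] by (simp add: z norm_divide divide_le_eq power2_eq_square mult.assoc)
      have "(\<lambda>n. K * x n) \<longlonglongrightarrow> K * 0" by (intro tendsto_intros xlim)
      then show "(\<lambda>n. K * x n) \<longlonglongrightarrow> 0" by simp
    qed
    ultimately have "deriv \<psi> 0 = 0" by (rule LIMSEQ_unique)
    with z show ?thesis by simp
  qed
  have \<phi>0: "\<phi> 0 = 0" using bd[of 0] r by simp
  define \<psi> where "\<psi> t = (if t = 0 then deriv \<phi> 0 else (\<phi> t - \<phi> 0) / (t - 0))" for t
  have \<psi>: "\<psi> holomorphic_on ball 0 r" unfolding \<psi>_def by (rule pole_lemma_open[OF \<phi> open_ball])
  have "cmod (\<psi> (of_real t)) \<le> K * t\<^sup>2" if "0 < t" "t < r" for t :: real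
    using bd[of t] that by (simp add: \<psi>_def \<phi>0 norm_divide divide_le_eq power2_eq_square power3_eq_cube mult.assoc)
  then have \<psi>0: "\<psi> 0 = 0" "deriv \<psi> 0 = 0" using first_order[OF \<psi>] by blast+
  then show "deriv \<phi> 0 = 0" by (simp add: \<psi>_def)
  have eq: "\<phi> t = t * \<psi> t" for t by (simp add: \<psi>_def \<phi>0)
  have d\<psi>: "(\<psi> has_field_derivative deriv \<psi> t) (at t)" if "t \<in> ball 0 r" for t
    by (rule holomorphic_derivI[OF \<psi> open_ball that])
  have "deriv \<phi> t = \<psi> t + t * deriv \<psi> t" if "t \<in> ball 0 r" for t
    unfolding eq[abs_def] using DERIV_mult[OF DERIV_ident d\<psi>[OF that]] by (intro DERIV_imp_deriv) (simp add: algebra_simps)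
  then have "\<forall>\<^sub>F t in nhds 0. deriv \<phi> t = \<psi> t + t * deriv \<psi> t"
    using r by (intro eventually_nhds_in_open[of "ball 0 r", THEN eventually_mono]) auto
  then have "deriv (deriv \<phi>) 0 = deriv (\<lambda>t. \<psi> t + t * deriv \<psi> t) 0" by (rule deriv_cong_ev) simp
  also have "\<dots> = 0"
  proof (rule DERIV_imp_deriv)
    have "(deriv \<psi> has_field_derivative deriv (deriv \<psi>) 0) (at 0)"
      by (rule holomorphic_derivI[OF holomorphic_deriv[OF \<psi> open_ball] open_ball]) (use r in simp)
    from DERIV_add[OF d\<psi>[of 0] DERIV_mult[OF DERIV_ident this]]
    show "((\<lambda>t. \<psi> t + t * deriv \<psi> t) has_field_derivative 0) (at 0)" using r \<psi>0 by simp
  qed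
  finally show "deriv (deriv \<phi>) 0 = 0" .
qed

lemma cderiv_add:
  assumes "hol f S" "hol g S" "open S" "p \<in> S"
  shows "cderiv v (\<lambda>x. f x + g x) p = cderiv v f p + cderiv v g p"
  using DERIV_add[OF hol_DERIV0[OF assms(1,3,4), of v] hol_DERIV0[OF assms(2,3,4), of v]]
  by (rule cderiv_eqI)

text \<open>The bound holds only on the real form. Restriction to its real lines kills the first
  derivative and the diagonal second derivatives in real-form directions; polarisation gives the
  mixed ones, and complex linearity together with \<open>real_decomposition\<close> gives all
  directions.\<close>

lemma cubic_derivatives_vanish:
  fixes H :: "(complex^'n) \<times> (complex^'n) \<Rightarrow> complex"
  assumes H: "hol H (ball 0 d)" and d: "d > 0"
    and bd: "\<And>x. (x, cnj_vec x) \<in> ball 0 d \<Longrightarrow> cmod (H (x, cnj_vec x)) \<le> K * norm x ^ 3"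
  shows "cderiv v H 0 = 0" and "cderiv u (cderiv v H) 0 = 0"
proof -
  let ?S = "ball (0::(complex^'n) \<times> (complex^'n)) d"
  have S: "open ?S" "0 \<in> ?S" using d by auto
  let ?r = "\<lambda>x. (x, cnj_vec x)"
  have real: "cderiv (?r x) H 0 = 0 \<and> cderiv (?r x) (cderiv (?r x) H) 0 = 0" for x
  proof -
    obtain r where r: "r > 0" "cball 0 r \<subseteq> {t. 0 + t *c ?r x \<in> ?S}"
      by (rule line_cball[OF S]) (rule that)
    let ?\<phi> = "\<lambda>t. H (0 + t *c ?r x)"
    have hol: "?\<phi> holomorphic_on ball 0 r"
      by (rule holomorphic_on_subset[OF hol_line[OF H] order_trans[OF ball_subset_cball r(2)]])
    have b: "cmod (?\<phi> (of_real t)) \<le> (K * norm x ^ 3) * \<bar>t\<bar> ^ 3" if "\<bar>t\<bar> < r" for t :: real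
    proof -
      have eq: "0 + of_real t *c ?r x = ?r (t *\<^sub>R x)" by (simp add: scaleC_of_real zero_prod_def)
      have "of_real t \<in> cball (0::complex) r" using that by simp
      then have "0 + of_real t *c ?r x \<in> ?S" using r(2) by blast
      then have "cmod (?\<phi> (of_real t)) \<le> K * norm (t *\<^sub>R x) ^ 3" unfolding eq by (rule bd)
      then show ?thesis by (simp add: power_mult_distrib mult.commute mult.left_commute)
    qed
    have "(deriv ^^ n) ?\<phi> 0 = (cderiv (?r x) ^^ n) H 0" for n
      using funpow_cderiv_line(2)[OF H S(1), of 0 0 "?r x" n] S(2) by (simp flip: zero_prod_def)
    from this[of 1] this[of 2] show ?thesis
      using cubic_vanishing[OF hol r(1) b] by (simp add: numeral_2_eq_2)
  qed
  have lin2: "cderiv w (cderiv (a + b) H) 0 = cderiv w (cderiv a H) 0 + cderiv w (cderiv b H) 0" for w a b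
    using cderiv_cong[OF S, of "cderiv (a + b) H" "\<lambda>q. cderiv a H q + cderiv b H q" w]
      cderiv_add_direction[OF H S(1)] cderiv_add[OF hol_cderiv[OF H S(1)] hol_cderiv[OF H S(1)] S] by simp
  have lin1: "cderiv (a + b) (cderiv w H) 0 = cderiv a (cderiv w H) 0 + cderiv b (cderiv w H) 0" for w a b
    by (rule cderiv_add_direction[OF hol_cderiv[OF H S(1)] S])
  have sc1: "cderiv (c *c a) (cderiv w H) 0 = c * cderiv a (cderiv w H) 0" for c w a
    by (rule cderiv_scale[OF hol_cderiv[OF H S(1)] S])
  note sym = cderiv_commute[OF H S]
  \<comment> \<open>Polarisation: the diagonal vanishes for x, y and x + y, and the two mixed terms
    are equal by symmetry.\<close>
  have rr: "cderiv (?r x) (cderiv (?r y) H) 0 = 0" for x y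
  proof -
    have "?r (x + y) = ?r x + ?r y" by simp
    then have "cderiv (?r x + ?r y) (cderiv (?r x + ?r y) H) 0 = 0" using real[of "x + y"] by metis
    then have "2 * cderiv (?r x) (cderiv (?r y) H) 0 = 0"
      unfolding lin1 lin2 using real[of x] real[of y] sym[of "?r x" "?r y"] by simp
    then show ?thesis by simp
  qed
  have r1: "cderiv w (cderiv (?r y) H) 0 = 0" for w y
  proof -
    obtain a b where "w = ?r a + \<i> *c ?r b" by (rule real_decomposition) (rule that)
    then show ?thesis using rr by (simp only: lin1 sc1) simp
  qed
  obtain a b where v: "v = ?r a + \<i> *c ?r b" by (rule real_decomposition) (rule that)
  show "cderiv v H 0 = 0"
    unfolding v cderiv_add_direction[OF H S] cderiv_scale[OF H S] using real by simp
  have "cderiv (?r y) (cderiv u H) 0 = 0" for y using r1[of u y] sym[of u "?r y"] by simp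
  then have "cderiv v (cderiv u H) 0 = 0" unfolding v lin1 sc1 by simp
  then show "cderiv u (cderiv v H) 0 = 0" by (simp only: sym)
qed

text \<open>The quadratic part Q with cnj z replaced by the independent variable \<xi>, which is why
  the entries of B appear conjugated.\<close>

definition quad_polarized :: "complex^'n^'n \<Rightarrow> complex^'n^'n \<Rightarrow> complex^'n^'n \<Rightarrow> (complex^'n) \<times> (complex^'n) \<Rightarrow> complex" where
  "quad_polarized A B C q = (\<Sum>i\<in>UNIV. \<Sum>j\<in>UNIV. snd q $ i * A $ i $ j * fst q $ j +
     snd q $ i * cnj (B $ i $ j) * snd q $ j + fst q $ i * C $ i $ j * fst q $ j)"

text \<open>The derivative of \<open>quad_polarized\<close> in the \<xi>-direction e, as a linear
  function of q = (z, \<xi>). For symmetric B the last two summands give equal sums.\<close>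

definition quad_hessian :: "complex^'n^'n \<Rightarrow> complex^'n^'n \<Rightarrow> complex^'n \<Rightarrow> (complex^'n) \<times> (complex^'n) \<Rightarrow> complex" where
  "quad_hessian A B e q = (\<Sum>i\<in>UNIV. \<Sum>j\<in>UNIV. e $ i * A $ i $ j * fst q $ j +
     (e $ i * cnj (B $ i $ j) * snd q $ j + snd q $ i * cnj (B $ i $ j) * e $ j))"

lemma quad_polarized_real:
  "quad_polarized A B C (x, cnj_vec x) = sesq_form A x + cnj (quad_form B x) + quad_form C x"
  by (simp add: quad_polarized_def sesq_form_def quad_form_def scalar_product_def matrix_vector_mult_def
      sum.distrib sum_distrib_left mult.assoc)

lemma hol_quad_polarized: "hol (quad_polarized A B C) S"
  unfolding quad_polarized_def by (intro hol_intros)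

lemma cderiv_quad_polarized: "cderiv (0, e) (quad_polarized A B C) q = quad_hessian A B e q"
  unfolding quad_polarized_def quad_hessian_def
  by (rule cderiv_eqI) (auto intro!: derivative_eq_intros sum.cong simp: algebra_simps)

lemma cderiv_quad_hessian: "cderiv u (quad_hessian A B e) q = quad_hessian A B e u"
  unfolding quad_hessian_def
  by (rule cderiv_eqI) (auto intro!: derivative_eq_intros sum.cong simp: algebra_simps)

text \<open>Each row r of the stacked matrix is realised by a vector w: the Hessian at w, as a
  function of e, is the pairing of e with cnj r. Two independent rows have a nonzero 2 by 2 minor,
  and Cramer's rule in these two columns gives e1 and e2 dual to the vectors of the two
  rows.\<close>

lemma quad_hessian_nondegenerate:
  fixes A B :: "complex^'n^'n"
  assumes B: "transpose B = B" and rank: "rank (stack_rows (conj_transpose A) B) \<ge> 2"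
  obtains e1 e2 u v where "quad_hessian A B e1 u = 1" "quad_hessian A B e1 v = 0"
    "quad_hessian A B e2 u = 0" "quad_hessian A B e2 v = 1"
proof -
  let ?M = "stack_rows (conj_transpose A) B"
  have ex: "\<exists>w. \<forall>e. quad_hessian A B e w = (\<Sum>i\<in>UNIV. e $ i * cnj (r $ i))" if rM: "r \<in> rows ?M" for r
  proof -
    obtain k where k: "r = ?M $ k" using rM by (auto simp: rows_def row_def vec_lambda_eta)
    show ?thesis
    proof (cases k)
      case (Inl j)
      then have r: "r $ i = cnj (A $ i $ j)" for i by (simp add: k stack_rows_def conj_transpose_def)
      show ?thesis
        by (intro exI[of _ "(axis j 1, 0)"]) (simp add: quad_hessian_def r axis_def mult_delta_right)
    next
      case (Inr j)
      have sym: "B $ i $ j = B $ j $ i" for i using B by (simp add: transpose_def vec_eq_iff)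
      from Inr have r: "r $ i = B $ j $ i" for i by (simp add: k stack_rows_def)
      \<comment> \<open>The row of B enters twice because B is symmetric, hence the 1/2.\<close>
      have "quad_hessian A B e (0, axis j (1/2)) = (\<Sum>i\<in>UNIV. e $ i * cnj (r $ i))" for e
      proof -
        have "quad_hessian A B e (0, axis j (1/2)) =
            (\<Sum>i\<in>UNIV. \<Sum>k\<in>UNIV. e $ i * cnj (B $ i $ k) * axis j (1/2) $ k) +
            (\<Sum>i\<in>UNIV. \<Sum>k\<in>UNIV. axis j (1/2) $ i * cnj (B $ i $ k) * e $ k)"
          by (simp add: quad_hessian_def sum.distrib)
        also have "(\<Sum>i\<in>UNIV. \<Sum>k\<in>UNIV. axis j (1/2) $ i * cnj (B $ i $ k) * e $ k) =
            (\<Sum>k\<in>UNIV. \<Sum>i\<in>UNIV. axis j (1/2) $ i * cnj (B $ i $ k) * e $ k)" by (rule sum.swap)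
        also have "\<dots> = (\<Sum>k\<in>UNIV. 1 / 2 * cnj (B $ j $ k) * e $ k)"
          by (simp add: axis_def mult_delta_left)
        also have "\<dots> = (\<Sum>i\<in>UNIV. e $ i * cnj (r $ i)) / 2"
          by (simp add: r sum_divide_distrib mult.commute)
        also have "(\<Sum>i\<in>UNIV. \<Sum>k\<in>UNIV. e $ i * cnj (B $ i $ k) * axis j (1/2) $ k) = (\<Sum>i\<in>UNIV. e $ i * cnj (r $ i)) / 2"
          by (simp add: axis_def mult_delta_right r sym sum_divide_distrib)
        finally show ?thesis by simp
      qed
      then show ?thesis by blast
    qed
  qed
  have "\<exists>w. \<forall>r\<in>rows ?M. \<forall>e. quad_hessian A B e (w r) = (\<Sum>i\<in>UNIV. e $ i * cnj (r $ i))"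
    by (rule bchoice) (use ex in blast)
  then obtain w where w: "\<And>r e. r \<in> rows ?M \<Longrightarrow> quad_hessian A B e (w r) = (\<Sum>i\<in>UNIV. e $ i * cnj (r $ i))"
    by blast
  obtain X where X: "X \<subseteq> rows ?M" "vec.independent X" "card X = vec.dim (rows ?M)"
    using vec.basis_exists by metis
  then have "card X \<ge> 2" using rank by (simp add: row_rank_def_gen)
  then obtain r1 r2 where r: "r1 \<in> X" "r2 \<in> X" "r1 \<noteq> r2"
    by (metis card_2_iff' obtain_subset_with_card_n subsetD)
  have ind: "vec.independent {r1, r2}" by (rule vec.independent_mono[OF X(2)]) (use r in auto)
  have "\<exists>i j. r1 $ i * r2 $ j - r1 $ j * r2 $ i \<noteq> 0"
  proof (rule ccontr)
    assume "\<not> ?thesis"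
    then have min: "r1 $ i * r2 $ j = r1 $ j * r2 $ i" for i j by simp
    have "r1 \<noteq> 0" using ind vec.dependent_zero by blast
    then obtain i where i: "r1 $ i \<noteq> 0" by (auto simp: vec_eq_iff)
    have "r2 = (r2 $ i / r1 $ i) *s r1" using min[of i] i by (simp add: vec_eq_iff field_simps)
    then have "r2 \<in> vec.span {r1}" by (metis insertI1 vec.span_base vec.span_scale)
    then show False using ind r(3) vec.independent_insert[of r2 "{r1}"] by (simp add: insert_commute)
  qed
  then obtain i j where ij: "r1 $ i * r2 $ j - r1 $ j * r2 $ i \<noteq> 0" by blast
  define y1 where "y1 k = cnj (r1 $ k)" for k
  define y2 where "y2 k = cnj (r2 $ k)" for k
  define D where "D = y1 i * y2 j - y1 j * y2 i"
  have D: "D \<noteq> 0"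
  proof -
    have "D = cnj (r1 $ i * r2 $ j - r1 $ j * r2 $ i)" by (simp add: D_def y1_def y2_def)
    then show ?thesis using ij by (metis complex_cnj_zero_iff)
  qed
  define e :: "complex \<Rightarrow> complex \<Rightarrow> complex^'n" where
    "e a b = (\<chi> k. (if k = i then a else 0) + (if k = j then b else 0))" for a b
  have pair: "(\<Sum>k\<in>UNIV. e a b $ k * y k) = a * y i + b * y j" for a b and y :: "'n \<Rightarrow> complex"
    by (simp add: e_def distrib_right sum.distrib mult_delta_left)
  have h: "quad_hessian A B (e a b) (w r1) = a * y1 i + b * y1 j" "quad_hessian A B (e a b) (w r2) = a * y2 i + b * y2 j" for a b
    using w[of r1 "e a b"] w[of r2 "e a b"] X(1) r pair[of a b] by (auto simp: y1_def y2_def)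
  show ?thesis
  \<comment> \<open>The two coefficient pairs are the rows of the inverse of the 2 by 2 matrix of
    conjugated entries, whose determinant is D.\<close>
  proof (rule that[of "e (y2 j / D) (- y2 i / D)" "w r1" "w r2" "e (- y1 j / D) (y1 i / D)"])
    have "(y2 j / D) * y1 i + (- y2 i / D) * y1 j = (y1 i * y2 j - y1 j * y2 i) / D"
      "(- y1 j / D) * y2 i + (y1 i / D) * y2 j = (y1 i * y2 j - y1 j * y2 i) / D"
      by (simp_all add: diff_divide_distrib mult.commute)
    then show "quad_hessian A B (e (y2 j / D) (- y2 i / D)) (w r1) = 1"
      "quad_hessian A B (e (- y1 j / D) (y1 i / D)) (w r2) = 1" unfolding h D_def[symmetric] using D by simp_all
    show "quad_hessian A B (e (y2 j / D) (- y2 i / D)) (w r2) = 0"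
      "quad_hessian A B (e (- y1 j / D) (y1 i / D)) (w r1) = 0" unfolding h by simp_all
  qed
qed

text \<open>The differential of g at x in direction h is that of G in direction (h, cnj h). Adding
  \<i> times its value at \<i> h cancels the z-part, since \<i> \<i> = -1, and doubles the
  \<xi>-part, since \<i> (- \<i>) = 1.\<close>

lemma dbar_complexified:
  assumes G: "hol G (ball 0 d)" and eq: "\<And>x. (x, cnj_vec x) \<in> ball 0 d \<Longrightarrow> g x = G (x, cnj_vec x)"
    and x: "(x, cnj_vec x) \<in> ball 0 d"
  shows "dbar g x v = cderiv (0, cnj_vec v) G (x, cnj_vec x)"
proof -
  let ?X = "{x. (x, cnj_vec x) \<in> ball 0 d}"
  have "continuous_on UNIV (\<lambda>x. (x, cnj_vec x))"
    by (rule bounded_linear.continuous_on[OF bounded_linear_with_cnj continuous_on_id])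
  from open_vimage[OF open_ball this] have X: "open ?X" by (simp only: vimage_def)
  have "((\<lambda>x. G (x, cnj_vec x)) has_derivative (\<lambda>h. cderiv (h, cnj_vec h) G (x, cnj_vec x))) (at x)"
    by (rule has_derivative_compose[OF bounded_linear_imp_has_derivative[OF bounded_linear_with_cnj]
          hol_has_derivative[OF G open_ball x]])
  then have "(g has_derivative (\<lambda>h. cderiv (h, cnj_vec h) G (x, cnj_vec x))) (at x)"
    by (rule has_derivative_transform_within_open[OF _ X]) (use eq x in auto)
  from fderiv_eq[OF this] have D: "fderiv g x h = cderiv (h, cnj_vec h) G (x, cnj_vec x)" for h by simp
  let ?c = "\<lambda>v. cderiv v G (x, cnj_vec x)"
  have split: "?c (a, b) = ?c (a, 0) + ?c (0, b)" for a b
    using cderiv_add_direction[OF G open_ball x, of "(a, 0)" "(0, b)"] by simp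
  have sc: "?c (c *c a, 0) = c * ?c (a, 0)" "?c (0, c *c a) = c * ?c (0, a)" for c a
    using cderiv_scale[OF G open_ball x, of c "(a, 0)"] cderiv_scale[OF G open_ball x, of c "(0, a)"] by simp_all
  have "fderiv g x v + \<i> * fderiv g x (\<i> *c v) =
      (?c (v, 0) + ?c (0, cnj_vec v)) + \<i> * (\<i> * ?c (v, 0) + (- \<i>) * ?c (0, cnj_vec v))"
    unfolding D cnj_vec_simps(5) complex_cnj_i split[of v "cnj_vec v"] split[of "\<i> *c v" "(- \<i>) *c cnj_vec v"] sc ..
  then show ?thesis by (simp add: dbar_def algebra_simps flip: mult.assoc)
qed

lemma dbar_expand:
  fixes v :: "complex^'n"
  assumes "(g has_derivative fderiv g x) (at x)"
  shows "dbar g x v = (\<Sum>j\<in>UNIV. cnj (v $ j) * dbar g x (axis j 1))"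
proof -
  note cl = dbar_conj_linear[OF assms]
  have z: "dbar g x 0 = 0" using cl(2)[of 0 0] by simp
  have "dbar g x (\<Sum>j\<in>J. v $ j *c axis j 1) = (\<Sum>j\<in>J. cnj (v $ j) * dbar g x (axis j 1))" for J
    by (induction J rule: infinite_finite_induct) (simp_all add: z cl)
  from this[of UNIV] show ?thesis by (simp only: sum_axis)
qed

theorem theorem1p1:
  fixes A B C :: "complex^'n^'n"
    and \<rho> E f :: "complex^'n \<Rightarrow> complex"
    and U :: "(complex^'n) set"
  assumes "CARD('n) \<ge> 2"
    and "open U" and "0 \<in> U"
    and "\<rho> real_analytic_on U"
    and "\<And>z. z \<in> U \<Longrightarrow> \<rho> z = sesq_form A z + cnj (quad_form B z) + quad_form C z + E z"
    and "transpose B = B" and "transpose C = C"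
    and "(\<lambda>z. norm (E z)) \<in> O[nhds 0](\<lambda>z. norm z ^ 3)"
    and "rank (stack_rows (conj_transpose A) B) \<ge> 2"
    and "f real_analytic_on U"
    and "CR_function (graph_over U \<rho>) (\<lambda>p. f (fst p))"
  shows "\<exists>W F. holomorphic_extension_near_0 U \<rho> f W F \<and>
           (\<forall>W' F'. holomorphic_extension_near_0 U \<rho> f W' F' \<longrightarrow>
              (\<forall>\<^sub>F p in nhds 0. F' p = F p))"
proof -
  note U = assms(2,3) and \<rho> = assms(4) and f = assms(10)
  have zz: "(0, 0) = (0 :: (complex^'n) \<times> (complex^'n))" by (simp add: zero_prod_def)
  obtain d1 R where d1: "d1 > 0" "hol R (ball 0 d1)" "\<And>x. (x, cnj_vec x) \<in> ball 0 d1 \<Longrightarrow> \<rho> (0 + x) = R (x, cnj_vec x)"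
    by (rule complexification[OF \<rho> U(2)], rule that)
  obtain d2 G where d2: "d2 > 0" "hol G (ball 0 d2)" "\<And>x. (x, cnj_vec x) \<in> ball 0 d2 \<Longrightarrow> f (0 + x) = G (x, cnj_vec x)"
    by (rule complexification[OF f U(2)], rule that)
  obtain d3 where d3: "d3 > 0" "ball 0 d3 \<subseteq> U" using U open_contains_ball by blast
  obtain K where "\<forall>\<^sub>F z in nhds 0. cmod (E z) \<le> K * norm z ^ 3"
    using assms(8) by (auto elim!: landau_o.bigE)
  then obtain d4 where d4: "d4 > 0" "\<And>z. dist z 0 < d4 \<Longrightarrow> cmod (E z) \<le> K * norm z ^ 3"
    unfolding eventually_nhds_metric by blast
  define d where "d = Min {d1, d2, d3, d4}"
  have d: "d > 0" "d \<le> d1" "d \<le> d2" "d \<le> d3" "d \<le> d4"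
    using d1 d2 d3 d4 by (auto simp: d_def)
  have hR: "hol R (ball 0 d)" by (rule hol_subset[OF d1(2)]) (use d in \<open>auto intro: subset_ball\<close>)
  have hG: "hol G (ball 0 d)" by (rule hol_subset[OF d2(2)]) (use d in \<open>auto intro: subset_ball\<close>)
  have xU: "x \<in> U" "norm x < d" if "(x, cnj_vec x) \<in> ball 0 d" for x
  proof -
    show "norm x < d" using that norm_fst_le[of x "cnj_vec x"] by simp
    then show "x \<in> U" using d d3(2) by (auto simp: subset_iff)
  qed
  have R: "\<rho> x = R (x, cnj_vec x)" and G: "f x = G (x, cnj_vec x)" if "(x, cnj_vec x) \<in> ball 0 d" for x
    using d1(3)[of x] d2(3)[of x] that d by auto
  \<comment> \<open>H is the holomorphic counterpart of the error E; its first and second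
    derivatives vanish at 0, so the Hessian of R there is that of Q.\<close>
  define H where "H q = R q - quad_polarized A B C q" for q
  have hH: "hol H (ball 0 d)" unfolding H_def by (intro hol_intros hR hol_quad_polarized)
  have HE: "H (x, cnj_vec x) = E x" if "(x, cnj_vec x) \<in> ball 0 d" for x
  proof -
    have "R (x, cnj_vec x) = sesq_form A x + cnj (quad_form B x) + quad_form C x + E x"
      unfolding R[OF that, symmetric] by (rule assms(5)[OF xU(1)[OF that]])
    then show ?thesis by (simp add: H_def quad_polarized_real)
  qed
  have H3: "cmod (H (x, cnj_vec x)) \<le> K * norm x ^ 3" if "(x, cnj_vec x) \<in> ball 0 d" for x
    unfolding HE[OF that] using d4(2)[of x] xU(2)[OF that] d by simp
  note Hvan = cubic_derivatives_vanish[OF hH d(1) H3]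
  have b0: "0 \<in> ball (0::(complex^'n) \<times> (complex^'n)) d" using d by simp
  have dR: "cderiv (0, e) R q = cderiv (0, e) H q + quad_hessian A B e q" if "q \<in> ball 0 d" for e q
  proof -
    have "cderiv (0, e) R q = cderiv (0, e) (\<lambda>q. H q + quad_polarized A B C q) q"
      by (rule cderiv_cong[OF open_ball that]) (simp add: H_def)
    then show ?thesis
      using cderiv_add[OF hH hol_quad_polarized open_ball that] by (simp add: cderiv_quad_polarized)
  qed
  have hol_hess: "hol (quad_hessian A B e) S" for e S
    unfolding quad_hessian_def by (intro hol_intros)
  have crit: "cderiv (0, e) R 0 = 0" for e
    using dR[OF b0] Hvan(1) by (simp add: quad_hessian_def)
  have hess: "cderiv w (cderiv (0, e) R) 0 = quad_hessian A B e w" for w e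
    using cderiv_cong[where v = w, OF open_ball b0 dR[where e = e]]
      cderiv_add[where v = w, OF hol_cderiv[where v = "(0, e)", OF hH open_ball] hol_hess[where e = e] open_ball b0] Hvan(2)
    by (simp add: cderiv_quad_hessian)
  have "H (0, cnj_vec 0) = 0" using H3[of 0] b0 by (simp add: zz)
  then have R0: "R 0 = 0" by (simp add: H_def quad_polarized_def zz)
  obtain e1 e2 u v where nd: "quad_hessian A B e1 u = 1" "quad_hessian A B e1 v = 0"
    "quad_hessian A B e2 u = 0" "quad_hessian A B e2 v = 1"
    by (rule quad_hessian_nondegenerate[OF assms(6,9)], rule that)
  note nondeg = nd[folded hess]
  have propRG: "proportional_on (ball 0 d) R G"
    unfolding proportional_on_def
  proof (intro conjI hG ballI allI)
    fix p :: "(complex^'n) \<times> (complex^'n)" and e e'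
    assume p: "p \<in> ball 0 d"
    have "cderiv (0, e) R p * cderiv (0, e') G p - cderiv (0, e') R p * cderiv (0, e) G p = 0"
    \<comment> \<open>The relation is verified at real points \<xi> = cnj x only, where the
      \<xi>-derivatives are antiholomorphic derivatives of \<rho> and f.\<close>
    proof (rule totally_real_zero[OF _ _ p])
      show "hol (\<lambda>p. cderiv (0, e) R p * cderiv (0, e') G p - cderiv (0, e') R p * cderiv (0, e) G p) (ball 0 d)"
        by (intro hol_intros hR hG open_ball)
      fix x :: "complex^'n" assume x: "(x, cnj_vec x) \<in> ball 0 d"
      have xU': "x \<in> U" by (rule xU(1)[OF x])
      have eq: "cderiv (0, c) R (x, cnj_vec x) = (\<Sum>j\<in>UNIV. c $ j * dbar \<rho> x (axis j 1))"
          "cderiv (0, c) G (x, cnj_vec x) = (\<Sum>j\<in>UNIV. c $ j * dbar f x (axis j 1))" for c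
        using dbar_complexified[OF hR R x, of "cnj_vec c"] dbar_complexified[OF hG G x, of "cnj_vec c"]
          dbar_expand[OF real_analytic_has_derivative[OF \<rho> xU'], of "cnj_vec c"]
          dbar_expand[OF real_analytic_has_derivative[OF f xU'], of "cnj_vec c"] by simp_all
      \<comment> \<open>The relations for pairs of coordinate directions extend bilinearly to e and
        e'.\<close>
      have "(\<Sum>i\<in>UNIV. e $ i * dbar \<rho> x (axis i 1)) * (\<Sum>j\<in>UNIV. e' $ j * dbar f x (axis j 1)) =
          (\<Sum>i\<in>UNIV. \<Sum>j\<in>UNIV. e $ i * e' $ j * (dbar \<rho> x (axis i 1) * dbar f x (axis j 1)))"
        unfolding sum_product by (intro sum.cong refl) (simp add: algebra_simps)
      also have "\<dots> = (\<Sum>i\<in>UNIV. \<Sum>j\<in>UNIV. e $ i * e' $ j * (dbar \<rho> x (axis j 1) * dbar f x (axis i 1)))"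
        by (intro sum.cong refl) (subst CR_function_dbar[OF U(1) \<rho> f assms(11) xU'], rule refl)
      also have "\<dots> = (\<Sum>j\<in>UNIV. \<Sum>i\<in>UNIV. e $ i * e' $ j * (dbar \<rho> x (axis j 1) * dbar f x (axis i 1)))"
        by (rule sum.swap)
      also have "\<dots> = (\<Sum>j\<in>UNIV. e' $ j * dbar \<rho> x (axis j 1)) * (\<Sum>i\<in>UNIV. e $ i * dbar f x (axis i 1))"
        unfolding sum_product by (intro sum.cong refl) (simp add: algebra_simps)
      finally show "cderiv (0, e) R (x, cnj_vec x) * cderiv (0, e') G (x, cnj_vec x) -
          cderiv (0, e') R (x, cnj_vec x) * cderiv (0, e) G (x, cnj_vec x) = 0"
        unfolding eq by simp
    qed
    then show "cderiv (0, e) R p * cderiv (0, e') G p = cderiv (0, e') R p * cderiv (0, e) G p" by simp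
  qed
  obtain \<delta> F where \<delta>: "\<delta> > 0" "hol F (ball 0 \<delta>)"
    and F: "\<And>z \<xi>. (z, \<xi>) \<in> ball 0 \<delta> \<Longrightarrow> (z, R (z, \<xi>)) \<in> ball 0 \<delta> \<Longrightarrow> G (z, \<xi>) = F (z, R (z, \<xi>))"
    by (rule holomorphic_factorization[OF hR d(1) propRG R0 crit nondeg], rule that)
  \<comment> \<open>The halving accounts for the bound of the norm of (z, cnj z) by 2 |z|. As W is a
    ball of this radius, every graph point in W lies over a z where both complexifications are
    valid.\<close>
  define \<delta>' where "\<delta>' = min \<delta> d / 2"
  have \<delta>': "\<delta>' > 0" "\<delta>' \<le> \<delta>" "2 * \<delta>' \<le> \<delta>" "2 * \<delta>' \<le> d" using \<delta>(1) d(1) by (auto simp: \<delta>'_def)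
  define W :: "((complex^'n) \<times> complex) set" where "W = ball 0 \<delta>'"
  have FW: "f z = F (z, \<rho> z)" if z: "z \<in> U" "(z, \<rho> z) \<in> W" for z
  proof -
    have "norm z < \<delta>'" using z(2) norm_fst_le[of z "\<rho> z"] by (simp add: W_def)
    moreover have "norm (z, cnj_vec z) \<le> norm z + norm (cnj_vec z)" by (rule norm_Pair_le)
    ultimately have n: "norm (z, cnj_vec z) < 2 * \<delta>'" by simp
    then have zd: "(z, cnj_vec z) \<in> ball 0 d" "(z, cnj_vec z) \<in> ball 0 \<delta>" using \<delta>' by simp_all
    have "(z, R (z, cnj_vec z)) \<in> ball 0 \<delta>" using z(2) \<delta>' R[OF zd(1)] by (simp add: W_def)
    then show ?thesis using F[OF zd(2)] R[OF zd(1)] G[OF zd(1)] by simp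
  qed
  have "F holomorphic_several_on W"
    unfolding holomorphic_several_on_def
  proof
    fix p assume "p \<in> W"
    then have p: "p \<in> ball 0 \<delta>" using \<delta>' by (simp add: W_def)
    show "\<exists>D. (F has_derivative D) (at p) \<and> (\<forall>c v. D (cmult c v) = c * D v)"
      unfolding cmult_eq_scaleC
      using hol_has_derivative[OF \<delta>(2) open_ball p] cderiv_scale[OF \<delta>(2) open_ball p] by blast
  qed
  then have ext: "holomorphic_extension_near_0 U \<rho> f W F"
    using FW \<delta>' by (simp add: holomorphic_extension_near_0_def W_def)
  have "\<forall>\<^sub>F p in nhds 0. F' p = F p" if ext': "holomorphic_extension_near_0 U \<rho> f W' F'" for W' F'
  proof -
    have W': "open W'" "0 \<in> W'" "F' holomorphic_several_on W'"
      and FW': "\<And>z. z \<in> U \<Longrightarrow> (z, \<rho> z) \<in> W' \<Longrightarrow> f z = F' (z, \<rho> z)"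
      using ext' by (auto simp: holomorphic_extension_near_0_def)
    have "\<forall>p\<in>W'. \<exists>D. (F' has_derivative D) (at p) \<and> (\<forall>c v. D (c *c v) = c * D v)"
      using W'(3) unfolding holomorphic_several_on_def cmult_eq_scaleC .
    then obtain D where "\<And>p. p \<in> W' \<Longrightarrow> (F' has_derivative D p) (at p)" "\<And>p c v. p \<in> W' \<Longrightarrow> D p (c *c v) = c * D p v"
      by metis
    then have hF': "hol F' W'" by (intro hol_of_has_derivative(1)[OF W'(1)])
    have "open (W \<inter> W')" "0 \<in> W \<inter> W'" using W' \<delta>' by (auto simp: W_def)
    then obtain \<eta> where \<eta>: "\<eta> > 0" "ball 0 \<eta> \<subseteq> W \<inter> W'" using open_contains_ball by blast
    define J where "J x = F' x - F x" for x
    have hJ: "hol J (ball 0 \<eta>)"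
      unfolding J_def by (intro hol_intros hol_subset[OF hF'] hol_subset[OF \<delta>(2)]) (use \<eta> \<delta>' in \<open>auto simp: W_def\<close>)
    obtain D' where D': "D' > 0" "D' \<le> d" and \<Psi>: "\<And>q. q \<in> ball 0 D' \<Longrightarrow> (fst q, R q) \<in> ball 0 \<eta>"
      by (rule graph_map_in_ball[OF hR d(1) R0 \<eta>(1)]) (rule that)
    have hRD': "hol R (ball 0 D')" by (rule hol_subset[OF hR]) (use D' in \<open>auto intro: subset_ball\<close>)
    \<comment> \<open>The difference J of the two extensions is known to vanish only on M, that is,
      for \<xi> = cnj z. Holomorphy of the composite extends this to all (z, \<xi>), which is the
      form that \<open>factorization_unique\<close> takes.\<close>
    have "hol (\<lambda>q. J (fst q, R q)) (ball 0 D')"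
    proof (rule hol_of_has_derivative(1)[where D = "\<lambda>q v. cderiv (fst v, cderiv v R q) J (fst q, R q)"])
      fix q :: "(complex^'n) \<times> (complex^'n)" assume q: "q \<in> ball 0 D'"
      have "((\<lambda>q. (fst q, R q)) has_derivative (\<lambda>v. (fst v, cderiv v R q))) (at q)"
        by (intro has_derivative_Pair has_derivative_fst has_derivative_ident hol_has_derivative[OF hRD' open_ball q])
      then show "((\<lambda>q. J (fst q, R q)) has_derivative (\<lambda>v. cderiv (fst v, cderiv v R q) J (fst q, R q))) (at q)"
        by (rule has_derivative_compose) (rule hol_has_derivative[OF hJ open_ball \<Psi>[OF q]])
      show "cderiv (fst (c *c v), cderiv (c *c v) R q) J (fst q, R q) = c * cderiv (fst v, cderiv v R q) J (fst q, R q)" for c v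
        using cderiv_scale[OF hJ open_ball \<Psi>[OF q], of c "(fst v, cderiv v R q)"]
        by (simp add: cderiv_scale[OF hRD' open_ball q])
    qed simp
    then have van: "J (fst q, R q) = 0" if "q \<in> ball 0 D'" for q
    proof (rule totally_real_zero[OF _ _ that])
      fix x :: "complex^'n" assume x: "(x, cnj_vec x) \<in> ball 0 D'"
      then have xd: "(x, cnj_vec x) \<in> ball 0 d" using D' by simp
      have "(x, \<rho> x) \<in> W \<inter> W'" using \<Psi>[OF x] \<eta>(2) R[OF xd] by auto
      then show "J (fst (x, cnj_vec x), R (x, cnj_vec x)) = 0"
        using FW[OF xU(1)[OF xd]] FW'[OF xU(1)[OF xd]] R[OF xd] by (simp add: J_def)
    qed
    obtain \<epsilon> where "\<epsilon> > 0" "\<And>x. x \<in> ball 0 \<epsilon> \<Longrightarrow> J x = 0"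
    proof (rule factorization_unique[OF hRD' D'(1) R0 nondeg hJ \<eta>(1)])
      show "J (z, R (z, \<xi>)) = 0" if "(z, \<xi>) \<in> ball 0 D'" for z \<xi> using van[OF that] by simp
    qed (rule that)
    then have "\<forall>\<^sub>F p in nhds 0. J p = 0"
      by (intro eventually_nhds_in_open[of "ball 0 \<epsilon>", THEN eventually_mono]) auto
    then show ?thesis by eventually_elim (simp add: J_def)
  qed
  with ext show ?thesis by blast
qed

end
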